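(* Let $0<q<1$, $N,n\ge1$ finite and $m\ge2N$. Put $\mathbb R_q=\mathbb U_q^+(\mathbb U_q^-)^{-1}$, $\mathbb R_i=(I+\mathbb H_i^+)(I-\mathbb H_i^-)$, $\mathscr K_i(X)=\mathbb R_iX\mathbb R_i^{-1}-X$ for operators $X$ on $\mathcal M$, and $\boldsymbol\Omega_{j}=\mathbb R_q\mathbb A_j^-\mathbb R_q^{-1}-\mathbb A_j^-$. Then for every label $j$, $$\boldsymbol\Omega_{j}=\Big[\prod_{i=1}^N(I+\mathscr K_i)-I\Big](\mathbb A_j^-)=\sum_{\varnothing\ne I\subseteq\{1,\dots,N\}}\mathscr K_I(\mathbb A_j^-),\qquad \mathscr K_I:=\prod_{i\in I}\mathscr K_i,$$ and the order of the factors in $\mathscr K_I$ is irrelevant. Hence every term of filtration $\geq 2$ (i.e. every summand with $|I|\ge2$) is a finite subset product of the same labelwise defects $\mathscr K_i$.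
   Context: **Coordinates.** $[r]_q=\frac{1-q^r}{1-q}$, $c_r=\frac12[2r]_q$. For $1\le k\le N$, $1\le a\le m$ let $z_{ka},\bar z_{ka}$ be independent commuting variables; $f_a,f_a^\dagger$ is a Witt basis of the complex Clifford algebra $\mathrm{Cl}_{2m}$: $\{f_a,f_b\}=\{f_a^\dagger,f_b^\dagger\}=0$, $\{f_a,f_b^\dagger\}=\delta_{ab}$. $\mathscr P^{\rm Cl}_{m,N}=\mathbb C[z_{ka},\bar z_{ka}]\otimes\mathrm{Cl}_{2m}$ ($\mathbb Z_2$-graded by Clifford parity). $\partial_{Z_k}=\sum_af_a^\dagger\partial_{z_{ka}}$, $\partial_{Z_k^\dagger}=\sum_af_a\partial_{\bar z_{ka}}$ (Clifford elements act by left multiplication). $\ddagger$ is the order-preserving antilinear involution $z\leftrightarrow\bar z$, $f_a\leftrightarrow f_a^\dagger$, $\vartheta\leftrightarrow\bar\vartheta$, $a\leftrightarrow b$ (fermionic symbols below), and $X^\ddagger=\ddagger X\ddagger$ on operators. **Capelli contractions.** $\delta_a$ is the odd antiderivation of Clifford coefficients with $\delta_a(f_b)=\delta_{ab}$, $\delta_a(f_b^\dagger)=0$. $\mathfrak s_i=\sum_a\delta_a\partial_{z_{ia}}$, $\mathcal E^z_{ji}=\sum_az_{ja}\partial_{z_{ia}}$, $(\mathcal C_z)_{ij}=m\delta_{ij}+\mathcal E^z_{ji}$ (an $N\times N$ matrix of operators, invertible on columns of polynomials in each homogeneous degree for $m\ge2N$). $\mathfrak n_i^+=\sum_\ell(\mathcal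 C_z^{-1})_{i\ell}\mathfrak s_\ell$, $\mathfrak n_i^-=(\mathfrak n_i^+)^\ddagger$. **Fermionic data.** One pair: Grassmann generators $\vartheta,\bar\vartheta$ (odd), Weyl generators $a,b$ (even), $ab-ba=-2i$, $B=ba-i$. Put $s=\frac1nq^{2m-2n}[2n]_q$, $\sigma R(B)=R(B+2i)$; $\mathcal A_s^{\min}$ is the localization of $\mathbb C[B]$ at the multiplicative set generated by $\sigma^k(B-i),\sigma^k(s-2iB),\sigma^k(s+2iB)$, $k\in\mathbb Z$. $x_j=a^j$ ($j\ge0$), $x_j=b^{-j}$ ($j<0$); $\beta_j(B)=B+(2j-1)i$ for $j\ge1$ and $1$ for $j\le0$; $\alpha_j(B)=1$ for $j\ge0$ and $B+(2j+1)i$ for $j\le-1$. The charge-$c$ module ($c\in\mathbb Z$) is the free right $\mathcal A_s^{\min}$-module on $e_{0,c}=x_c$, $e_{\vartheta,c}=\vartheta x_{c+1}$, $e_{\bar\vartheta,c}=\bar\vartheta x_{c-1}$, $e_{2,c}=\vartheta\bar\vartheta x_c$. $\Phi_s(B)=\frac{4-s+2iB}{B-i}$, $\Psi_s(B)=\frac{-s-2iB}{B-i}$, $\sigma_c^+(B)=\beta_{c+1}(B)\Phi_s(B+2i(c+1))$, $\sigma_c^-(B)=\alpha_{c-1}(B)\Psi_s(B+2ic)$, $\pi_c^\pm=-\frac14\sigma_c^\pm$. Right-linear maps (zero on unlisted basis vectors): $\mathbb Q_c^+:e_{\vartheta,c}\mapsto e_{0,c}\pi_c^+,\ e_{2,c}\mapsto\frac1{2i}e_{\bar\vartheta,c}\beta_c$;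 $\mathbb h_c^+:e_{0,c}\mapsto e_{\vartheta,c}(\pi_c^+)^{-1},\ e_{\bar\vartheta,c}\mapsto2i\,e_{2,c}\beta_c^{-1}$. The minus maps are the $\ddagger$-conjugates ($c\leftrightarrow-c$): $\mathbb Q_c^-:e_{\bar\vartheta,c}\mapsto e_{0,c}\pi_c^-,\ e_{2,c}\mapsto\frac1{2i}e_{\vartheta,c}\alpha_c$; $\mathbb h_c^-:e_{0,c}\mapsto e_{\bar\vartheta,c}(\pi_c^-)^{-1},\ e_{\vartheta,c}\mapsto2i\,e_{2,c}\alpha_c^{-1}$. For $n$ pairs and $\mathbf c\in\mathbb Z^n$ take the graded tensor product of the one-pair modules; $\mathbb Q^\pm=\sum_j\widehat{\mathbb Q}_j^\pm$, $\mathbb h^\pm=\frac1n\sum_j\widehat{\mathbb h}_j^\pm$ (hats: graded embeddings in factor $j$). Let $\widehat{\mathsf P}_j^+$ be the projector on the span of $e_{\bar\vartheta,c_j},e_{2,c_j}$ in factor $j$ (killing $e_{0,c_j},e_{\vartheta,c_j}$), $\mathsf P_S^+=\prod_{j\in S}\widehat{\mathsf P}_j^+\prod_{j\notin S}(I-\widehat{\mathsf P}_j^+)$; $\kappa_c^+=-\frac14\sigma_c^+\alpha_c$, $K_c=\frac1{2i}\alpha_{c-1}\beta_c$, $\delta_m(q)=\frac{2m-[2m]_q}4$, and $$\mathbb M^+=\delta_m(q)I+\sum_{\varnothing\ne S}\mathsf P_S^+\Big(\sum_{j\in S}\kappa_{c_j}^+-|S|-B_q^{(|S|)}(E_{\bar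 z})\sum_{j\in S}K_{c_j}\Big),\qquad \mathbb N^+=-\mathbb h^+\mathbb M^+,$$ where $B_q^{(k)}(E_{\bar z})$ is the scalar $\frac{c_{r+k}}{r+k}$ on bosonic elements of antiholomorphic Euler degree $r$. $\mathbb M^-,\mathbb N^-$ are the $\ddagger$-conjugates (depending on the holomorphic Euler degree). $\mathscr F_k$ ($1\le k\le N$) is a copy, for label $k$, of the direct sum over $\mathbf c\in\mathbb Z^n$ of these modules; $\mathbb Q_k^\pm,\mathbb N_k^\pm$ are the corresponding operators, the Euler degree in $\mathbb N_k^+$ (resp. $\mathbb N_k^-$) being that in the variables $\bar z_k$ (resp. $z_k$), its coefficient acting on the bosonic factor. **Transport.** $\mathcal M=\mathscr P^{\rm Cl}_{m,N}\widehat\otimes\mathscr F_1\widehat\otimes\cdots\widehat\otimes\mathscr F_N$. With $(X\widehat\otimes Y)(F\otimes e)=(-1)^{|Y||F|}XF\otimes Ye$: $\mathbb A_k^+=\partial_{Z_k}\widehat\otimes I+I\widehat\otimes\mathbb Q_k^+$, $\mathbb A_k^-=(\mathbb A_k^+)^\ddagger$; $\mathbb H_i^\pm=\mathfrak n_i^\pm\widehat\otimes\mathbb N_i^\pm$, $\mathbb U_q^\pm=\exp(\sum_{i=1}^N\mathbb H_i^\pm)$. *)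

theory Defs
  imports
    Complex_Main
    "HOL-Library.Poly_Mapping"
    "HOL-Library.Nat_Bijection"
    "HOL-Computational_Algebra.Fraction_Field"
begin

section \<open>Free modules with a given basis\<close>

text \<open>\<^typ>\<open>'b \<Rightarrow>\<^sub>0 'r\<close> is the free \<open>'r\<close>-module on \<open>'b\<close>, with basis vectors
  \<open>Poly_Mapping.single b 1\<close>.\<close>

definition smul :: "'r::mult_zero \<Rightarrow> ('b \<Rightarrow>\<^sub>0 'r) \<Rightarrow> ('b \<Rightarrow>\<^sub>0 'r)" where
  "smul c v = Poly_Mapping.map ((*) c) v"

definition lin_ext :: "('b \<Rightarrow> ('c \<Rightarrow>\<^sub>0 'r)) \<Rightarrow> ('b \<Rightarrow>\<^sub>0 'r) \<Rightarrow> ('c \<Rightarrow>\<^sub>0 'r::comm_ring_1)" where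
  "lin_ext \<phi> v = (\<Sum>b\<in>Poly_Mapping.keys v. smul (Poly_Mapping.lookup v b) (\<phi> b))"

lemma lookup_smul [simp]: "Poly_Mapping.lookup (smul c v) b = c * Poly_Mapping.lookup v b"
  for v :: "'b \<Rightarrow>\<^sub>0 'r::mult_zero"
  unfolding smul_def by transfer (simp add: when_def)

lemma smul_add: "smul c (u + v) = smul c u + smul c v" for u :: "'b \<Rightarrow>\<^sub>0 'r::comm_ring_1"
  by (rule poly_mapping_eqI) (simp add: lookup_add algebra_simps)

lemma smul_add_left: "smul (c + d) u = smul c u + smul d u" for u :: "'b \<Rightarrow>\<^sub>0 'r::comm_ring_1"
  by (rule poly_mapping_eqI) (simp add: lookup_add algebra_simps)

lemma smul_zero [simp]: "smul c 0 = 0" "smul 0 u = 0" for u :: "'b \<Rightarrow>\<^sub>0 'r::comm_ring_1"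
  by (rule poly_mapping_eqI, simp)+

lemma smul_smul: "smul c (smul d u) = smul (c * d) u" for u :: "'b \<Rightarrow>\<^sub>0 'r::comm_ring_1"
  by (rule poly_mapping_eqI) (simp add: algebra_simps)

lemma smul_one [simp]: "smul 1 u = u" for u :: "'b \<Rightarrow>\<^sub>0 'r::comm_ring_1"
  by (rule poly_mapping_eqI) simp

lemma smul_single: "smul c (Poly_Mapping.single b d) = Poly_Mapping.single b (c * d)"
  for c d :: "'r::comm_ring_1"
  by (rule poly_mapping_eqI) (simp add: lookup_single when_def)

lemma smul_sum: "smul c (\<Sum>i\<in>I. u i) = (\<Sum>i\<in>I. smul c (u i))"
  for u :: "'i \<Rightarrow> 'b \<Rightarrow>\<^sub>0 'r::comm_ring_1"
  by (induction I rule: infinite_finite_induct) (simp_all add: smul_add)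

lemma lin_ext_superset:
  assumes "finite A" "Poly_Mapping.keys v \<subseteq> A"
  shows "lin_ext \<phi> v = (\<Sum>b\<in>A. smul (Poly_Mapping.lookup v b) (\<phi> b))"
  unfolding lin_ext_def
  by (rule sum.mono_neutral_left) (use assms in \<open>auto simp: in_keys_iff\<close>)

lemma lin_ext_zero [simp]: "lin_ext \<phi> 0 = 0"
  by (simp add: lin_ext_def)

lemma lin_ext_single [simp]: "lin_ext \<phi> (Poly_Mapping.single b c) = smul c (\<phi> b)"
  by (subst lin_ext_superset[of "{b}"]) auto

lemma lin_ext_add: "lin_ext \<phi> (u + v) = lin_ext \<phi> u + lin_ext \<phi> v"
proof -
  let ?A = "Poly_Mapping.keys u \<union> Poly_Mapping.keys v"
  have "Poly_Mapping.keys (u + v) \<subseteq> ?A" by (rule keys_add)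
  then show ?thesis
    by (simp add: lin_ext_superset[of ?A] lookup_add smul_add_left sum.distrib)
qed

lemma lin_ext_smul: "lin_ext \<phi> (smul c u) = smul c (lin_ext \<phi> u)"
proof -
  have "Poly_Mapping.keys (smul c u) \<subseteq> Poly_Mapping.keys u" by (auto simp: in_keys_iff)
  then show ?thesis
    by (simp add: lin_ext_superset[of "Poly_Mapping.keys u"] smul_smul smul_sum)
qed

lemma lin_ext_fun_add: "lin_ext (\<lambda>b. \<phi> b + \<psi> b) u = lin_ext \<phi> u + lin_ext \<psi> u"
  by (simp add: lin_ext_def smul_add sum.distrib)

lemma lin_ext_fun_smul: "lin_ext (\<lambda>b. smul c (\<phi> b)) u = smul c (lin_ext \<phi> u)"
  by (simp add: lin_ext_def smul_smul smul_sum mult.commute)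

lemma poly_mapping_expand:
  "v = (\<Sum>b\<in>Poly_Mapping.keys v. Poly_Mapping.single b (Poly_Mapping.lookup v b))"
  for v :: "'b \<Rightarrow>\<^sub>0 'r::comm_monoid_add"
  by (rule poly_mapping_eqI) (auto simp: lookup_sum lookup_single when_def in_keys_iff)

lemma keys_induct [consumes 1, case_names zero single add]:
  fixes v :: "'b \<Rightarrow>\<^sub>0 'r::comm_monoid_add"
  assumes "Poly_Mapping.keys v \<subseteq> A" "P 0" "\<And>b c. b \<in> A \<Longrightarrow> P (Poly_Mapping.single b c)"
    and "\<And>u w. P u \<Longrightarrow> P w \<Longrightarrow> P (u + w)"
  shows "P v"
proof -
  have "finite I \<Longrightarrow> I \<subseteq> A \<Longrightarrow> P (\<Sum>b\<in>I. Poly_Mapping.single b (f b))" for I and f :: "'b \<Rightarrow> 'r"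
    by (induction I rule: finite_induct) (use assms in auto)
  from this[OF finite_keys assms(1)] show ?thesis
    by (subst poly_mapping_expand)
qed


section \<open>Clifford-valued polynomials\<close>

text \<open>The Clifford algebra is realized on the anticommuting generators
  \<open>e\<^sub>2\<^sub>a = f\<^sub>a + f\<^sub>a\<^sup>\<dagger>\<close> (square \<open>1\<close>) and \<open>e\<^sub>2\<^sub>a\<^sub>+\<^sub>1 = f\<^sub>a - f\<^sub>a\<^sup>\<dagger>\<close> (square \<open>-1\<close>), with basis the
  increasing words \<open>e\<^sub>S\<close> for finite sets \<open>S\<close> of indices.  The basis element
  \<open>(\<mu>, \<nu>, S)\<close> stands for \<open>z\<^sup>\<mu> zbar\<^sup>\<nu> e\<^sub>S\<close>; the exponent maps are indexed by pairs \<open>(k, a)\<close>.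
  In this basis \<open>\<ddagger>\<close> is diagonal on words.\<close>

type_synonym expo = "nat \<times> nat \<Rightarrow>\<^sub>0 nat"
type_synonym pbase = "expo \<times> expo \<times> nat set"
type_synonym pcl = "pbase \<Rightarrow>\<^sub>0 complex"

definition chi :: "nat \<Rightarrow> nat \<Rightarrow> complex" where
  "chi i j = (if j < i \<or> (j = i \<and> odd i) then - 1 else 1)"

text \<open>\<open>e\<^sub>S e\<^sub>T = cl_sign S T e\<^bsub>S \<triangle> T\<^esub>\<close>: one sign for each pair that has to be
  interchanged, and the squares of the common generators.\<close>

definition cl_sign :: "nat set \<Rightarrow> nat set \<Rightarrow> complex" where
  "cl_sign S T = (\<Prod>i\<in>S. \<Prod>j\<in>T. chi i j)"

definition symdiff :: "'a set \<Rightarrow> 'a set \<Rightarrow> 'a set" where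
  "symdiff S T = (S - T) \<union> (T - S)"

fun pbase_mul :: "pbase \<Rightarrow> pbase \<Rightarrow> pcl" where
  "pbase_mul (\<mu>, \<nu>, S) (\<mu>', \<nu>', T) =
     Poly_Mapping.single (\<mu> + \<mu>', \<nu> + \<nu>', symdiff S T) (cl_sign S T)"

definition pmul :: "pcl \<Rightarrow> pcl \<Rightarrow> pcl" where
  "pmul x y = lin_ext (\<lambda>b. lin_ext (pbase_mul b) y) x"

definition pone :: pcl where
  "pone = Poly_Mapping.single (0, 0, {}) 1"

definition cl_gen :: "nat \<Rightarrow> pcl" where
  "cl_gen i = Poly_Mapping.single (0, 0, {i}) 1"

definition witt_f :: "nat \<Rightarrow> pcl" where
  "witt_f a = smul (1/2) (cl_gen (2 * a) + cl_gen (2 * a + 1))"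

definition witt_fd :: "nat \<Rightarrow> pcl" where
  "witt_fd a = smul (1/2) (cl_gen (2 * a) - cl_gen (2 * a + 1))"

definition zvar :: "nat \<Rightarrow> nat \<Rightarrow> pcl" where
  "zvar k a = Poly_Mapping.single (Poly_Mapping.single (k, a) 1, 0, {}) 1"

fun pparity :: "pbase \<Rightarrow> nat" where
  "pparity (\<mu>, \<nu>, S) = card S mod 2"

definition grade_inv :: "pcl \<Rightarrow> pcl" where
  "grade_inv = lin_ext (\<lambda>b. Poly_Mapping.single b ((- 1) ^ pparity b))"

definition pbasis :: "nat \<Rightarrow> nat \<Rightarrow> pbase set" where
  "pbasis m N = {(\<mu>, \<nu>, S). Poly_Mapping.keys \<mu> \<subseteq> {1..N} \<times> {1..m} \<and>
     Poly_Mapping.keys \<nu> \<subseteq> {1..N} \<times> {1..m} \<and> S \<subseteq> {2..2 * m + 1}}"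

definition PCl :: "nat \<Rightarrow> nat \<Rightarrow> pcl set" where
  "PCl m N = {F. Poly_Mapping.keys F \<subseteq> pbasis m N}"

definition dz :: "nat \<Rightarrow> nat \<Rightarrow> pcl \<Rightarrow> pcl" where
  "dz k a = lin_ext (\<lambda>(\<mu>, \<nu>, S).
     Poly_Mapping.single (\<mu> - Poly_Mapping.single (k, a) 1, \<nu>, S)
       (of_nat (Poly_Mapping.lookup \<mu> (k, a))))"

text \<open>The antilinear involution on the bosonic side, exchanging \<open>z\<close> with \<open>zbar\<close> and
  \<open>f\<^sub>a\<close> with \<open>f\<^sub>a\<^sup>\<dagger>\<close>; thus it fixes \<open>e\<^sub>2\<^sub>a\<close> and negates \<open>e\<^sub>2\<^sub>a\<^sub>+\<^sub>1\<close>.\<close>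

definition pdag :: "pcl \<Rightarrow> pcl" where
  "pdag F = lin_ext (\<lambda>(\<mu>, \<nu>, S). Poly_Mapping.single (\<nu>, \<mu>, S) ((- 1) ^ card {i \<in> S. odd i}))
     (Poly_Mapping.map cnj F)"

definition dirac :: "nat \<Rightarrow> nat \<Rightarrow> pcl \<Rightarrow> pcl" where
  "dirac m k F = (\<Sum>a=1..m. pmul (witt_fd a) (dz k a F))"

text \<open>The odd antiderivation \<open>\<delta>\<^sub>a\<close> is the graded commutator with \<open>f\<^sub>a\<^sup>\<dagger>\<close>; its characterizing
  properties are proved in \<open>delta_witt\<close> and \<open>delta_antiderivation\<close> below.\<close>

definition delta :: "nat \<Rightarrow> pcl \<Rightarrow> pcl" where
  "delta a F = pmul (witt_fd a) F - pmul (grade_inv F) (witt_fd a)"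

subsection \<open>The Clifford relations and the characterization of \<open>\<delta>\<^sub>a\<close>\<close>

definition fin_words :: "pbase set" where
  "fin_words = {(\<mu>, \<nu>, S). finite S}"

lemma prod_symdiff:
  fixes g :: "'a \<Rightarrow> complex"
  assumes "finite S" "finite T" "\<And>i. g i * g i = 1"
  shows "(\<Prod>i\<in>symdiff S T. g i) = (\<Prod>i\<in>S. g i) * (\<Prod>i\<in>T. g i)"
proof -
  have S: "(\<Prod>i\<in>S. g i) = (\<Prod>i\<in>S - T. g i) * (\<Prod>i\<in>S \<inter> T. g i)"
    by (subst prod.union_disjoint [symmetric]) (use assms in \<open>auto intro: arg_cong2[of _ _ _ _ prod]\<close>)
  have T: "(\<Prod>i\<in>T. g i) = (\<Prod>i\<in>T - S. g i) * (\<Prod>i\<in>S \<inter> T. g i)"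
    by (subst prod.union_disjoint [symmetric]) (use assms in \<open>auto intro: arg_cong2[of _ _ _ _ prod]\<close>)
  have "(\<Prod>i\<in>S \<inter> T. g i) * (\<Prod>i\<in>S \<inter> T. g i) = 1"
    by (simp add: prod.distrib [symmetric] assms)
  moreover have "(\<Prod>i\<in>symdiff S T. g i) = (\<Prod>i\<in>S - T. g i) * (\<Prod>i\<in>T - S. g i)"
    unfolding symdiff_def by (rule prod.union_disjoint) (use assms in auto)
  ultimately show ?thesis unfolding S T by (simp add: algebra_simps)
qed

lemma chi_square: "chi i j * chi i j = 1"
  by (simp add: chi_def)

lemma cl_sign_square: "finite S \<Longrightarrow> finite T \<Longrightarrow> cl_sign S T * cl_sign S T = 1"
  by (simp add: cl_sign_def prod.distrib [symmetric] chi_square)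

lemma cl_sign_symdiff_left:
  assumes "finite S" "finite T" "finite U"
  shows "cl_sign (symdiff S T) U = cl_sign S U * cl_sign T U"
  unfolding cl_sign_def
  by (rule prod_symdiff) (use assms in \<open>simp_all add: prod.distrib [symmetric] chi_square\<close>)

lemma cl_sign_symdiff_right:
  assumes "finite S" "finite T" "finite U"
  shows "cl_sign S (symdiff T U) = cl_sign S T * cl_sign S U"
  unfolding cl_sign_def
  by (subst prod_symdiff) (use assms in \<open>simp_all add: prod.distrib [symmetric] chi_square\<close>)

lemma symdiff_assoc: "symdiff (symdiff S T) U = symdiff S (symdiff T U)"
  by (auto simp: symdiff_def)

lemma finite_symdiff [simp]: "finite S \<Longrightarrow> finite T \<Longrightarrow> finite (symdiff S T)"
  by (simp add: symdiff_def)

lemma pmul_add_left: "pmul (x + y) w = pmul x w + pmul y w"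
  by (simp add: pmul_def lin_ext_add)

lemma pmul_add_right: "pmul w (x + y) = pmul w x + pmul w y"
  by (simp add: pmul_def lin_ext_add lin_ext_fun_add)

lemma pmul_zero [simp]: "pmul 0 x = 0" "pmul x 0 = 0"
  by (simp_all add: pmul_def lin_ext_def)

lemma pmul_smul_left: "pmul (smul c x) y = smul c (pmul x y)"
  by (simp add: pmul_def lin_ext_smul)

lemma pmul_smul_right: "pmul x (smul c y) = smul c (pmul x y)"
  by (simp add: pmul_def lin_ext_smul lin_ext_fun_smul)

lemma pmul_single:
  "pmul (Poly_Mapping.single b c) (Poly_Mapping.single b' d) = smul (c * d) (pbase_mul b b')"
  by (simp add: pmul_def smul_smul)

lemma pmul_assoc_single:
  assumes "finite S" "finite T" "finite U"
  shows "pmul (pmul (Poly_Mapping.single (\<mu>1, \<nu>1, S) c1) (Poly_Mapping.single (\<mu>2, \<nu>2, T) c2))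
            (Poly_Mapping.single (\<mu>3, \<nu>3, U) c3) =
         pmul (Poly_Mapping.single (\<mu>1, \<nu>1, S) c1)
            (pmul (Poly_Mapping.single (\<mu>2, \<nu>2, T) c2) (Poly_Mapping.single (\<mu>3, \<nu>3, U) c3))"
  using assms
  by (simp add: pmul_single smul_single symdiff_assoc cl_sign_symdiff_left cl_sign_symdiff_right
      add.assoc algebra_simps)

lemma pmul_assoc:
  assumes "Poly_Mapping.keys x \<subseteq> fin_words" "Poly_Mapping.keys y \<subseteq> fin_words"
    "Poly_Mapping.keys w \<subseteq> fin_words"
  shows "pmul (pmul x y) w = pmul x (pmul y w)"
  using assms(1)
proof (induction x rule: keys_induct)
  case (single b c)
  from assms(2) show ?case
  proof (induction y rule: keys_induct)
    case (single b' c')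
    from assms(3) show ?case
    proof (induction w rule: keys_induct)
      case (single b'' c'')
      with \<open>b \<in> fin_words\<close> \<open>b' \<in> fin_words\<close> show ?case
        unfolding fin_words_def using pmul_assoc_single by auto
    qed (simp_all add: pmul_add_right)
  qed (simp_all add: pmul_add_right pmul_add_left)
qed (simp_all add: pmul_add_left)

lemma pone_mul [simp]: "pmul pone x = x" "pmul x pone = x"
proof -
  have l: "pmul pone (Poly_Mapping.single (\<mu>, \<nu>, S) c) = Poly_Mapping.single (\<mu>, \<nu>, S) c"
    and r: "pmul (Poly_Mapping.single (\<mu>, \<nu>, S) c) pone = Poly_Mapping.single (\<mu>, \<nu>, S) c"
    for \<mu> \<nu> S c
    by (simp_all add: pone_def pmul_single smul_single cl_sign_def symdiff_def)
  have U: "Poly_Mapping.keys x \<subseteq> UNIV" by simp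
  from U show "pmul pone x = x"
    by (induction x rule: keys_induct) (auto simp: l pmul_add_right)
  from U show "pmul x pone = x"
    by (induction x rule: keys_induct) (auto simp: r pmul_add_left)
qed

lemma cl_gen_square: "pmul (cl_gen i) (cl_gen i) = smul (if odd i then - 1 else 1) pone"
  by (simp add: cl_gen_def pone_def pmul_single smul_single cl_sign_def chi_def symdiff_def)

lemma cl_gen_anticomm:
  assumes "i \<noteq> j"
  shows "pmul (cl_gen i) (cl_gen j) + pmul (cl_gen j) (cl_gen i) = 0"
  using assms
  by (auto simp: cl_gen_def pmul_single smul_single cl_sign_def chi_def symdiff_def insert_commute
      insert_Diff_if single_add [symmetric])

lemma pmul_minus: "pmul (- x) y = - pmul x y" "pmul x (- y) = - pmul x y"
proof -
  have n: "- u = smul (- 1) u" for u :: pcl by (rule poly_mapping_eqI) simp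
  show "pmul (- x) y = - pmul x y" "pmul x (- y) = - pmul x y"
    by (simp_all add: n pmul_smul_left pmul_smul_right)
qed

lemma pmul_diff: "pmul (x - y) w = pmul x w - pmul y w" "pmul w (x - y) = pmul w x - pmul w y"
  using pmul_add_left[of x "- y" w] pmul_add_right[of w x "- y"] by (simp_all add: pmul_minus)

lemma cl_gen_anticommutator:
  "pmul (cl_gen i) (cl_gen j) + pmul (cl_gen j) (cl_gen i) =
     (if i = j then smul (if odd i then - 2 else 2) pone else 0)"
  by (auto simp: cl_gen_anticomm cl_gen_square smul_add_left [symmetric])

lemma witt_anticomm_aux:
  fixes \<epsilon> \<eta> :: complex
  shows "pmul (smul (1/2) (cl_gen (2*a) + smul \<epsilon> (cl_gen (2*a+1))))
              (smul (1/2) (cl_gen (2*b) + smul \<eta> (cl_gen (2*b+1)))) +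
         pmul (smul (1/2) (cl_gen (2*b) + smul \<eta> (cl_gen (2*b+1))))
              (smul (1/2) (cl_gen (2*a) + smul \<epsilon> (cl_gen (2*a+1)))) =
         (if a = b then smul ((1 - \<epsilon> * \<eta>) / 2) pone else 0)"
  (is "?lhs = ?rhs")
proof -
  let ?A = "\<lambda>i j. pmul (cl_gen i) (cl_gen j) + pmul (cl_gen j) (cl_gen i)"
  have "?lhs = smul (1/4) (?A (2*a) (2*b) + smul \<eta> (?A (2*a) (2*b+1))
      + smul \<epsilon> (?A (2*a+1) (2*b)) + smul (\<epsilon> * \<eta>) (?A (2*a+1) (2*b+1)))"
    by (rule poly_mapping_eqI)
      (simp add: pmul_add_left pmul_add_right pmul_smul_left pmul_smul_right lookup_add
        algebra_simps)
  also have "\<dots> = ?rhs"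
  proof -
    have ne: "2 * a \<noteq> 2 * b + 1" "2 * a + 1 \<noteq> 2 * b" by presburger+
    show ?thesis
      by (rule poly_mapping_eqI)
        (use ne in \<open>auto simp: cl_gen_anticommutator lookup_add algebra_simps diff_divide_distrib\<close>)
  qed
  finally show ?thesis .
qed

lemma witt_f_alt: "witt_f a = smul (1/2) (cl_gen (2*a) + smul 1 (cl_gen (2*a+1)))"
  by (simp add: witt_f_def)

lemma witt_fd_alt: "witt_fd a = smul (1/2) (cl_gen (2*a) + smul (- 1) (cl_gen (2*a+1)))"
  unfolding witt_fd_def by (rule poly_mapping_eqI) (simp add: lookup_add lookup_minus)

lemma witt_f_f: "pmul (witt_f a) (witt_f b) + pmul (witt_f b) (witt_f a) = 0"
  unfolding witt_f_alt by (subst witt_anticomm_aux) simp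

lemma witt_fd_fd: "pmul (witt_fd a) (witt_fd b) + pmul (witt_fd b) (witt_fd a) = 0"
  unfolding witt_fd_alt by (subst witt_anticomm_aux) simp

lemma witt_f_fd:
  "pmul (witt_f a) (witt_fd b) + pmul (witt_fd b) (witt_f a) = (if a = b then pone else 0)"
  unfolding witt_f_alt witt_fd_alt by (subst witt_anticomm_aux) simp

lemma grade_inv_add: "grade_inv (x + y) = grade_inv x + grade_inv y"
  by (simp add: grade_inv_def lin_ext_add)

lemma grade_inv_smul: "grade_inv (smul c x) = smul c (grade_inv x)"
  by (simp add: grade_inv_def lin_ext_smul)

lemma grade_inv_cl_gen: "grade_inv (cl_gen i) = - cl_gen i"
  by (simp add: grade_inv_def cl_gen_def single_uminus)

lemma grade_inv_witt: "grade_inv (witt_f a) = - witt_f a" "grade_inv (witt_fd a) = - witt_fd a"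
  unfolding witt_f_alt witt_fd_alt grade_inv_add grade_inv_smul grade_inv_cl_gen
  by (rule poly_mapping_eqI, simp add: lookup_add lookup_minus diff_divide_distrib add_divide_distrib)+

lemma neg_one_power_card:
  "finite S \<Longrightarrow> (- 1 :: complex) ^ (card S mod 2) = (\<Prod>i\<in>S. - 1)"
  by (cases "even (card S)") (auto simp: odd_iff_mod_2_eq_one)

lemma grade_inv_mul:
  assumes "Poly_Mapping.keys x \<subseteq> fin_words" "Poly_Mapping.keys y \<subseteq> fin_words"
  shows "grade_inv (pmul x y) = pmul (grade_inv x) (grade_inv y)"
  using assms(1)
proof (induction x rule: keys_induct)
  case (single b c)
  from assms(2) show ?case
  proof (induction y rule: keys_induct)
    case (single b' c')
    obtain \<mu> \<nu> S \<mu>' \<nu>' T where b: "b = (\<mu>, \<nu>, S)" "finite S" "b' = (\<mu>', \<nu>', T)" "finite T"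
      using \<open>b \<in> fin_words\<close> \<open>b' \<in> fin_words\<close> by (auto simp: fin_words_def)
    have "(- 1 :: complex) ^ (card (symdiff S T) mod 2) = (-1) ^ (card S mod 2) * (-1) ^ (card T mod 2)"
      using b by (simp only: neg_one_power_card finite_symdiff, intro prod_symdiff) simp_all
    then show ?case
      by (simp add: b grade_inv_def pmul_single smul_single algebra_simps)
  qed (simp_all add: pmul_add_right grade_inv_add, simp_all add: grade_inv_def)
qed (simp_all add: pmul_add_left grade_inv_add, simp_all add: grade_inv_def)

lemma keys_witt_fd: "Poly_Mapping.keys (witt_fd a) \<subseteq> fin_words"
  unfolding witt_fd_def
proof -
  have "Poly_Mapping.keys (smul (1/2) (cl_gen (2*a) - cl_gen (2*a+1))) \<subseteq>
      {(0, 0, {2 * a}), (0, 0, {2 * a + 1})}"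
    by (auto simp: in_keys_iff lookup_minus cl_gen_def lookup_single when_def split: if_splits)
  then show "Poly_Mapping.keys (smul (1/2) (cl_gen (2*a) - cl_gen (2*a+1))) \<subseteq> fin_words"
    by (auto simp: fin_words_def)
qed

lemma keys_grade_inv: "Poly_Mapping.keys (grade_inv x) \<subseteq> Poly_Mapping.keys x"
proof -
  have "Poly_Mapping.lookup (grade_inv x) b = 0" if "b \<notin> Poly_Mapping.keys x" for b
    unfolding grade_inv_def lin_ext_def lookup_sum
    by (rule sum.neutral) (use that in \<open>auto simp: lookup_single when_def\<close>)
  then show ?thesis by (auto simp: in_keys_iff)
qed

lemma delta_witt:
  "delta a (witt_f b) = (if a = b then pone else 0)"
  "delta a (witt_fd b) = 0"
  using witt_f_fd[of b a] witt_fd_fd[of a b]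
  by (simp_all add: delta_def grade_inv_witt pmul_minus add.commute)

lemma delta_antiderivation:
  assumes "Poly_Mapping.keys x \<subseteq> fin_words" "Poly_Mapping.keys y \<subseteq> fin_words"
  shows "delta a (pmul x y) = pmul (delta a x) y + pmul (grade_inv x) (delta a y)"
proof -
  have gx: "Poly_Mapping.keys (grade_inv x) \<subseteq> fin_words"
    and gy: "Poly_Mapping.keys (grade_inv y) \<subseteq> fin_words"
    using keys_grade_inv assms by blast+
  show ?thesis
    unfolding delta_def
    by (simp add: grade_inv_mul assms pmul_diff pmul_assoc keys_witt_fd gx gy)
qed


section \<open>Capelli contractions\<close>

definition contr :: "nat \<Rightarrow> nat \<Rightarrow> pcl \<Rightarrow> pcl" where
  "contr m i F = (\<Sum>a=1..m. delta a (dz i a F))"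

definition euler_z :: "nat \<Rightarrow> nat \<Rightarrow> nat \<Rightarrow> pcl \<Rightarrow> pcl" where
  "euler_z m j i F = (\<Sum>a=1..m. pmul (zvar j a) (dz i a F))"

definition Cz :: "nat \<Rightarrow> nat \<Rightarrow> nat \<Rightarrow> pcl \<Rightarrow> pcl" where
  "Cz m i j F = smul (if i = j then of_nat m else 0) F + euler_z m j i F"

definition columns :: "nat \<Rightarrow> nat \<Rightarrow> (nat \<Rightarrow> pcl) set" where
  "columns m N = {V. (\<forall>i\<in>{1..N}. V i \<in> PCl m N) \<and> (\<forall>i. i \<notin> {1..N} \<longrightarrow> V i = 0)}"

definition Cz_op :: "nat \<Rightarrow> nat \<Rightarrow> (nat \<Rightarrow> pcl) \<Rightarrow> (nat \<Rightarrow> pcl)" where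
  "Cz_op m N V = (\<lambda>i. if i \<in> {1..N} then \<Sum>j=1..N. Cz m i j (V j) else 0)"

text \<open>For \<open>m \<ge> 2 N\<close> the operator matrix is bijective on the columns, degree by degree; the
  entries of its inverse are read off on columns with a single nonzero component.\<close>

definition Cz_inv :: "nat \<Rightarrow> nat \<Rightarrow> nat \<Rightarrow> nat \<Rightarrow> pcl \<Rightarrow> pcl" where
  "Cz_inv m N i l F = inv_into (columns m N) (Cz_op m N) (\<lambda>j. if j = l then F else 0) i"

definition n_plus :: "nat \<Rightarrow> nat \<Rightarrow> nat \<Rightarrow> pcl \<Rightarrow> pcl" where
  "n_plus m N i F = (\<Sum>l=1..N. Cz_inv m N i l (contr m l F))"

definition n_minus :: "nat \<Rightarrow> nat \<Rightarrow> nat \<Rightarrow> pcl \<Rightarrow> pcl" where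
  "n_minus m N i = pdag \<circ> n_plus m N i \<circ> pdag"


section \<open>Coefficient rings\<close>

text \<open>The coefficients of all fermionic modules are taken in the field of rational
  functions in the commuting variables \<open>B\<^sub>k\<^sub>j\<close> (label \<open>k\<close>, pair \<open>j\<close>); the variable with index
  \<open>(k, j)\<close> is numbered by \<^const>\<open>prod_encode\<close>, as the exponents have to be linearly ordered for
  the polynomial ring to be known as an integral domain.  The tensor product of the
  one-pair rings is the corresponding localization of the polynomial ring, a subring of this
  field.\<close>

type_synonym bpoly = "(nat \<Rightarrow>\<^sub>0 nat) \<Rightarrow>\<^sub>0 complex"
type_synonym coeff = "bpoly fract"

definition bpconst :: "complex \<Rightarrow> bpoly" where
  "bpconst c = Poly_Mapping.single 0 c"

definition bpvar :: "nat \<Rightarrow> nat \<Rightarrow> bpoly" where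
  "bpvar k j = Poly_Mapping.single (Poly_Mapping.single (prod_encode (k, j)) 1) 1"

definition cst :: "complex \<Rightarrow> coeff" where
  "cst c = Fract (bpconst c) 1"

definition Bvar :: "nat \<Rightarrow> nat \<Rightarrow> coeff" where
  "Bvar k j = Fract (bpvar k j) 1"

definition bpolys :: "nat \<Rightarrow> nat \<Rightarrow> bpoly set" where
  "bpolys N n = {p. \<forall>\<mu>\<in>Poly_Mapping.keys p. Poly_Mapping.keys \<mu> \<subseteq> prod_encode ` ({1..N} \<times> {1..n})}"

inductive_set denoms :: "complex \<Rightarrow> nat \<Rightarrow> nat \<Rightarrow> bpoly set" for s N n where
  one: "1 \<in> denoms s N n"
| gen1: "d \<in> denoms s N n \<Longrightarrow> k \<in> {1..N} \<Longrightarrow> j \<in> {1..n} \<Longrightarrow>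
    ((bpvar k j + bpconst (2 * \<i> * of_int l)) - bpconst \<i>) * d \<in> denoms s N n"
| gen2: "d \<in> denoms s N n \<Longrightarrow> k \<in> {1..N} \<Longrightarrow> j \<in> {1..n} \<Longrightarrow>
    (bpconst s - bpconst (2 * \<i>) * (bpvar k j + bpconst (2 * \<i> * of_int l))) * d \<in> denoms s N n"
| gen3: "d \<in> denoms s N n \<Longrightarrow> k \<in> {1..N} \<Longrightarrow> j \<in> {1..n} \<Longrightarrow>
    (bpconst s + bpconst (2 * \<i>) * (bpvar k j + bpconst (2 * \<i> * of_int l))) * d \<in> denoms s N n"

definition Amin :: "complex \<Rightarrow> nat \<Rightarrow> nat \<Rightarrow> coeff set" where
  "Amin s N n = {Fract p d | p d. p \<in> bpolys N n \<and> d \<in> denoms s N n}"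

text \<open>On coefficients \<open>\<ddagger>\<close> conjugates the scalars and fixes every \<open>B\<^sub>k\<^sub>j\<close>: from
  \<open>B = ba - i\<close> and \<open>ab - ba = -2i\<close> one gets \<open>ab + i = ba - i\<close>.\<close>

definition bpcnj :: "bpoly \<Rightarrow> bpoly" where
  "bpcnj = Poly_Mapping.map cnj"

lemma lookup_bpcnj [simp]: "Poly_Mapping.lookup (bpcnj p) \<mu> = cnj (Poly_Mapping.lookup p \<mu>)"
  unfolding bpcnj_def by transfer (simp add: when_def)

lemma bpcnj_add: "bpcnj (p + r) = bpcnj p + bpcnj r"
  by (rule poly_mapping_eqI) (simp add: lookup_add)

lemma bpcnj_zero_iff [simp]: "bpcnj p = 0 \<longleftrightarrow> p = 0"
  by (auto simp: poly_mapping_eq_iff fun_eq_iff)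

lemma bpcnj_single [simp]: "bpcnj (Poly_Mapping.single \<mu> c) = Poly_Mapping.single \<mu> (cnj c)"
  by (rule poly_mapping_eqI) (simp add: lookup_single when_def)

lemma bpcnj_mult: "bpcnj (p * r) = bpcnj p * bpcnj r"
proof -
  have U: "Poly_Mapping.keys p \<subseteq> UNIV" "Poly_Mapping.keys r \<subseteq> UNIV" by simp_all
  from U(1) show ?thesis
  proof (induction p rule: keys_induct)
    case zero
    then show ?case by (metis bpcnj_zero_iff mult_zero_left)
  next
    case (single b c)
    from U(2) show ?case
    proof (induction r rule: keys_induct)
      case zero
      then show ?case by (metis bpcnj_zero_iff mult_zero_right)
    qed (simp_all add: mult_single bpcnj_add distrib_left)
  qed (simp_all add: bpcnj_add distrib_right)
qed

lift_definition ccnj :: "coeff \<Rightarrow> coeff" is "\<lambda>x. (bpcnj (fst x), bpcnj (snd x))"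
  by (auto simp: bpcnj_mult [symmetric])

lemma ccnj_Fract [simp]: "ccnj (Fract p d) = Fract (bpcnj p) (bpcnj d)"
proof -
  have "bpcnj 0 = 0" "bpcnj 1 = 1"
    using bpcnj_single[of 0 1] by simp_all
  then show ?thesis by transfer auto
qed

lemma ccnj_mult: "ccnj (x * y) = ccnj x * ccnj y"
  by (cases x; cases y) (simp add: bpcnj_mult)

lemma ccnj_add: "ccnj (x + y) = ccnj x + ccnj y"
  by (cases x; cases y) (simp add: bpcnj_mult bpcnj_add)

lemma ccnj_minus: "ccnj (- x) = - ccnj x"
proof (cases x)
  case (Fract p d)
  have "bpcnj (- p) = - bpcnj p" by (rule poly_mapping_eqI) simp
  then show ?thesis using Fract by simp
qed

lemma ccnj_diff: "ccnj (x - y) = ccnj x - ccnj y"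
  using ccnj_add[of x "- y"] by (simp add: ccnj_minus)

lemma ccnj_inverse: "ccnj (inverse x) = inverse (ccnj x)"
  by (cases x) simp

lemma ccnj_divide: "ccnj (x / y) = ccnj x / ccnj y"
  by (simp add: divide_inverse ccnj_mult ccnj_inverse)

lemma bpcnj_one [simp]: "bpcnj 1 = 1"
  using bpcnj_single[of 0 1] by simp

lemma ccnj_cst [simp]: "ccnj (cst c) = cst (cnj c)"
  by (simp add: cst_def bpconst_def)

lemma ccnj_Bvar [simp]: "ccnj (Bvar k j) = Bvar k j"
  by (simp add: Bvar_def bpvar_def)

lemma ccnj_0_1 [simp]: "ccnj 0 = 0" "ccnj 1 = 1"
  by (simp_all add: fract_expand) (metis bpcnj_zero_iff)

lemma ccnj_ccnj [simp]: "ccnj (ccnj x) = x"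
proof (cases x)
  case (Fract p d)
  have "bpcnj (bpcnj t) = t" for t by (rule poly_mapping_eqI) simp
  then show ?thesis using Fract by simp
qed

lemma ccnj_neg_one_power [simp]: "ccnj ((- 1) ^ t) = (- 1) ^ t"
  by (induction t) (simp_all add: ccnj_mult ccnj_minus)

lemma cst_add: "cst (c + d) = cst c + cst d"
  by (simp add: cst_def bpconst_def single_add)

lemma cst_mult: "cst (c * d) = cst c * cst d"
  by (simp add: cst_def bpconst_def mult_single)

lemma cst_minus: "cst (- c) = - cst c"
  by (simp add: cst_def bpconst_def single_uminus)

lemma cst_0_1 [simp]: "cst 0 = 0" "cst 1 = 1"
  by (simp_all add: cst_def bpconst_def fract_expand)



section \<open>The one-pair modules\<close>

definition qint :: "real \<Rightarrow> nat \<Rightarrow> real" where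
  "qint q r = (1 - q ^ r) / (1 - q)"

definition cq :: "real \<Rightarrow> nat \<Rightarrow> real" where
  "cq q r = qint q (2 * r) / 2"

definition s_par :: "real \<Rightarrow> nat \<Rightarrow> nat \<Rightarrow> complex" where
  "s_par q m n = of_real (1 / real n * q powi (2 * int m - 2 * int n) * qint q (2 * n))"

definition beta_c :: "int \<Rightarrow> coeff \<Rightarrow> coeff" where
  "beta_c j X = (if j \<ge> 1 then X + cst (of_int (2 * j - 1) * \<i>) else 1)"

definition alpha_c :: "int \<Rightarrow> coeff \<Rightarrow> coeff" where
  "alpha_c j X = (if j \<ge> 0 then 1 else X + cst (of_int (2 * j + 1) * \<i>))"

definition Phi_s :: "complex \<Rightarrow> coeff \<Rightarrow> coeff" where
  "Phi_s s X = (cst (4 - s) + cst (2 * \<i>) * X) / (X - cst \<i>)"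

definition Psi_s :: "complex \<Rightarrow> coeff \<Rightarrow> coeff" where
  "Psi_s s X = (cst (- s) - cst (2 * \<i>) * X) / (X - cst \<i>)"

definition sigma_plus :: "complex \<Rightarrow> int \<Rightarrow> coeff \<Rightarrow> coeff" where
  "sigma_plus s c X = beta_c (c + 1) X * Phi_s s (X + cst (2 * \<i> * of_int (c + 1)))"

definition sigma_minus :: "complex \<Rightarrow> int \<Rightarrow> coeff \<Rightarrow> coeff" where
  "sigma_minus s c X = alpha_c (c - 1) X * Psi_s s (X + cst (2 * \<i> * of_int c))"

definition pi_plus :: "complex \<Rightarrow> int \<Rightarrow> coeff \<Rightarrow> coeff" where
  "pi_plus s c X = cst (- 1 / 4) * sigma_plus s c X"

definition pi_minus :: "complex \<Rightarrow> int \<Rightarrow> coeff \<Rightarrow> coeff" where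
  "pi_minus s c X = cst (- 1 / 4) * sigma_minus s c X"

definition kappa_plus :: "complex \<Rightarrow> int \<Rightarrow> coeff \<Rightarrow> coeff" where
  "kappa_plus s c X = cst (- 1 / 4) * sigma_plus s c X * alpha_c c X"

definition K_c :: "int \<Rightarrow> coeff \<Rightarrow> coeff" where
  "K_c c X = cst (1 / (2 * \<i>)) * alpha_c (c - 1) X * beta_c c X"

datatype fstate = E0 | Et | Etb | E2

text \<open>One-pair right-linear maps that preserve the charge are given by their matrices:
  \<open>T X c \<epsilon> \<epsilon>'\<close> is the coefficient of \<open>e\<^bsub>\<epsilon>',c\<^esub>\<close> in the image of \<open>e\<^bsub>\<epsilon>,c\<^esub>\<close>, with
  \<open>X\<close> standing for \<open>B\<close>.\<close>

type_synonym pair_map = "coeff \<Rightarrow> int \<Rightarrow> fstate \<Rightarrow> fstate \<Rightarrow> coeff"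

fun Q1_plus :: "complex \<Rightarrow> pair_map" where
  "Q1_plus s X c Et E0 = pi_plus s c X"
| "Q1_plus s X c E2 Etb = cst (1 / (2 * \<i>)) * beta_c c X"
| "Q1_plus s X c _ _ = 0"

fun h1_plus :: "complex \<Rightarrow> pair_map" where
  "h1_plus s X c E0 Et = inverse (pi_plus s c X)"
| "h1_plus s X c Etb E2 = cst (2 * \<i>) * inverse (beta_c c X)"
| "h1_plus s X c _ _ = 0"

fun Q1_minus :: "complex \<Rightarrow> pair_map" where
  "Q1_minus s X c Etb E0 = pi_minus s c X"
| "Q1_minus s X c E2 Et = cst (1 / (2 * \<i>)) * alpha_c c X"
| "Q1_minus s X c _ _ = 0"

fun h1_minus :: "complex \<Rightarrow> pair_map" where
  "h1_minus s X c E0 Etb = inverse (pi_minus s c X)"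
| "h1_minus s X c Et E2 = cst (2 * \<i>) * inverse (alpha_c c X)"
| "h1_minus s X c _ _ = 0"


section \<open>The fermionic factor\<close>

text \<open>The tensor product of the \<open>\<F>\<^sub>k\<close>, \<open>1 \<le> k \<le> N\<close>, each of which is a direct sum over
  charges of graded tensor products over the pairs \<open>1 \<le> j \<le> n\<close>, is the free module over the
  tensor product of the coefficient rings on the tensors of basis vectors; a basis element is
  recorded as the map from \<open>(k, j)\<close> to the charge and state of that factor.  The factors are
  ordered lexicographically.  All products are taken over the complex numbers.\<close>

type_synonym fbase = "nat \<times> nat \<Rightarrow> int \<times> fstate"
type_synonym fmod = "fbase \<Rightarrow>\<^sub>0 coeff"

definition fbasis :: "nat \<Rightarrow> nat \<Rightarrow> fbase set" where
  "fbasis N n = {e. \<forall>p. p \<notin> {1..N} \<times> {1..n} \<longrightarrow> e p = (0, E0)}"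

definition odd_before :: "nat \<Rightarrow> nat \<Rightarrow> fbase \<Rightarrow> nat" where
  "odd_before k j e = card {(k', j'). (k' < k \<or> (k' = k \<and> j' < j)) \<and> snd (e (k', j')) \<in> {Et, Etb}}"

text \<open>Graded embedding of an odd one-pair map into factor \<open>j\<close> of \<open>\<F>\<^sub>k\<close>, with Koszul sign.\<close>

definition hat_odd :: "pair_map \<Rightarrow> nat \<Rightarrow> nat \<Rightarrow> fmod \<Rightarrow> fmod" where
  "hat_odd T k j = lin_ext (\<lambda>e. \<Sum>\<epsilon>\<in>{E0, Et, Etb, E2}.
     Poly_Mapping.single (e((k, j) := (fst (e (k, j)), \<epsilon>)))
       ((- 1) ^ odd_before k j e * T (Bvar k j) (fst (e (k, j))) (snd (e (k, j))) \<epsilon>))"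

definition Q_plus :: "real \<Rightarrow> nat \<Rightarrow> nat \<Rightarrow> nat \<Rightarrow> fmod \<Rightarrow> fmod" where
  "Q_plus q m n k u = (\<Sum>j=1..n. hat_odd (Q1_plus (s_par q m n)) k j u)"

definition h_plus :: "real \<Rightarrow> nat \<Rightarrow> nat \<Rightarrow> nat \<Rightarrow> fmod \<Rightarrow> fmod" where
  "h_plus q m n k u = smul (cst (1 / of_nat n)) (\<Sum>j=1..n. hat_odd (h1_plus (s_par q m n)) k j u)"

definition delta_m :: "real \<Rightarrow> nat \<Rightarrow> real" where
  "delta_m q m = (2 * real m - qint q (2 * m)) / 4"

definition Bq :: "real \<Rightarrow> nat \<Rightarrow> nat \<Rightarrow> real" where
  "Bq q t r = cq q (r + t) / real (r + t)"

definition P1_plus :: "nat \<Rightarrow> nat \<Rightarrow> fbase \<Rightarrow> coeff" where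
  "P1_plus k j e = (if snd (e (k, j)) \<in> {Etb, E2} then 1 else 0)"

definition PS_plus :: "nat \<Rightarrow> nat \<Rightarrow> nat set \<Rightarrow> fbase \<Rightarrow> coeff" where
  "PS_plus n k S e = (\<Prod>j\<in>S. P1_plus k j e) * (\<Prod>j\<in>{1..n} - S. 1 - P1_plus k j e)"

text \<open>The operators \<open>M\<^sup>\<plusminus>\<close> and \<open>N\<^sup>\<plusminus>\<close> for label \<open>k\<close> depend on the bosonic Euler degree; here they
  are given as operators on the fermionic factor for each value \<open>r\<close> of that degree.
  The projectors and hence \<open>M\<^sup>+\<close> are diagonal in the basis.\<close>

definition M_plus :: "real \<Rightarrow> nat \<Rightarrow> nat \<Rightarrow> nat \<Rightarrow> nat \<Rightarrow> fmod \<Rightarrow> fmod" where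
  "M_plus q m n k r = lin_ext (\<lambda>e. Poly_Mapping.single e
     (cst (of_real (delta_m q m)) +
      (\<Sum>S\<in>Pow {1..n} - {{}}. PS_plus n k S e *
        ((\<Sum>j\<in>S. kappa_plus (s_par q m n) (fst (e (k, j))) (Bvar k j))
         - of_nat (card S)
         - cst (of_real (Bq q (card S) r)) * (\<Sum>j\<in>S. K_c (fst (e (k, j))) (Bvar k j))))))"

definition N_plus :: "real \<Rightarrow> nat \<Rightarrow> nat \<Rightarrow> nat \<Rightarrow> nat \<Rightarrow> fmod \<Rightarrow> fmod" where
  "N_plus q m n k r u = - h_plus q m n k (M_plus q m n k r u)"

fun state_dag :: "fstate \<Rightarrow> fstate" where
  "state_dag E0 = E0" | "state_dag Et = Etb" | "state_dag Etb = Et" | "state_dag E2 = E2"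

text \<open>\<open>\<ddagger>\<close> on the fermionic factor: it is order preserving, so each \<open>e\<^bsub>2,c\<^esub>\<close> goes to
  \<open>-e\<^bsub>2,-c\<^esub>\<close>.\<close>

definition fdag :: "fmod \<Rightarrow> fmod" where
  "fdag u = lin_ext (\<lambda>e. Poly_Mapping.single (\<lambda>p. (- fst (e p), state_dag (snd (e p))))
     ((- 1) ^ card {p. snd (e p) = E2})) (Poly_Mapping.map ccnj u)"

definition N_minus :: "real \<Rightarrow> nat \<Rightarrow> nat \<Rightarrow> nat \<Rightarrow> nat \<Rightarrow> fmod \<Rightarrow> fmod" where
  "N_minus q m n k r = fdag \<circ> N_plus q m n k r \<circ> fdag"

text \<open>The explicit minus maps are the \<open>\<ddagger>\<close>-conjugates of the plus maps.\<close>

lemma ccnj_beta: "ccnj (beta_c j (Bvar k i)) = alpha_c (- j) (Bvar k i)"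
  by (auto simp: beta_c_def alpha_c_def ccnj_add algebra_simps)

lemma ccnj_alpha: "ccnj (alpha_c j (Bvar k i)) = beta_c (- j) (Bvar k i)"
  using arg_cong[of _ _ ccnj, OF ccnj_beta[of "- j" k i]] by simp

lemma ccnj_Phi:
  assumes "cnj s = s"
  shows "ccnj (Phi_s s (Bvar k i + cst (2 * \<i> * of_int (1 - c)))) =
     Psi_s s (Bvar k i + cst (2 * \<i> * of_int c))"
proof -
  have num: "cst (4 - s) - cst (2 * \<i>) * (Bvar k i - cst (2 * \<i> * of_int (1 - c))) =
      cst (- s) - cst (2 * \<i>) * (Bvar k i + cst (2 * \<i> * of_int c))"
  proof -
    have "4 - s = - s - 2 * \<i> * (2 * \<i> * of_int c) - 2 * \<i> * (2 * \<i> * of_int (1 - c))"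
      by (simp add: algebra_simps)
    then have "cst (4 - s) = cst (- s + - (2 * \<i> * (2 * \<i> * of_int c)) + - (2 * \<i> * (2 * \<i> * of_int (1 - c))))"
      by simp
    also have "\<dots> = cst (- s) - cst (2 * \<i>) * cst (2 * \<i> * of_int c)
        - cst (2 * \<i>) * cst (2 * \<i> * of_int (1 - c))"
      by (simp only: cst_add cst_minus cst_mult) simp
    finally show ?thesis by (simp add: algebra_simps)
  qed
  have "- (2 * \<i> * of_int (1 - c)) + \<i> = 2 * \<i> * of_int c + - \<i>"
    by (simp add: algebra_simps)
  then have "cst (- (2 * \<i> * of_int (1 - c)) + \<i>) = cst (2 * \<i> * of_int c + - \<i>)"
    by (rule arg_cong)
  then have den: "Bvar k i - cst (2 * \<i> * of_int (1 - c)) + cst \<i> =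
      Bvar k i + cst (2 * \<i> * of_int c) - cst \<i>"
    by (simp only: cst_add cst_minus) (simp add: algebra_simps)
  have c1: "cnj (2 * \<i> * of_int (1 - c)) = - (2 * \<i> * of_int (1 - c))" "cnj (4 - s) = 4 - s"
    "cnj (2 * \<i>) = - (2 * \<i>)" "cnj \<i> = - \<i>"
    using assms by simp_all
  show ?thesis
    unfolding Phi_s_def Psi_s_def ccnj_divide ccnj_add ccnj_diff ccnj_mult ccnj_cst ccnj_Bvar c1
      cst_minus[of "2 * \<i>"] cst_minus[of "\<i>"] cst_minus[of "2 * \<i> * of_int (1 - c)"]
    using num den by simp
qed

lemma ccnj_pi_plus:
  assumes "cnj s = s"
  shows "ccnj (pi_plus s (- c) (Bvar k i)) = pi_minus s c (Bvar k i)"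
  using ccnj_Phi[OF assms, of k i c] ccnj_beta[of "1 - c" k i]
  by (simp add: pi_plus_def pi_minus_def sigma_plus_def sigma_minus_def ccnj_mult add.commute)

definition state_sign :: "fstate \<Rightarrow> coeff" where
  "state_sign \<epsilon> = (if \<epsilon> = E2 then - 1 else 1)"

lemma Q1_dag:
  assumes "cnj s = s"
  shows "state_sign \<epsilon> * state_sign \<epsilon>' *
      ccnj (Q1_plus s (Bvar k i) (- c) (state_dag \<epsilon>) (state_dag \<epsilon>')) = Q1_minus s (Bvar k i) c \<epsilon> \<epsilon>'"
  by (cases \<epsilon>; cases \<epsilon>')
    (simp_all add: state_sign_def ccnj_pi_plus[OF assms] ccnj_mult ccnj_beta ccnj_minus cst_minus)

lemma h1_dag:
  assumes "cnj s = s"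
  shows "state_sign \<epsilon> * state_sign \<epsilon>' *
      ccnj (h1_plus s (Bvar k i) (- c) (state_dag \<epsilon>) (state_dag \<epsilon>')) = h1_minus s (Bvar k i) c \<epsilon> \<epsilon>'"
  by (cases \<epsilon>; cases \<epsilon>')
    (simp_all add: state_sign_def ccnj_pi_plus[OF assms] ccnj_mult ccnj_beta ccnj_inverse cst_minus)

lemma state_dag_dag [simp]: "state_dag (state_dag \<epsilon>) = \<epsilon>"
  by (cases \<epsilon>) simp_all

lemma fdag_single [simp]:
  "fdag (Poly_Mapping.single e r) =
     Poly_Mapping.single (\<lambda>p. (- fst (e p), state_dag (snd (e p))))
       ((- 1) ^ card {p. snd (e p) = E2} * ccnj r)"
  by (simp add: fdag_def smul_single mult.commute)

lemma fdag_add: "fdag (u + w) = fdag u + fdag w"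
proof -
  have "Poly_Mapping.lookup (Poly_Mapping.map ccnj t) b = ccnj (Poly_Mapping.lookup t b)"
    for t :: fmod and b by (simp add: map.rep_eq when_def)
  then have "Poly_Mapping.map ccnj (u + w) = Poly_Mapping.map ccnj u + Poly_Mapping.map ccnj w"
    by (intro poly_mapping_eqI) (simp add: lookup_add ccnj_add)
  then show ?thesis by (simp add: fdag_def lin_ext_add)
qed

lemma fdag_hat_odd:
  assumes TT: "\<And>\<epsilon> \<epsilon>' c. state_sign \<epsilon> * state_sign \<epsilon>' *
      ccnj (T (Bvar k j) (- c) (state_dag \<epsilon>) (state_dag \<epsilon>')) = T' (Bvar k j) c \<epsilon> \<epsilon>'"
    and fin: "finite {p. snd (e p) = E2}"
  shows "fdag (hat_odd T k j (fdag (Poly_Mapping.single e r))) =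
     hat_odd T' k j (Poly_Mapping.single e r)"
proof -
  let ?d = "\<lambda>e :: fbase. \<lambda>p. (- fst (e p), state_dag (snd (e p)))"
  let ?n = "\<lambda>e :: fbase. card {p. snd (e p) = E2}"
  define c \<epsilon> where "c = fst (e (k, j))" and "\<epsilon> = snd (e (k, j))"
  have ob: "odd_before k j (?d e) = odd_before k j e"
  proof -
    have "state_dag x \<in> {Et, Etb} \<longleftrightarrow> x \<in> {Et, Etb}" for x by (cases x) auto
    then show ?thesis by (simp add: odd_before_def)
  qed
  have sgn: "(- 1 :: coeff) ^ ?n ((?d e)((k, j) := (- c, state_dag \<epsilon>'))) * (- 1) ^ ?n e =
      state_sign \<epsilon> * state_sign \<epsilon>'" for \<epsilon>'
  proof -
    define Z where "Z = {p. p \<noteq> (k, j) \<and> snd (e p) = E2}"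
    have fZ: "finite Z" and nZ: "(k, j) \<notin> Z"
      unfolding Z_def by (auto intro: finite_subset[OF _ fin])
    have d2: "state_dag x = E2 \<longleftrightarrow> x = E2" for x by (cases x) auto
    have 1: "{p. snd (((?d e)((k, j) := (- c, state_dag \<epsilon>'))) p) = E2} =
        (if \<epsilon>' = E2 then insert (k, j) Z else Z)"
      by (auto simp: Z_def d2)
    have 2: "{p. snd (e p) = E2} = (if \<epsilon> = E2 then insert (k, j) Z else Z)"
      by (auto simp: Z_def \<epsilon>_def)
    show ?thesis unfolding 1 2
      using fZ nZ by (auto simp: state_sign_def simp flip: power_add)
  qed
  have upd: "?d ((?d e)((k, j) := (- c, state_dag \<epsilon>'))) = e((k, j) := (c, \<epsilon>'))" for \<epsilon>'
    by (auto simp: fun_eq_iff)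
  have reidx: "(\<Sum>\<epsilon>\<in>{E0, Et, Etb, E2}. f \<epsilon>) = (\<Sum>\<epsilon>\<in>{E0, Et, Etb, E2}. f (state_dag \<epsilon>))"
    for f :: "fstate \<Rightarrow> fmod"
    by (simp add: add.commute add.left_commute)
  have fsum: "fdag (\<Sum>\<epsilon>\<in>A. f \<epsilon>) = (\<Sum>\<epsilon>\<in>A. fdag (f \<epsilon>))" if "finite A" for A and f :: "fstate \<Rightarrow> fmod"
    using that by (induction A) (use fdag_add[of 0 0] in \<open>simp_all add: fdag_add\<close>)
  have "hat_odd T k j (fdag (Poly_Mapping.single e r)) =
     (\<Sum>\<epsilon>'\<in>{E0, Et, Etb, E2}. Poly_Mapping.single ((?d e)((k, j) := (- c, state_dag \<epsilon>')))
       ((- 1) ^ ?n e * ccnj r * ((- 1) ^ odd_before k j e *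
          T (Bvar k j) (- c) (state_dag \<epsilon>) (state_dag \<epsilon>'))))"
    unfolding hat_odd_def fdag_single lin_ext_single smul_sum smul_single
    by (subst reidx) (simp only: ob c_def \<epsilon>_def fst_conv snd_conv)
  then have "fdag (hat_odd T k j (fdag (Poly_Mapping.single e r))) =
     (\<Sum>\<epsilon>'\<in>{E0, Et, Etb, E2}. Poly_Mapping.single (e((k, j) := (c, \<epsilon>')))
       ((- 1) ^ ?n ((?d e)((k, j) := (- c, state_dag \<epsilon>'))) *
        ccnj ((- 1) ^ ?n e * ccnj r * ((- 1) ^ odd_before k j e *
          T (Bvar k j) (- c) (state_dag \<epsilon>) (state_dag \<epsilon>')))))"
    by (simp only: fsum finite.intros fdag_single upd)
  also have "\<dots> = (\<Sum>\<epsilon>'\<in>{E0, Et, Etb, E2}. Poly_Mapping.single (e((k, j) := (c, \<epsilon>')))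
       (r * ((- 1) ^ odd_before k j e * T' (Bvar k j) c \<epsilon> \<epsilon>')))"
  proof (rule sum.cong[OF refl], rule arg_cong[of _ _ "Poly_Mapping.single _"])
    fix \<epsilon>'
    have "(- 1) ^ ?n ((?d e)((k, j) := (- c, state_dag \<epsilon>'))) *
        ccnj ((- 1) ^ ?n e * ccnj r * ((- 1) ^ odd_before k j e *
          T (Bvar k j) (- c) (state_dag \<epsilon>) (state_dag \<epsilon>'))) =
        ((- 1) ^ ?n ((?d e)((k, j) := (- c, state_dag \<epsilon>'))) * (- 1) ^ ?n e) * r *
        (- 1) ^ odd_before k j e * ccnj (T (Bvar k j) (- c) (state_dag \<epsilon>) (state_dag \<epsilon>'))"
      by (simp only: ccnj_mult ccnj_ccnj ccnj_neg_one_power mult_ac)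
    also have "\<dots> = r * ((- 1) ^ odd_before k j e * T' (Bvar k j) c \<epsilon> \<epsilon>')"
      unfolding sgn TT[symmetric] by (simp only: mult_ac)
    finally show "(- 1) ^ ?n ((?d e)((k, j) := (- c, state_dag \<epsilon>'))) *
        ccnj ((- 1) ^ ?n e * ccnj r * ((- 1) ^ odd_before k j e *
          T (Bvar k j) (- c) (state_dag \<epsilon>) (state_dag \<epsilon>'))) =
        r * ((- 1) ^ odd_before k j e * T' (Bvar k j) c \<epsilon> \<epsilon>')" .
  qed
  also have "\<dots> = hat_odd T' k j (Poly_Mapping.single e r)"
    unfolding hat_odd_def lin_ext_single smul_sum smul_single by (simp only: c_def \<epsilon>_def)
  finally show ?thesis .
qed

lemma Q1_h1_minus_dag:
  assumes "finite {p. snd (e p) = E2}"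
  shows "fdag (hat_odd (Q1_plus (s_par q m n)) k j (fdag (Poly_Mapping.single e r))) =
      hat_odd (Q1_minus (s_par q m n)) k j (Poly_Mapping.single e r)"
    and "fdag (hat_odd (h1_plus (s_par q m n)) k j (fdag (Poly_Mapping.single e r))) =
      hat_odd (h1_minus (s_par q m n)) k j (Poly_Mapping.single e r)"
proof -
  have s: "cnj (s_par q m n) = s_par q m n" by (simp only: s_par_def complex_cnj_complex_of_real)
  show "fdag (hat_odd (Q1_plus (s_par q m n)) k j (fdag (Poly_Mapping.single e r))) =
      hat_odd (Q1_minus (s_par q m n)) k j (Poly_Mapping.single e r)"
    by (rule fdag_hat_odd[where T = "Q1_plus (s_par q m n)" and T' = "Q1_minus (s_par q m n)"])
      (use Q1_dag[OF s] assms in auto)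
  show "fdag (hat_odd (h1_plus (s_par q m n)) k j (fdag (Poly_Mapping.single e r))) =
      hat_odd (h1_minus (s_par q m n)) k j (Poly_Mapping.single e r)"
    by (rule fdag_hat_odd[where T = "h1_plus (s_par q m n)" and T' = "h1_minus (s_par q m n)"])
      (use h1_dag[OF s] assms in auto)
qed


section \<open>The total space\<close>

text \<open>An element of the graded tensor product of the bosonic and the fermionic factor is
  written uniquely as \<open>\<Sum>\<^sub>b b \<otimes> u\<^sub>b\<close>, with \<open>b\<close> in the basis of the bosonic factor.\<close>

type_synonym mtot = "pbase \<Rightarrow>\<^sub>0 fmod"

definition Mspace :: "real \<Rightarrow> nat \<Rightarrow> nat \<Rightarrow> nat \<Rightarrow> mtot set" where
  "Mspace q m N n = {v. \<forall>b\<in>Poly_Mapping.keys v. b \<in> pbasis m N \<and>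
     (\<forall>e\<in>Poly_Mapping.keys (Poly_Mapping.lookup v b). e \<in> fbasis N n \<and>
        Poly_Mapping.lookup (Poly_Mapping.lookup v b) e \<in> Amin (s_par q m n) N n)}"

definition tens :: "pcl \<Rightarrow> fmod \<Rightarrow> mtot" where
  "tens F u = (\<Sum>b\<in>Poly_Mapping.keys F.
     Poly_Mapping.single b (smul (cst (Poly_Mapping.lookup F b)) u))"

definition mscale :: "complex \<Rightarrow> mtot \<Rightarrow> mtot" where
  "mscale c v = Poly_Mapping.map (smul (cst c)) v"

text \<open>Graded tensor product of operators; \<open>y\<close> is the parity of the second operator, which may
  depend on degrees of the basis element of the bosonic factor it is paired with.\<close>

definition gtens :: "nat \<Rightarrow> (pcl \<Rightarrow> pcl) \<Rightarrow> (pbase \<Rightarrow> fmod \<Rightarrow> fmod) \<Rightarrow> mtot \<Rightarrow> mtot" where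
  "gtens y X Y v = (\<Sum>b\<in>Poly_Mapping.keys v.
     mscale ((- 1) ^ (y * pparity b))
       (tens (X (Poly_Mapping.single b 1)) (Y b (Poly_Mapping.lookup v b))))"

definition mdag :: "mtot \<Rightarrow> mtot" where
  "mdag v = (\<Sum>b\<in>Poly_Mapping.keys v.
     tens (pdag (Poly_Mapping.single b 1)) (fdag (Poly_Mapping.lookup v b)))"

fun zdeg :: "nat \<Rightarrow> pbase \<Rightarrow> nat" where
  "zdeg k (\<mu>, \<nu>, S) = (\<Sum>p\<in>{p \<in> Poly_Mapping.keys \<mu>. fst p = k}. Poly_Mapping.lookup \<mu> p)"

fun zbdeg :: "nat \<Rightarrow> pbase \<Rightarrow> nat" where
  "zbdeg k (\<mu>, \<nu>, S) = (\<Sum>p\<in>{p \<in> Poly_Mapping.keys \<nu>. fst p = k}. Poly_Mapping.lookup \<nu> p)"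

definition A_plus :: "real \<Rightarrow> nat \<Rightarrow> nat \<Rightarrow> nat \<Rightarrow> mtot \<Rightarrow> mtot" where
  "A_plus q m n k v = gtens 0 (dirac m k) (\<lambda>_. id) v + gtens 1 id (\<lambda>_. Q_plus q m n k) v"

definition A_minus :: "real \<Rightarrow> nat \<Rightarrow> nat \<Rightarrow> nat \<Rightarrow> mtot \<Rightarrow> mtot" where
  "A_minus q m n k = mdag \<circ> A_plus q m n k \<circ> mdag"

definition H_plus :: "real \<Rightarrow> nat \<Rightarrow> nat \<Rightarrow> nat \<Rightarrow> nat \<Rightarrow> mtot \<Rightarrow> mtot" where
  "H_plus q m N n i = gtens 1 (n_plus m N i) (\<lambda>b. N_plus q m n i (zbdeg i b))"

definition H_minus :: "real \<Rightarrow> nat \<Rightarrow> nat \<Rightarrow> nat \<Rightarrow> nat \<Rightarrow> mtot \<Rightarrow> mtot" where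
  "H_minus q m N n i = gtens 1 (n_minus m N i) (\<lambda>b. N_minus q m n i (zdeg i b))"

text \<open>Exponential series of a locally nilpotent operator: on each vector only finitely many
  terms are nonzero.\<close>

definition op_exp :: "(mtot \<Rightarrow> mtot) \<Rightarrow> mtot \<Rightarrow> mtot" where
  "op_exp A v = (\<Sum>t\<in>{t. (A ^^ t) v \<noteq> 0}. mscale (1 / fact t) ((A ^^ t) v))"

definition U_plus :: "real \<Rightarrow> nat \<Rightarrow> nat \<Rightarrow> nat \<Rightarrow> mtot \<Rightarrow> mtot" where
  "U_plus q m N n = op_exp (\<lambda>v. \<Sum>i=1..N. H_plus q m N n i v)"

definition U_minus :: "real \<Rightarrow> nat \<Rightarrow> nat \<Rightarrow> nat \<Rightarrow> mtot \<Rightarrow> mtot" where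
  "U_minus q m N n = op_exp (\<lambda>v. \<Sum>i=1..N. H_minus q m N n i v)"

definition R_q :: "real \<Rightarrow> nat \<Rightarrow> nat \<Rightarrow> nat \<Rightarrow> mtot \<Rightarrow> mtot" where
  "R_q q m N n = U_plus q m N n \<circ> inv_into (Mspace q m N n) (U_minus q m N n)"

definition R_lab :: "real \<Rightarrow> nat \<Rightarrow> nat \<Rightarrow> nat \<Rightarrow> nat \<Rightarrow> mtot \<Rightarrow> mtot" where
  "R_lab q m N n i = (\<lambda>v. v + H_plus q m N n i v) \<circ> (\<lambda>v. v - H_minus q m N n i v)"

definition is_operator :: "real \<Rightarrow> nat \<Rightarrow> nat \<Rightarrow> nat \<Rightarrow> (mtot \<Rightarrow> mtot) \<Rightarrow> bool" where
  "is_operator q m N n X \<longleftrightarrow>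
     (\<forall>v\<in>Mspace q m N n. X v \<in> Mspace q m N n) \<and>
     (\<forall>u\<in>Mspace q m N n. \<forall>v\<in>Mspace q m N n. X (u + v) = X u + X v) \<and>
     (\<forall>c. \<forall>v\<in>Mspace q m N n. X (mscale c v) = mscale c (X v))"

definition K_lab :: "real \<Rightarrow> nat \<Rightarrow> nat \<Rightarrow> nat \<Rightarrow> nat \<Rightarrow> (mtot \<Rightarrow> mtot) \<Rightarrow> mtot \<Rightarrow> mtot" where
  "K_lab q m N n i X =
     (\<lambda>v. R_lab q m N n i (X (inv_into (Mspace q m N n) (R_lab q m N n i) v)) - X v)"

definition Omega :: "real \<Rightarrow> nat \<Rightarrow> nat \<Rightarrow> nat \<Rightarrow> nat \<Rightarrow> mtot \<Rightarrow> mtot" where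
  "Omega q m N n j =
     (\<lambda>v. R_q q m N n (A_minus q m n j (inv_into (Mspace q m N n) (R_q q m N n) v))
            - A_minus q m n j v)"

text \<open>Composition, in the order of the list, of a family of maps.\<close>

definition comp_list :: "('i \<Rightarrow> 'x \<Rightarrow> 'x) \<Rightarrow> 'i list \<Rightarrow> 'x \<Rightarrow> 'x" where
  "comp_list f is = foldr (\<lambda>i g. f i \<circ> g) is id"

definition K_set ::
    "real \<Rightarrow> nat \<Rightarrow> nat \<Rightarrow> nat \<Rightarrow> nat set \<Rightarrow> (mtot \<Rightarrow> mtot) \<Rightarrow> mtot \<Rightarrow> mtot" where
  "K_set q m N n I = comp_list (K_lab q m N n) (sorted_list_of_set I)"

end

(*
  Write C for the Capelli matrix.  Since C_ij = sum_a d/dz_ia z_ja, the Fischer inner product gives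
  <V, C V> = sum_a |sum_j z_ja V_j|^2, so C is injective for m >= N, and bijective because it
  preserves finite-dimensional spaces.  Hence the contractions n_i are characterized by
  sum_j C_ij n_j = s_i; from the gl_N commutation relations of C and s one obtains n_i n_j = - n_j n_i,
  and n_i^+ anticommutes with n_j^- because the operators from which the two are built do so.
  Moreover z_i is the only Euler degree that n_i^+ changes, and the fermionic operators of different
  labels anticommute.  So H_i^+ and H_i^- have square zero, and operators H with different
  labels commute.  Then exp (sum_i H_i) = prod_i (1 + H_i), R_q is the product of the commuting
  R_i, and conjugation by R_q is the product of the commuting maps 1 + K_i, which is expanded.
*)

theory Submission
  imports Defs "HOL-Library.Function_Algebras"
begin

text \<open>The entries of the inverse Capelli matrix are given only through
  \<open>inv_into\<close>, so the contractions have no explicit formula. Identities about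
  \<open>n_plus\<close> are proved by showing that both sides solve one column system with a unique
  solution. \<open>n_plus_intertwine\<close> packages this for any operator \<open>T\<close> that
  commutes with all \<open>Cz m i j\<close> and, up to a fixed scalar, with all
  \<open>contr m i\<close>; the grading, the zbar-degree and \<open>n_minus\<close> are such
  \<open>T\<close>. A second holomorphic contraction is not, since its commutator with C is nonzero.

  Both tensor factors of an H are odd, so a composite of two H carries the Koszul sign -1. For
  different labels the bosonic and the fermionic anticommutation cancel; for a repeated label and
  equal type the composite vanishes in the bosonic factor. The plus and minus H of one label are
  never interchanged: the two factors of \<open>R_lab\<close> keep their order, and only factors of
  different labels are moved.

  All maps are total functions with meaning only on \<open>PCl m N\<close> or
  \<open>Mspace q m N n\<close>, hence the relative notions \<open>lin_on\<close>,
  \<open>endo\<close> and \<open>commute_on\<close>.\<close>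

abbreviation sing :: "'b \<Rightarrow> 'r::zero \<Rightarrow> 'b \<Rightarrow>\<^sub>0 'r" where "sing \<equiv> Poly_Mapping.single"
abbreviation keysof :: "('b \<Rightarrow>\<^sub>0 'r::zero) \<Rightarrow> 'b set" where "keysof \<equiv> Poly_Mapping.keys"
abbreviation coef :: "('b \<Rightarrow>\<^sub>0 'r::zero) \<Rightarrow> 'b \<Rightarrow> 'r" where "coef \<equiv> Poly_Mapping.lookup"

section \<open>Linear maps of free modules: values on basis vectors, supports of images\<close>

section \<open>Linear maps between free modules\<close>

definition plin :: "(('b \<Rightarrow>\<^sub>0 'r::comm_ring_1) \<Rightarrow> ('c \<Rightarrow>\<^sub>0 'r)) \<Rightarrow> bool" where
  "plin f \<longleftrightarrow> (\<forall>x y. f (x + y) = f x + f y) \<and> (\<forall>c x. f (smul c x) = smul c (f x))"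

lemma plin_add: "plin f \<Longrightarrow> f (x + y) = f x + f y"
  by (simp add: plin_def)

lemma plin_smul: "plin f \<Longrightarrow> f (smul c x) = smul c (f x)"
  by (simp add: plin_def)

lemma smul_minus: "smul c (- u) = - smul c u" "smul (- c) u = - smul c u"
  for u :: "'b \<Rightarrow>\<^sub>0 'r::comm_ring_1"
  by (rule poly_mapping_eqI, simp)+

lemma smul_diff: "smul c (u - w) = smul c u - smul c w" for u :: "'b \<Rightarrow>\<^sub>0 'r::comm_ring_1"
  by (rule poly_mapping_eqI) (simp add: lookup_minus algebra_simps)

lemma plin_zero: "plin f \<Longrightarrow> f 0 = 0"
  using plin_smul[of f 0 0] by simp

lemma plin_minus: "plin f \<Longrightarrow> f (- x) = - f x"
  using plin_smul[of f "- 1" x] by (simp add: smul_minus)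

lemma plin_diff: "plin f \<Longrightarrow> f (x - y) = f x - f y"
  using plin_add[of f x "- y"] by (simp add: plin_minus)

lemma plin_sum: "plin f \<Longrightarrow> f (\<Sum>i\<in>I. x i) = (\<Sum>i\<in>I. f (x i))"
  by (induction I rule: infinite_finite_induct) (simp_all add: plin_zero plin_add)

lemma plin_lin_ext [simp]: "plin (lin_ext \<phi>)"
  by (simp add: plin_def lin_ext_add lin_ext_smul)

lemma plin_id [simp]: "plin (\<lambda>x. x)"
  by (simp add: plin_def)

lemma plin_comp: "plin f \<Longrightarrow> plin g \<Longrightarrow> plin (\<lambda>x. f (g x))"
  by (simp add: plin_def)

lemma plin_fun_add: "plin f \<Longrightarrow> plin g \<Longrightarrow> plin (\<lambda>x. f x + g x)"
  by (simp add: plin_def smul_add algebra_simps)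

lemma plin_fun_diff: "plin f \<Longrightarrow> plin g \<Longrightarrow> plin (\<lambda>x. f x - g x)"
  by (simp add: plin_def smul_diff algebra_simps)

lemma plin_fun_uminus: "plin f \<Longrightarrow> plin (\<lambda>x. - f x)"
  by (simp add: plin_def smul_minus algebra_simps)

lemma plin_fun_smul: "plin f \<Longrightarrow> plin (\<lambda>x. smul c (f x))"
  by (simp add: plin_def smul_add smul_smul mult.commute)

lemma plin_fun_sum: "(\<And>i. i \<in> I \<Longrightarrow> plin (f i)) \<Longrightarrow> plin (\<lambda>x. \<Sum>i\<in>I. f i x)"
  by (simp add: plin_def smul_sum sum.distrib)

text \<open>Linear maps are determined on basis vectors. The set \<open>A\<close> allows identities
  that are checked on admissible basis elements only, such as \<open>pbasis m N\<close> or
  \<open>fbasis N n\<close>.\<close>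

lemma plin_eqI:
  assumes "plin f" "plin g" "keysof v \<subseteq> A"
    and "\<And>b. b \<in> A \<Longrightarrow> f (sing b 1) = g (sing b 1)"
  shows "f v = g v"
  using assms(3)
proof (induction v rule: keys_induct)
  case (single b c)
  have "sing b c = smul c (sing b 1)" by (simp add: smul_single)
  then show ?case by (simp add: plin_smul assms single)
qed (simp_all add: plin_zero plin_add assms)

lemma keys_sum_subset:
  "(\<And>i. i \<in> I \<Longrightarrow> keysof (f i) \<subseteq> A) \<Longrightarrow> keysof (\<Sum>i\<in>I. f i) \<subseteq> A"
proof (induction I rule: infinite_finite_induct)
  case (insert i I)
  then show ?case using keys_add[of "f i" "\<Sum>i\<in>I. f i"] by auto
qed auto

lemma keys_add_subset: "keysof u \<subseteq> A \<Longrightarrow> keysof w \<subseteq> A \<Longrightarrow> keysof (u + w) \<subseteq> A"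
  using keys_add[of u w] by auto

lemma keys_minus_subset: "keysof u \<subseteq> A \<Longrightarrow> keysof (- u) \<subseteq> A" for u :: "'b \<Rightarrow>\<^sub>0 'r::ab_group_add"
  by (auto simp: in_keys_iff)

lemma keys_diff_subset: "keysof u \<subseteq> A \<Longrightarrow> keysof w \<subseteq> A \<Longrightarrow> keysof (u - w) \<subseteq> A"
  for u :: "'b \<Rightarrow>\<^sub>0 'r::ab_group_add"
  using keys_diff[of u w] by auto

lemma keys_smul_subset: "keysof u \<subseteq> A \<Longrightarrow> keysof (smul c u) \<subseteq> A"
  for u :: "'b \<Rightarrow>\<^sub>0 'r::comm_ring_1"
proof
  fix b assume u: "keysof u \<subseteq> A" and "b \<in> keysof (smul c u)"
  then have "coef u b \<noteq> 0" by (auto simp: in_keys_iff)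
  then show "b \<in> A" using u by (auto simp: in_keys_iff)
qed

lemma keys_single_subset: "(c \<noteq> 0 \<Longrightarrow> b \<in> A) \<Longrightarrow> keysof (sing b c) \<subseteq> A"
  by auto

lemma plin_keys_subset:
  assumes "plin f" "keysof v \<subseteq> A" and "\<And>b. b \<in> A \<Longrightarrow> keysof (f (sing b 1)) \<subseteq> A'"
  shows "keysof (f v) \<subseteq> A'"
  using assms(2)
proof (induction v rule: keys_induct)
  case (single b c)
  have "sing b c = smul c (sing b 1)" by (simp add: smul_single)
  then show ?case by (simp add: plin_smul assms single keys_smul_subset)
qed (simp_all add: plin_zero plin_add assms keys_add_subset)

lemma lin_ext_keys_subset:
  assumes "keysof v \<subseteq> A" and "\<And>b. b \<in> A \<Longrightarrow> keysof (\<phi> b) \<subseteq> A'"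
  shows "keysof (lin_ext \<phi> v) \<subseteq> A'"
  by (rule plin_keys_subset[OF plin_lin_ext assms(1)]) (simp add: assms(2))

section \<open>Operators on exponents, and graded commutators with Clifford constants\<close>

section \<open>Elementary operators on Clifford-valued polynomials\<close>

text \<open>The operators that move exponents and leave the Clifford word alone. Multiplication by
  variables, derivatives and degree operators all have this form, so their relation to the Clifford
  side is proved once.\<close>

definition bos :: "(expo \<Rightarrow> expo \<Rightarrow> expo) \<Rightarrow> (expo \<Rightarrow> expo \<Rightarrow> expo) \<Rightarrow> (expo \<Rightarrow> expo \<Rightarrow> complex) \<Rightarrow>
    pcl \<Rightarrow> pcl" where
  "bos f g c = lin_ext (\<lambda>(\<mu>, \<nu>, S). sing (f \<mu> \<nu>, g \<mu> \<nu>, S) (c \<mu> \<nu>))"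

lemma bos_single [simp]:
  "bos f g c (sing (\<mu>, \<nu>, S) x) = sing (f \<mu> \<nu>, g \<mu> \<nu>, S) (x * c \<mu> \<nu>)"
  by (simp add: bos_def smul_single)

lemma plin_bos [simp]: "plin (bos f g c)"
  by (simp add: bos_def)

definition zmul :: "nat \<Rightarrow> nat \<Rightarrow> pcl \<Rightarrow> pcl" where
  "zmul k a = bos (\<lambda>\<mu> \<nu>. \<mu> + sing (k, a) 1) (\<lambda>\<mu> \<nu>. \<nu>) (\<lambda>\<mu> \<nu>. 1)"

definition zbmul :: "nat \<Rightarrow> nat \<Rightarrow> pcl \<Rightarrow> pcl" where
  "zbmul k a = bos (\<lambda>\<mu> \<nu>. \<mu>) (\<lambda>\<mu> \<nu>. \<nu> + sing (k, a) 1) (\<lambda>\<mu> \<nu>. 1)"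

definition dzb :: "nat \<Rightarrow> nat \<Rightarrow> pcl \<Rightarrow> pcl" where
  "dzb k a = bos (\<lambda>\<mu> \<nu>. \<mu>) (\<lambda>\<mu> \<nu>. \<nu> - sing (k, a) 1) (\<lambda>\<mu> \<nu>. of_nat (coef \<nu> (k, a)))"

lemma dz_bos: "dz k a = bos (\<lambda>\<mu> \<nu>. \<mu> - sing (k, a) 1) (\<lambda>\<mu> \<nu>. \<nu>) (\<lambda>\<mu> \<nu>. of_nat (coef \<mu> (k, a)))"
  by (simp add: dz_def bos_def)

lemma plin_pmul [simp]: "plin (pmul x)" "plin (\<lambda>y. pmul y x)"
  by (simp_all add: plin_def pmul_add_left pmul_add_right pmul_smul_left pmul_smul_right)

lemma plin_elementary [simp]: "plin (dz k a)" "plin (dzb k a)" "plin (zmul k a)" "plin (zbmul k a)"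
  by (simp_all add: dz_bos dzb_def zmul_def zbmul_def)

lemma plin_grade_inv [simp]: "plin grade_inv"
  by (simp add: grade_inv_def)

lemma pmul_zvar: "pmul (zvar k a) = zmul k a"
proof
  fix F :: pcl
  have U: "keysof F \<subseteq> UNIV" by simp
  show "pmul (zvar k a) F = zmul k a F"
    by (rule plin_eqI[OF _ _ U])
      (auto simp: zvar_def zmul_def pmul_single cl_sign_def symdiff_def add.commute split: prod.splits)
qed

definition cl_consts :: "pbase set" where
  "cl_consts = {(\<mu>, \<nu>, S). \<mu> = 0 \<and> \<nu> = 0 \<and> finite S}"

text \<open>A constant word adds 0 to the exponents, and its sign depends on the words only, so it
  cannot interact with an operator on exponents.\<close>

lemma bos_pmul:
  assumes "keysof g \<subseteq> cl_consts"
  shows "bos f h c (pmul g F) = pmul g (bos f h c F)"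
    and "bos f h c (pmul F g) = pmul (bos f h c F) g"
proof -
  have U: "keysof F \<subseteq> UNIV" by simp
  from assms have "bos f h c (pmul g F) = pmul g (bos f h c F) \<and>
     bos f h c (pmul F g) = pmul (bos f h c F) g"
  proof (induction g rule: keys_induct)
    case (single b x)
    from U show ?case
    proof (induction F rule: keys_induct)
      case (single b' x')
      obtain \<mu> \<nu> S T where "b' = (\<mu>, \<nu>, S)" "b = (0, 0, T)"
        using \<open>b \<in> cl_consts\<close> by (cases b; cases b') (auto simp: cl_consts_def)
      then show ?case
        by (simp add: pmul_single smul_single mult_ac)
    qed (simp_all add: plin_zero[OF plin_bos] plin_add[OF plin_bos] pmul_add_left pmul_add_right)
  qed (simp_all add: plin_zero[OF plin_bos] plin_add[OF plin_bos] pmul_add_left pmul_add_right)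
  then show "bos f h c (pmul g F) = pmul g (bos f h c F)"
    "bos f h c (pmul F g) = pmul (bos f h c F) g" by auto
qed

lemma bos_grade_inv: "bos f h c (grade_inv F) = grade_inv (bos f h c F)"
proof -
  have U: "keysof F \<subseteq> UNIV" by simp
  show ?thesis
    by (rule plin_eqI[OF _ _ U, of "\<lambda>F. bos f h c (grade_inv F)"])
      (auto intro: plin_comp simp: grade_inv_def smul_single mult.commute split: prod.splits)
qed

text \<open>For odd \<open>g\<close> this is the graded commutator with \<open>g\<close>.\<close>

definition gcomm :: "pcl \<Rightarrow> pcl \<Rightarrow> pcl" where
  "gcomm g F = pmul g F - pmul (grade_inv F) g"

lemma delta_gcomm: "delta a = gcomm (witt_fd a)"
  by (simp add: delta_def gcomm_def fun_eq_iff)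

lemma plin_gcomm [simp]: "plin (gcomm g)"
  unfolding gcomm_def by (intro plin_fun_diff plin_comp[of "\<lambda>y. pmul y g" grade_inv]) simp_all

lemma bos_gcomm: "keysof g \<subseteq> cl_consts \<Longrightarrow> bos f h c (gcomm g F) = gcomm g (bos f h c F)"
  by (simp add: gcomm_def plin_diff[OF plin_bos] bos_pmul bos_grade_inv)

lemma cl_consts_fin_words: "cl_consts \<subseteq> fin_words"
  by (auto simp: cl_consts_def fin_words_def)

lemma grade_inv_grade_inv [simp]: "grade_inv (grade_inv F) = F"
proof -
  have U: "keysof F \<subseteq> UNIV" by simp
  show ?thesis
    by (rule plin_eqI[OF plin_comp[OF plin_grade_inv plin_grade_inv] plin_id U])
      (auto simp: grade_inv_def smul_single split: prod.splits)
qed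

lemma keys_pmul_fin:
  assumes "keysof x \<subseteq> fin_words" "keysof y \<subseteq> fin_words"
  shows "keysof (pmul x y) \<subseteq> fin_words"
  unfolding pmul_def
  by (rule lin_ext_keys_subset[OF assms(1)], rule lin_ext_keys_subset[OF assms(2)])
    (auto simp: fin_words_def split: if_splits)

lemma keys_grade_inv_fin: "keysof x \<subseteq> A \<Longrightarrow> keysof (grade_inv x) \<subseteq> A"
  using keys_grade_inv by blast

text \<open>For odd \<open>g\<close> and \<open>h\<close> the sum of the two double graded
  commutators is the ordinary commutator of \<open>F\<close> with the anticommutator of
  \<open>g\<close> and \<open>h\<close>, which is a scalar.\<close>

lemma gcomm_gcomm:
  assumes "keysof g \<subseteq> cl_consts" "keysof h \<subseteq> cl_consts" "grade_inv g = - g" "grade_inv h = - h"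
    and "keysof F \<subseteq> fin_words" "pmul g h + pmul h g = smul c pone"
  shows "gcomm g (gcomm h F) = - gcomm h (gcomm g F)"
proof -
  have k: "keysof g \<subseteq> fin_words" "keysof h \<subseteq> fin_words" "keysof (grade_inv F) \<subseteq> fin_words"
    "keysof (pmul g h) \<subseteq> fin_words"
    using assms cl_consts_fin_words keys_grade_inv_fin[of F fin_words] keys_pmul_fin[of g h] by auto
  have "gcomm g (gcomm h F) + gcomm h (gcomm g F) =
      pmul (pmul g h + pmul h g) F - pmul F (pmul g h + pmul h g)"
    by (simp add: gcomm_def plin_diff[OF plin_grade_inv] grade_inv_mul k assms(1-5) pmul_diff pmul_minus
        keys_pmul_fin pmul_add_left pmul_add_right pmul_assoc)
  also have "\<dots> = 0"
    by (simp add: assms(6) pmul_smul_left pmul_smul_right)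
  finally show ?thesis by (simp add: eq_neg_iff_add_eq_0)
qed

lemma gcomm_grade_inv:
  assumes "keysof g \<subseteq> cl_consts" "grade_inv g = - g" "keysof F \<subseteq> fin_words"
  shows "gcomm g (grade_inv F) = - grade_inv (gcomm g F)"
  using assms cl_consts_fin_words
  by (simp add: gcomm_def plin_diff[OF plin_grade_inv] grade_inv_mul keys_grade_inv_fin pmul_minus)

lemma keys_witt: "keysof (witt_fd a) \<subseteq> {(0, 0, {2 * a}), (0, 0, {2 * a + 1})}"
  "keysof (witt_f a) \<subseteq> {(0, 0, {2 * a}), (0, 0, {2 * a + 1})}"
  unfolding witt_fd_def witt_f_def
  by (auto simp: in_keys_iff lookup_minus lookup_add cl_gen_def lookup_single when_def split: if_splits)

lemma keys_witt_consts: "keysof (witt_fd a) \<subseteq> cl_consts" "keysof (witt_f a) \<subseteq> cl_consts"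
  using keys_witt[of a] by (auto simp: cl_consts_def)

section \<open>Weyl algebra relations and the entries of the Capelli matrix\<close>

section \<open>The Capelli matrix\<close>

declare One_nat_def [simp del]

lemma pcl_eqI:
  assumes "plin f" "plin g" "\<And>\<mu> \<nu> S. f (sing (\<mu>, \<nu>, S) 1) = g (sing (\<mu>, \<nu>, S) 1)"
  shows "f F = g F"
  by (rule plin_eqI[OF assms(1,2) subset_UNIV]) (auto simp: assms(3))

lemma expo_minus_commute: "(\<mu> - sing x 1) - sing y 1 = (\<mu> - sing y 1) - sing x 1" for \<mu> :: expo
  by (rule poly_mapping_eqI) (simp add: lookup_minus)

lemma bos_bos:
  "bos f g c (bos f' g' c' F) =
    bos (\<lambda>\<mu> \<nu>. f (f' \<mu> \<nu>) (g' \<mu> \<nu>)) (\<lambda>\<mu> \<nu>. g (f' \<mu> \<nu>) (g' \<mu> \<nu>))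
      (\<lambda>\<mu> \<nu>. c' \<mu> \<nu> * c (f' \<mu> \<nu>) (g' \<mu> \<nu>)) F"
  by (rule pcl_eqI[where F = F]) (auto intro: plin_comp)

text \<open>Exponents have to agree only where the coefficient is nonzero: truncated subtraction
  yields a wrong exponent exactly when the coefficient of the derivative vanishes.\<close>

lemma bos_cong:
  assumes "\<And>\<mu> \<nu>. c \<mu> \<nu> = c' \<mu> \<nu>"
    and "\<And>\<mu> \<nu>. c' \<mu> \<nu> \<noteq> 0 \<Longrightarrow> f \<mu> \<nu> = f' \<mu> \<nu> \<and> g \<mu> \<nu> = g' \<mu> \<nu>"
  shows "bos f g c F = bos f' g' c' F"
proof (rule pcl_eqI[where F = F])
  fix \<mu> \<nu> :: expo and S :: "nat set"
  show "bos f g c (sing (\<mu>, \<nu>, S) 1) = bos f' g' c' (sing (\<mu>, \<nu>, S) 1)"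
    using assms[of \<mu> \<nu>] by (cases "c' \<mu> \<nu> = 0") auto
qed simp_all

lemma dz_dz: "dz k a (dz l b F) = dz l b (dz k a F)"
  unfolding dz_bos bos_bos
  by (cases "(k, a) = (l, b)"; rule bos_cong)
    (auto simp: lookup_minus lookup_single when_def expo_minus_commute[of _ "(k, a)"])

lemma zmul_zmul: "zmul k a (zmul l b F) = zmul l b (zmul k a F)"
  unfolding zmul_def bos_bos by (rule bos_cong) (auto simp: add_ac)

lemma plin_if: "plin f \<Longrightarrow> plin g \<Longrightarrow> plin (\<lambda>x. if P then f x else g x)"
  by (cases P) simp_all

lemma plin_zero_fun: "plin (\<lambda>x. 0)"
  by (simp add: plin_def)

lemma dz_zmul: "dz k a (zmul l b F) = zmul l b (dz k a F) + (if k = l \<and> a = b then F else 0)"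
proof (rule pcl_eqI[where F = F])
  show "plin (\<lambda>F. zmul l b (dz k a F) + (if k = l \<and> a = b then F else 0))"
    by (intro plin_fun_add plin_comp[of "zmul l b" "dz k a"] plin_if plin_id plin_zero_fun) simp_all
  fix \<mu> \<nu> :: expo and S :: "nat set"
  show "dz k a (zmul l b (sing (\<mu>, \<nu>, S) 1)) = zmul l b (dz k a (sing (\<mu>, \<nu>, S) 1)) +
      (if k = l \<and> a = b then sing (\<mu>, \<nu>, S) 1 else 0)"
  proof (cases "k = l \<and> a = b")
    case True
    have "sing (\<mu> - sing (l, b) 1 + sing (l, b) 1, \<nu>, S) (of_nat (coef \<mu> (l, b))) =
        sing (\<mu>, \<nu>, S) (of_nat (coef \<mu> (l, b)) :: complex)"
    \<comment> \<open>If the variable is absent, truncated subtraction does not restore the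
      exponent, but then both coefficients are 0.\<close>
    proof (cases "coef \<mu> (l, b) = 0")
      case False
      then have "\<mu> - sing (l, b) 1 + sing (l, b) 1 = \<mu>"
        by (intro poly_mapping_eqI) (auto simp: lookup_minus lookup_add lookup_single when_def)
      then show ?thesis by simp
    qed simp
    with True show ?thesis
      by (simp add: dz_bos zmul_def lookup_add flip: single_add)
  next
    case False
    then have "\<mu> + sing (l, b) 1 - sing (k, a) 1 = \<mu> - sing (k, a) 1 + sing (l, b) 1"
      by (intro poly_mapping_eqI) (auto simp: lookup_minus lookup_add lookup_single when_def)
    with False show ?thesis
      by (auto simp: dz_bos zmul_def lookup_add lookup_single when_def)
  qed
qed (rule plin_comp[of "dz k a" "zmul l b"]; simp)

lemma holo_antiholo:
  "dz k a (dzb l b F) = dzb l b (dz k a F)" "dz k a (zbmul l b F) = zbmul l b (dz k a F)"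
  "zmul k a (dzb l b F) = dzb l b (zmul k a F)" "zmul k a (zbmul l b F) = zbmul l b (zmul k a F)"
  unfolding dz_bos dzb_def zmul_def zbmul_def bos_bos by (rule bos_cong; simp add: mult_ac)+

lemma euler_z_zmul: "euler_z m j i F = (\<Sum>a=1..m. zmul j a (dz i a F))"
  by (simp add: euler_z_def pmul_zvar)

lemma plin_euler [simp]: "plin (euler_z m j i)"
  by (subst euler_z_zmul[abs_def], intro plin_fun_sum plin_comp[of "zmul _ _" "dz _ _"]) simp_all

lemma plin_Cz [simp]: "plin (Cz m i j)"
  unfolding Cz_def[abs_def] by (intro plin_fun_add plin_fun_smul) simp_all

lemma plin_contr [simp]: "plin (contr m i)"
  unfolding contr_def[abs_def] delta_gcomm
  by (intro plin_fun_sum plin_comp[of "gcomm _" "dz _ _"]) simp_all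

text \<open>Moving the derivative to the left of \<open>z_ja\<close> costs one identity for each
  \<open>a\<close> if \<open>i = j\<close>; these \<open>m\<close> identities are the diagonal shift
  of the Capelli matrix.\<close>

lemma Cz_dz_zmul: "Cz m i j F = (\<Sum>a=1..m. dz i a (zmul j a F))"
  by (auto simp: Cz_def euler_z_zmul dz_zmul sum.distrib smul_def intro!: poly_mapping_eqI
      simp: lookup_add lookup_sum map.rep_eq when_def)

lemma coef_dz: "coef (dz k a G) (\<mu>, \<nu>, S) = of_nat (coef \<mu> (k, a) + 1) * coef G (\<mu> + sing (k, a) 1, \<nu>, S)"
proof -
  have U: "keysof G \<subseteq> UNIV" by simp
  then show ?thesis
  proof (induction G rule: keys_induct)
    case (single b c)
    obtain \<mu>' \<nu>' S' where b: "b = (\<mu>', \<nu>', S')" by (cases b)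
    show ?case
    proof (cases "coef \<mu>' (k, a) = 0")
      case True
      then have "\<mu>' \<noteq> \<mu> + sing (k, a) 1" by (auto simp: lookup_add)
      with True show ?thesis by (simp add: b dz_bos lookup_single when_def)
    next
      case False
      have "\<mu>' - sing (k, a) 1 = \<mu> \<longleftrightarrow> \<mu>' = \<mu> + sing (k, a) 1"
      proof
        assume "\<mu>' - sing (k, a) 1 = \<mu>"
        then show "\<mu>' = \<mu> + sing (k, a) 1" using False
          by (intro poly_mapping_eqI) (auto simp: lookup_minus lookup_add lookup_single when_def split: if_splits)
      qed simp
      then show ?thesis by (auto simp: b dz_bos lookup_single when_def lookup_add)
    qed
  qed (simp_all add: plin_zero plin_add lookup_add algebra_simps)
qed

lemma coef_zmul: "coef (zmul k a G) (\<mu>, \<nu>, S) =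
  (if coef \<mu> (k, a) = 0 then 0 else coef G (\<mu> - sing (k, a) 1, \<nu>, S))"
proof -
  have U: "keysof G \<subseteq> UNIV" by simp
  then show ?thesis
  proof (induction G rule: keys_induct)
    case (single b c)
    obtain \<mu>' \<nu>' S' where b: "b = (\<mu>', \<nu>', S')" by (cases b)
    have "\<mu>' + sing (k, a) 1 = \<mu> \<longleftrightarrow> coef \<mu> (k, a) \<noteq> 0 \<and> \<mu>' = \<mu> - sing (k, a) 1"
    proof
      assume "coef \<mu> (k, a) \<noteq> 0 \<and> \<mu>' = \<mu> - sing (k, a) 1"
      then show "\<mu>' + sing (k, a) 1 = \<mu>"
        by (intro poly_mapping_eqI) (auto simp: lookup_minus lookup_add lookup_single when_def)
    qed (auto simp: lookup_add)
    then show ?case by (auto simp: b zmul_def lookup_single when_def)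
  qed (simp_all add: plin_zero plin_add lookup_add)
qed

section \<open>The Fischer inner product and injectivity of C and of C + 1\<close>

subsection \<open>Injectivity\<close>

definition wfact :: "expo \<Rightarrow> real" where
  "wfact \<mu> = (\<Prod>p\<in>keysof \<mu>. fact (coef \<mu> p))"

lemma wfact_superset: "finite A \<Longrightarrow> keysof \<mu> \<subseteq> A \<Longrightarrow> wfact \<mu> = (\<Prod>p\<in>A. fact (coef \<mu> p))"
  unfolding wfact_def by (rule prod.mono_neutral_left) (auto simp: in_keys_iff)

lemma wfact_pos: "wfact \<mu> > 0"
  unfolding wfact_def by (rule prod_pos) simp

text \<open>The ratio of neighbouring weights is the factor that a derivative produces in
  \<open>coef_dz\<close>; this is why multi-index factorials are the right weights.\<close>

lemma wfact_add_single: "wfact (\<mu> + sing p 1) = real (coef \<mu> p + 1) * wfact \<mu>"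
proof -
  let ?A = "insert p (keysof \<mu>)"
  have "keysof (\<mu> + sing p 1) \<subseteq> ?A" using keys_add[of \<mu> "sing p 1"] by auto
  then have 1: "wfact (\<mu> + sing p 1) = (\<Prod>x\<in>?A. fact (coef (\<mu> + sing p 1) x))"
    by (intro wfact_superset) auto
  have 2: "wfact \<mu> = (\<Prod>x\<in>?A. fact (coef \<mu> x))"
    by (intro wfact_superset) auto
  have "(\<Prod>x\<in>?A - {p}. fact (coef (\<mu> + sing p 1) x)) = (\<Prod>x\<in>?A - {p}. fact (coef \<mu> x) :: real)"
    by (rule prod.cong) (auto simp: lookup_add lookup_single)
  then show ?thesis
    unfolding 1 2 by (subst (1 2) prod.remove[of _ p]) (auto simp: lookup_add One_nat_def)
qed

text \<open>The Fischer inner product in the z variables: the monomial with exponent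
  \<open>\<mu>\<close> has squared norm \<open>\<mu>!\<close>. The zbar exponents and the words are
  orthonormal labels, since only z derivatives need an adjoint.\<close>

definition fischer :: "pcl \<Rightarrow> pcl \<Rightarrow> complex" where
  "fischer F G = (\<Sum>b\<in>keysof F. cnj (coef F b) * of_real (wfact (fst b)) * coef G b)"

lemma fischer_superset:
  "finite A \<Longrightarrow> keysof F \<subseteq> A \<Longrightarrow>
    fischer F G = (\<Sum>b\<in>A. cnj (coef F b) * of_real (wfact (fst b)) * coef G b)"
  unfolding fischer_def by (rule sum.mono_neutral_left) (auto simp: in_keys_iff)

lemma fischer_add_left: "fischer (F + F') G = fischer F G + fischer F' G"
proof -
  let ?A = "keysof F \<union> keysof F'"
  have "keysof (F + F') \<subseteq> ?A" by (rule keys_add)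
  then show ?thesis
    by (simp add: fischer_superset[of ?A] lookup_add algebra_simps sum.distrib)
qed

lemma fischer_add_right: "fischer F (G + G') = fischer F G + fischer F G'"
  by (simp add: fischer_def lookup_add algebra_simps sum.distrib)

lemma fischer_zero [simp]: "fischer 0 G = 0" "fischer F 0 = 0"
  by (simp_all add: fischer_def)

lemma fischer_sum_left: "fischer (\<Sum>i\<in>I. F i) G = (\<Sum>i\<in>I. fischer (F i) G)"
  by (induction I rule: infinite_finite_induct) (simp_all add: fischer_add_left)

lemma fischer_sum_right: "fischer F (\<Sum>i\<in>I. G i) = (\<Sum>i\<in>I. fischer F (G i))"
  by (induction I rule: infinite_finite_induct) (simp_all add: fischer_add_right)

lemma fischer_smul_right: "fischer F (smul c G) = c * fischer F G"
  by (simp add: fischer_def sum_distrib_left mult_ac)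

lemma fischer_single: "fischer (sing b c) G = cnj c * of_real (wfact (fst b)) * coef G b"
  by (subst fischer_superset[of "{b}"]) auto

text \<open>On a single basis vector both sides pick the same coefficient of \<open>G\<close>; the
  factor from the derivative on the left is absorbed by the weight on the right.\<close>

lemma fischer_adjoint: "fischer F (dz k a G) = fischer (zmul k a F) G"
proof -
  have U: "keysof F \<subseteq> UNIV" by simp
  then show ?thesis
  proof (induction F rule: keys_induct)
    case (single b c)
    obtain \<mu> \<nu> S where b: "b = (\<mu>, \<nu>, S)" by (cases b)
    show ?case
      by (simp only: b zmul_def bos_single fischer_single coef_dz wfact_add_single fst_conv
          of_real_mult of_real_of_nat_eq mult_1_left mult_1_right) (simp only: mult_ac)
  qed (simp_all add: plin_zero plin_add fischer_add_left)
qed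

lemma fischer_self: "fischer F F = of_real (\<Sum>b\<in>keysof F. (cmod (coef F b))\<^sup>2 * wfact (fst b))"
  unfolding fischer_def of_real_sum of_real_mult complex_norm_square by (simp only: mult_ac)

lemma fischer_nonneg: "0 \<le> Re (fischer F F)"
  by (simp add: fischer_self wfact_pos less_imp_le sum_nonneg)

lemma fischer_eq_0: "Re (fischer F F) = 0 \<Longrightarrow> F = 0"
proof (rule ccontr)
  assume r: "Re (fischer F F) = 0" and "F \<noteq> 0"
  then have ne: "keysof F \<noteq> {}" by simp
  have "0 < (\<Sum>b\<in>keysof F. (cmod (coef F b))\<^sup>2 * wfact (fst b))"
    by (rule sum_pos) (use ne in \<open>auto simp: in_keys_iff wfact_pos\<close>)
  with r show False by (simp add: fischer_self)
qed

text \<open>\<open>\<langle>V, (\<C>\<^sub>z + t) V\<rangle> = \<Sum>\<^sub>a \<parallel>\<Sum>\<^sub>j z\<^sub>j\<^sub>a V\<^sub>j\<parallel>\<^sup>2 + t \<parallel>V\<parallel>\<^sup>2\<close> because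
  \<open>(\<C>\<^sub>z)\<^sub>i\<^sub>j = \<Sum>\<^sub>a \<partial>\<^sub>i\<^sub>a z\<^sub>j\<^sub>a\<close>.\<close>

lemma Cz_kernel:
  assumes "0 \<le> t" and ker: "\<And>i. i \<in> {1..N} \<Longrightarrow> (\<Sum>j=1..N. Cz m i j (V j)) + smul (of_real t) (V i) = 0"
  shows "a \<in> {1..m} \<Longrightarrow> (\<Sum>j=1..N. zmul j a (V j)) = 0"
    and "i \<in> {1..N} \<Longrightarrow> t > 0 \<Longrightarrow> V i = 0"
proof -
  let ?Y = "\<lambda>a. \<Sum>j=1..N. zmul j a (V j)"
  \<comment> \<open>Equation \<open>i\<close> is paired with \<open>V i\<close> and summed over
    \<open>i\<close>. Both resulting terms have nonnegative real part, so each of them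
    vanishes.\<close>
  have "0 = (\<Sum>i=1..N. fischer (V i) ((\<Sum>j=1..N. Cz m i j (V j)) + smul (of_real t) (V i)))"
    by (simp add: ker)
  also have "\<dots> = (\<Sum>i=1..N. \<Sum>j=1..N. \<Sum>a=1..m. fischer (zmul i a (V i)) (zmul j a (V j)))
      + of_real t * (\<Sum>i=1..N. fischer (V i) (V i))"
    by (simp add: fischer_add_right fischer_sum_right fischer_smul_right Cz_dz_zmul fischer_adjoint
        sum.distrib sum_distrib_left)
  also have "(\<Sum>i=1..N. \<Sum>j=1..N. \<Sum>a=1..m. fischer (zmul i a (V i)) (zmul j a (V j))) =
      (\<Sum>i=1..N. \<Sum>a=1..m. \<Sum>j=1..N. fischer (zmul i a (V i)) (zmul j a (V j)))"
    by (rule sum.cong[OF refl], rule sum.swap)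
  also have "\<dots> = (\<Sum>a=1..m. fischer (?Y a) (?Y a))"
    by (subst sum.swap, subst fischer_sum_left, subst fischer_sum_right) (rule refl)
  finally have "(\<Sum>a=1..m. fischer (?Y a) (?Y a)) + of_real t * (\<Sum>i=1..N. fischer (V i) (V i)) = 0" ..
  then have "Re ((\<Sum>a=1..m. fischer (?Y a) (?Y a)) + of_real t * (\<Sum>i=1..N. fischer (V i) (V i))) = 0"
    by simp
  then have s: "(\<Sum>a=1..m. Re (fischer (?Y a) (?Y a))) + t * (\<Sum>i=1..N. Re (fischer (V i) (V i))) = 0"
    by (simp only: plus_complex.sel Re_sum times_complex.sel Re_complex_of_real Im_complex_of_real mult_zero_left diff_0_right)
  have p1: "(\<Sum>a=1..m. Re (fischer (?Y a) (?Y a))) \<ge> 0"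
    by (intro sum_nonneg fischer_nonneg)
  have p2: "(\<Sum>i=1..N. Re (fischer (V i) (V i))) \<ge> 0"
    by (intro sum_nonneg fischer_nonneg)
  have p3: "t * (\<Sum>i=1..N. Re (fischer (V i) (V i))) \<ge> 0"
    using p2 assms(1) by simp
  have z1: "(\<Sum>a=1..m. Re (fischer (?Y a) (?Y a))) = 0"
    and z2: "t * (\<Sum>i=1..N. Re (fischer (V i) (V i))) = 0"
    using s p1 p3 by linarith+
  show "?Y a = 0" if "a \<in> {1..m}"
    using z1 that by (subst (asm) sum_nonneg_eq_0_iff) (auto intro: fischer_nonneg fischer_eq_0)
  show "V i = 0" if "i \<in> {1..N}" "t > 0"
    using z2 that by (simp, subst (asm) sum_nonneg_eq_0_iff) (auto intro: fischer_nonneg fischer_eq_0)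
qed

text \<open>Multiplication by \<open>z\<^sub>i\<^sub>i\<close> raises the degree in the diagonal variables, multiplication by
  the off-diagonal variables does not; hence a term of maximal diagonal degree cannot cancel.\<close>

lemma zmul_sum_eq_0:
  assumes Y: "\<And>a. a \<in> {1..N} \<Longrightarrow> (\<Sum>j=1..N. zmul j a (V j)) = 0" and "i \<in> {1..N}"
  shows "V i = 0"
proof (rule ccontr)
  define L :: "pbase \<Rightarrow> nat" where "L b = (\<Sum>k=1..N. coef (fst b) (k, k))" for b
  let ?K = "\<Union>i\<in>{1..N}. keysof (V i)"
  assume "V i \<noteq> 0"
  then have "?K \<noteq> {}" using assms(2) by auto
  moreover have fin: "finite ?K" by auto
  ultimately have "Max (L ` ?K) \<in> L ` ?K" by (intro Max_in) auto
  then obtain b k where k: "k \<in> {1..N}" "b \<in> keysof (V k)" and Lb: "L b = Max (L ` ?K)" by auto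
  then have max: "L b' \<le> L b" if "j \<in> {1..N}" "b' \<in> keysof (V j)" for j b'
    using fin that unfolding Lb by (intro Max_ge) blast+
  obtain \<mu> \<nu> S where b: "b = (\<mu>, \<nu>, S)" by (cases b)
  \<comment> \<open>In equation \<open>a = k\<close> the term \<open>j = k\<close> contributes the
    chosen leading coefficient at this exponent. A term with \<open>j \<noteq> k\<close> would need
    a monomial of diagonal degree \<open>L b + 1\<close>, above the maximum.\<close>
  let ?\<mu> = "\<mu> + sing (k, k) 1"
  have "0 = coef (\<Sum>j=1..N. zmul j k (V j)) (?\<mu>, \<nu>, S)" using Y k by simp
  also have "\<dots> = (\<Sum>j=1..N. coef (zmul j k (V j)) (?\<mu>, \<nu>, S))" by (simp add: lookup_sum)
  also have "\<dots> = (\<Sum>j=1..N. if j = k then coef (V k) b else 0)"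
  proof (rule sum.cong[OF refl])
    fix j assume j: "j \<in> {1..N}"
    show "coef (zmul j k (V j)) (?\<mu>, \<nu>, S) = (if j = k then coef (V k) b else 0)"
    proof (cases "j = k")
      case False
      have "coef (V j) (?\<mu> - sing (j, k) 1, \<nu>, S) = 0"
      proof (rule ccontr)
        assume "coef (V j) (?\<mu> - sing (j, k) 1, \<nu>, S) \<noteq> 0"
        then have "L (?\<mu> - sing (j, k) 1, \<nu>, S) \<le> L b"
          using max[OF j] by (simp add: in_keys_iff)
        moreover have "L (?\<mu> - sing (j, k) 1, \<nu>, S) = (\<Sum>l=1..N. coef \<mu> (l, l) + (if l = k then 1 else 0))"
          unfolding L_def by (rule sum.cong) (use False in \<open>auto simp: lookup_minus lookup_add lookup_single when_def\<close>)
        ultimately show False using k(1) by (simp add: L_def b sum.distrib)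
      qed
      with False show ?thesis by (simp add: coef_zmul)
    qed (simp add: coef_zmul b lookup_add)
  qed
  also have "\<dots> = coef (V k) b" using k(1) by simp
  finally show False using k(2) by (simp add: in_keys_iff)
qed

text \<open>The Fischer identity with \<open>t = 0\<close> annihilates the sums over
  \<open>j\<close> of \<open>z_ja V_j\<close> for \<open>a \<le> m\<close>. Because
  \<open>m \<ge> N\<close>, this covers \<open>a = 1..N\<close>, the square system that contains all
  diagonal variables.\<close>

lemma Cz_injective:
  assumes "m \<ge> N" and "\<And>i. i \<in> {1..N} \<Longrightarrow> (\<Sum>j=1..N. Cz m i j (V j)) = 0" and "i \<in> {1..N}"
  shows "V i = 0"
proof (rule zmul_sum_eq_0[OF _ assms(3)])
  fix a assume "a \<in> {1..N}"
  then show "(\<Sum>j=1..N. zmul j a (V j)) = 0"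
    by (intro Cz_kernel(1)[where t = 0 and m = m]) (use assms in auto)
qed

text \<open>With \<open>t = 1\<close> the norm of \<open>V\<close> itself is a summand of the
  Fischer identity. Serves \<open>n_plus_anticomm\<close>, where the anticommutators form a column
  in this kernel.\<close>

lemma Cz_plus_one_injective:
  assumes "\<And>i. i \<in> {1..N} \<Longrightarrow> (\<Sum>j=1..N. Cz m i j (V j)) + V i = 0" and "i \<in> {1..N}"
  shows "V i = 0"
  by (rule Cz_kernel(2)[where t = 1 and m = m and V = V, OF _ _ assms(2)]) (use assms in auto)

section \<open>Finite-dimensional invariant pieces and surjectivity of C\<close>

subsection \<open>Surjectivity\<close>

lemma PCl_iff: "F \<in> PCl m N \<longleftrightarrow> keysof F \<subseteq> pbasis m N"
  by (simp add: PCl_def)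

lemma PCl_zero [simp]: "0 \<in> PCl m N"
  by (simp add: PCl_def)

lemma PCl_add: "F \<in> PCl m N \<Longrightarrow> G \<in> PCl m N \<Longrightarrow> F + G \<in> PCl m N"
  by (simp add: PCl_iff keys_add_subset)

lemma PCl_diff: "F \<in> PCl m N \<Longrightarrow> G \<in> PCl m N \<Longrightarrow> F - G \<in> PCl m N"
  by (simp add: PCl_iff keys_diff_subset)

lemma PCl_smul: "F \<in> PCl m N \<Longrightarrow> smul c F \<in> PCl m N"
  by (simp add: PCl_iff keys_smul_subset)

lemma PCl_sum: "(\<And>i. i \<in> I \<Longrightarrow> F i \<in> PCl m N) \<Longrightarrow> (\<Sum>i\<in>I. F i) \<in> PCl m N"
  by (simp add: PCl_iff keys_sum_subset)

lemma pbasis_fin_words: "pbasis m N \<subseteq> fin_words"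
  by (auto simp: pbasis_def fin_words_def intro: finite_subset)

lemma PCl_fin_words: "F \<in> PCl m N \<Longrightarrow> keysof F \<subseteq> fin_words"
  using pbasis_fin_words by (auto simp: PCl_iff)

lemma PCl_pmul: "F \<in> PCl m N \<Longrightarrow> G \<in> PCl m N \<Longrightarrow> pmul F G \<in> PCl m N"
proof -
  assume FG: "F \<in> PCl m N" "G \<in> PCl m N"
  show ?thesis
    unfolding PCl_iff pmul_def
  proof (rule lin_ext_keys_subset[OF FG(1)[unfolded PCl_iff]],
      rule lin_ext_keys_subset[OF FG(2)[unfolded PCl_iff]])
    fix b b' assume "b \<in> pbasis m N" "b' \<in> pbasis m N"
    then show "keysof (pbase_mul b b') \<subseteq> pbasis m N"
      by (cases b; cases b', simp only: pbase_mul.simps, intro keys_single_subset,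
          simp only: pbasis_def mem_Collect_eq prod.case, intro conjI keys_add_subset)
        (auto simp: symdiff_def)
  qed
qed

lemma PCl_grade_inv: "F \<in> PCl m N \<Longrightarrow> grade_inv F \<in> PCl m N"
  by (simp add: PCl_iff keys_grade_inv_fin)

lemma PCl_witt: "a \<in> {1..m} \<Longrightarrow> witt_fd a \<in> PCl m N" "a \<in> {1..m} \<Longrightarrow> witt_f a \<in> PCl m N"
  using keys_witt[of a] by (force simp: PCl_iff pbasis_def)+

lemma PCl_gcomm: "g \<in> PCl m N \<Longrightarrow> F \<in> PCl m N \<Longrightarrow> gcomm g F \<in> PCl m N"
  by (simp add: gcomm_def PCl_diff PCl_pmul PCl_grade_inv)

lemma bos_PCl:
  assumes "F \<in> PCl m N"
    and "\<And>\<mu> \<nu>. keysof \<mu> \<subseteq> {1..N} \<times> {1..m} \<Longrightarrow> keysof \<nu> \<subseteq> {1..N} \<times> {1..m} \<Longrightarrow>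
      keysof (f \<mu> \<nu>) \<subseteq> {1..N} \<times> {1..m} \<and> keysof (g \<mu> \<nu>) \<subseteq> {1..N} \<times> {1..m}"
  shows "bos f g c F \<in> PCl m N"
  unfolding PCl_iff bos_def
proof (rule lin_ext_keys_subset[OF assms(1)[unfolded PCl_iff]])
  fix b assume b: "b \<in> pbasis m N"
  obtain \<mu> \<nu> S where bb: "b = (\<mu>, \<nu>, S)" by (cases b)
  show "keysof ((\<lambda>(\<mu>, \<nu>, S). sing (f \<mu> \<nu>, g \<mu> \<nu>, S) (c \<mu> \<nu>)) b) \<subseteq> pbasis m N"
    using b assms(2)[of \<mu> \<nu>] unfolding bb pbasis_def by (simp split: if_splits)
qed

lemma keys_expo_diff: "keysof (\<mu> - \<mu>') \<subseteq> keysof \<mu>" for \<mu> :: expo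
  by (auto simp: in_keys_iff lookup_minus)

lemma PCl_elementary:
  assumes "F \<in> PCl m N"
  shows "dz k a F \<in> PCl m N" "dzb k a F \<in> PCl m N"
    and "k \<in> {1..N} \<Longrightarrow> a \<in> {1..m} \<Longrightarrow> zmul k a F \<in> PCl m N"
    and "k \<in> {1..N} \<Longrightarrow> a \<in> {1..m} \<Longrightarrow> zbmul k a F \<in> PCl m N"
  using keys_expo_diff keys_add[of _ "sing (k, a) 1 :: expo"]
  unfolding dz_bos dzb_def zmul_def zbmul_def
  by (intro bos_PCl[OF assms]; fastforce)+

lemma PCl_euler: "i \<in> {1..N} \<Longrightarrow> F \<in> PCl m N \<Longrightarrow> euler_z m i j F \<in> PCl m N"
  unfolding euler_z_zmul by (intro PCl_sum PCl_elementary)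

lemma PCl_Cz: "j \<in> {1..N} \<Longrightarrow> F \<in> PCl m N \<Longrightarrow> Cz m i j F \<in> PCl m N"
  unfolding Cz_dz_zmul by (intro PCl_sum PCl_elementary)

lemma PCl_contr: "F \<in> PCl m N \<Longrightarrow> contr m i F \<in> PCl m N"
  by (auto simp: contr_def delta_gcomm intro!: PCl_sum PCl_gcomm PCl_witt PCl_elementary)

text \<open>Dimension count: the image of a basis \<open>B\<close> of the span is independent and
  has as many elements as \<open>B\<close>. A vector of \<open>T\<close> outside its span would give
  an independent subset larger than \<open>B\<close>.\<close>

lemma (in vector_space) linear_inj_surj_on_span:
  assumes lin: "Vector_Spaces.linear scale scale f" and T: "finite T"
    and sub: "f ` span T \<subseteq> span T" and inj: "inj_on f (span T)"
  shows "f ` span T = span T"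
proof
  interpret f: Vector_Spaces.linear scale scale f by (rule lin)
  obtain B where B: "B \<subseteq> T" "independent B" "T \<subseteq> span B"
    using maximal_independent_subset[of T] by blast
  have sB: "span B = span T" using B span_mono[of B T] span_mono[OF B(3)] by (simp add: span_span)
  have fB: "finite B" using B(1) T by (rule finite_subset)
  have ind: "independent (f ` B)"
    by (rule f.independent_injective_image) (use B inj sB in auto)
  have "T \<subseteq> span (f ` B)"
  proof
    fix x assume "x \<in> T"
    show "x \<in> span (f ` B)"
    proof (rule ccontr)
      assume x: "x \<notin> span (f ` B)"
      then have nx: "x \<notin> f ` B" using span_base by blast
      have "independent (insert x (f ` B))" using ind x nx by (simp add: independent_insert)
      moreover have "insert x (f ` B) \<subseteq> span B"
        using \<open>x \<in> T\<close> B(3) sub span_superset[of B] sB by auto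
      ultimately have "card (insert x (f ` B)) \<le> card B"
        using independent_span_bound[OF fB] by blast
      moreover have "card (f ` B) = card B"
        by (rule card_image) (use inj sB span_superset[of B] in \<open>auto intro: inj_on_subset\<close>)
      ultimately show False using nx fB by simp
    qed
  qed
  then have "span T \<subseteq> span (f ` B)" using span_mono span_span by metis
  also have "\<dots> = f ` span T" using f.span_image[of B] sB by simp
  finally show "span T \<subseteq> f ` span T" .
qed (rule sub)

text \<open>Columns form a complex vector space under pointwise operations, so that the dimension
  count applies to the operator matrix as one linear map.\<close>

interpretation col: vector_space "\<lambda>(c :: complex) (V :: nat \<Rightarrow> pcl) i. smul c (V i)"
  by unfold_locales (auto simp: fun_eq_iff smul_add smul_add_left smul_smul)

definition cols_in :: "nat \<Rightarrow> pbase set \<Rightarrow> (nat \<Rightarrow> pcl) set" where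
  "cols_in N A = {V. (\<forall>i\<in>{1..N}. keysof (V i) \<subseteq> A) \<and> (\<forall>i. i \<notin> {1..N} \<longrightarrow> V i = 0)}"

lemma columns_cols_in: "columns m N = cols_in N (pbasis m N)"
  by (simp add: columns_def cols_in_def PCl_iff)

definition col_unit :: "nat \<Rightarrow> pbase \<Rightarrow> nat \<Rightarrow> pcl" where
  "col_unit k b = (\<lambda>i. if i = k then sing b 1 else 0)"

lemma sum_fun_apply: "(\<Sum>x\<in>I. f x) i = (\<Sum>x\<in>I. f x i)" for f :: "'a \<Rightarrow> 'b \<Rightarrow> 'c::comm_monoid_add"
  by (induction I rule: infinite_finite_induct) simp_all

lemma cols_in_span:
  assumes "finite A"
  shows "cols_in N A = col.span (case_prod col_unit ` ({1..N} \<times> A))" (is "?W = col.span ?T")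
proof
  have "col.subspace ?W"
    by (rule col.subspaceI) (auto simp: cols_in_def keys_add_subset keys_smul_subset)
  moreover have "?T \<subseteq> ?W" by (auto simp: cols_in_def col_unit_def split: if_splits)
  ultimately show "col.span ?T \<subseteq> ?W" by (rule col.span_minimal[rotated])
next
  show "?W \<subseteq> col.span ?T"
  proof
    fix V assume V: "V \<in> ?W"
    have "V = (\<Sum>k\<in>{1..N}. \<Sum>b\<in>A. (\<lambda>i. smul (coef (V k) b) (col_unit k b i)))"
    proof
      fix i
      have e: "V i = (\<Sum>b\<in>A. smul (coef (V i) b) (sing b 1))" if "i \<in> {1..N}"
      proof (rule poly_mapping_eqI)
        fix b
        have "coef (V i) b = 0" if "b \<notin> A" 
        proof -
          have "keysof (V i) \<subseteq> A" using V \<open>i \<in> {1..N}\<close> by (simp add: cols_in_def)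
          then have "b \<notin> keysof (V i)" using that by blast
          then show ?thesis by (simp add: in_keys_iff)
        qed
        then show "coef (V i) b = coef (\<Sum>b\<in>A. smul (coef (V i) b) (sing b 1)) b"
          using assms
          by (auto simp: lookup_sum lookup_single when_def if_distrib[of "(*) _"] cong: if_cong)
      qed
      have "(\<Sum>k\<in>{1..N}. \<Sum>b\<in>A. (\<lambda>i. smul (coef (V k) b) (col_unit k b i))) i =
          (\<Sum>k\<in>{1..N}. if k = i then (\<Sum>b\<in>A. smul (coef (V k) b) (sing b 1)) else 0)"
        unfolding sum_fun_apply by (rule sum.cong) (auto simp: col_unit_def intro: sum.neutral)
      also have "\<dots> = V i"
        using e[symmetric] V by (cases "i \<in> {1..N}") (auto simp: cols_in_def)
      finally show "V i = (\<Sum>k\<in>{1..N}. \<Sum>b\<in>A. (\<lambda>i. smul (coef (V k) b) (col_unit k b i))) i" ..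
    qed
    moreover have "(\<Sum>k\<in>{1..N}. \<Sum>b\<in>A. (\<lambda>i. smul (coef (V k) b) (col_unit k b i))) \<in> col.span ?T"
      by (intro col.span_sum col.span_scale col.span_base) auto
    ultimately show "V \<in> col.span ?T" by simp
  qed
qed

lemma Cz_op_linear:
  "Vector_Spaces.linear (\<lambda>c V i. smul c (V i)) (\<lambda>c V i. smul c (V i)) (Cz_op m N)"
  by unfold_locales (auto simp: fun_eq_iff Cz_op_def smul_add smul_add_left smul_smul smul_sum
      plin_add[OF plin_Cz] plin_smul[OF plin_Cz] sum.distrib)

lemma Cz_op_inj_on:
  assumes "m \<ge> N" and zero: "\<And>V. V \<in> W \<Longrightarrow> \<forall>i. i \<notin> {1..N} \<longrightarrow> V i = 0"
  shows "inj_on (Cz_op m N) W"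
proof (rule inj_onI)
  fix V V' assume V: "V \<in> W" "V' \<in> W" and eq: "Cz_op m N V = Cz_op m N V'"
  have "V i - V' i = 0" if "i \<in> {1..N}" for i
  proof (rule Cz_injective[OF assms(1) _ that, where V = "\<lambda>i. V i - V' i"])
    fix k assume "k \<in> {1..N}"
    then show "(\<Sum>j=1..N. Cz m k j (V j - V' j)) = 0"
      using fun_cong[OF eq, of k] by (simp add: Cz_op_def plin_diff[OF plin_Cz] sum_subtractf)
  qed
  then have "V i = V' i" for i
    using zero[OF V(1)] zero[OF V(2)] by (cases "i \<in> {1..N}") auto
  then show "V = V'" by auto
qed

definition hdeg :: "nat \<Rightarrow> nat \<Rightarrow> expo \<Rightarrow> nat" where
  "hdeg m N \<mu> = (\<Sum>p\<in>{1..N} \<times> {1..m}. coef \<mu> p)"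

lemma hdeg_add: "hdeg m N (\<mu> + \<mu>') = hdeg m N \<mu> + hdeg m N \<mu>'"
  by (simp add: hdeg_def lookup_add sum.distrib)

lemma hdeg_single: "p \<in> {1..N} \<times> {1..m} \<Longrightarrow> hdeg m N (sing p 1) = 1"
  by (simp add: hdeg_def lookup_single when_def)

lemma finite_expo_bounded: "finite {\<mu>. keysof \<mu> \<subseteq> {1..N} \<times> {1..m} \<and> hdeg m N \<mu> \<le> d}"
proof -
  let ?P = "{1..N} \<times> {1..m}"
  let ?F = "{f. \<forall>x. (x \<in> ?P \<longrightarrow> f x \<in> {..d}) \<and> (x \<notin> ?P \<longrightarrow> f x = (0::nat))}"
  have "finite ?F" by (rule finite_set_of_finite_funs) auto
  moreover have "coef ` {\<mu>. keysof \<mu> \<subseteq> ?P \<and> hdeg m N \<mu> \<le> d} \<subseteq> ?F"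
  proof (clarify, intro conjI impI)
    fix \<mu> :: expo and x y assume \<mu>: "keysof \<mu> \<subseteq> ?P" "hdeg m N \<mu> \<le> d"
    show "coef \<mu> (x, y) \<in> {..d}" if "(x, y) \<in> ?P"
    proof -
      have "coef \<mu> (x, y) \<le> hdeg m N \<mu>" unfolding hdeg_def
        by (rule member_le_sum) (use that in auto)
      with \<mu>(2) show ?thesis by simp
    qed
    show "coef \<mu> (x, y) = 0" if "(x, y) \<notin> ?P"
      using that \<mu>(1) by (meson in_keys_iff subsetD)
  qed
  ultimately have "finite (coef ` {\<mu>. keysof \<mu> \<subseteq> ?P \<and> hdeg m N \<mu> \<le> d})" by (rule finite_subset[rotated])
  then show ?thesis by (rule finite_imageD) (auto intro: inj_onI poly_mapping_eqI)
qed

text \<open>Spans a finite-dimensional space that C preserves: C changes neither zbar exponents nor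
  words and keeps the total z-degree. The degree is bounded rather than fixed because a right-hand
  side need not be homogeneous.\<close>

definition bounded_basis :: "nat \<Rightarrow> nat \<Rightarrow> nat \<Rightarrow> expo set \<Rightarrow> pbase set" where
  "bounded_basis m N d Y = {(\<mu>, \<nu>, S). keysof \<mu> \<subseteq> {1..N} \<times> {1..m} \<and> hdeg m N \<mu> \<le> d \<and>
     \<nu> \<in> Y \<and> S \<subseteq> {2..2 * m + 1}}"

lemma finite_bounded_basis: "finite Y \<Longrightarrow> finite (bounded_basis m N d Y)"
proof -
  assume "finite Y"
  moreover have "bounded_basis m N d Y \<subseteq>
      {\<mu>. keysof \<mu> \<subseteq> {1..N} \<times> {1..m} \<and> hdeg m N \<mu> \<le> d} \<times> Y \<times> Pow {2..2 * m + 1}"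
    by (auto simp: bounded_basis_def)
  ultimately show ?thesis using finite_expo_bounded
    by (meson finite_Pow_iff finite_SigmaI finite_atLeastAtMost finite_subset)
qed

text \<open>The operator \<open>zmul j a\<close> after \<open>dz i a\<close> trades one
  \<open>z_ia\<close> for one \<open>z_ja\<close>, so the total z-degree over all labels is
  unchanged, although the degrees of the labels \<open>i\<close> and \<open>j\<close> may
  change.\<close>

lemma Cz_bounded_basis:
  assumes "i \<in> {1..N}" "j \<in> {1..N}" "keysof F \<subseteq> bounded_basis m N d Y"
  shows "keysof (Cz m i j F) \<subseteq> bounded_basis m N d Y"
proof (rule plin_keys_subset[OF plin_Cz assms(3)])
  fix b assume b: "b \<in> bounded_basis m N d Y"
  obtain \<mu> \<nu> S where bb: "b = (\<mu>, \<nu>, S)" by (cases b)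
  have "keysof (zmul j a (dz i a (sing b 1))) \<subseteq> bounded_basis m N d Y" if a: "a \<in> {1..m}" for a
  proof (cases "coef \<mu> (i, a) = 0")
    case True
    then have "dz i a (sing b 1) = 0" by (simp add: bb dz_bos)
    then show ?thesis by (simp add: plin_zero)
  next
    case False
    define \<mu>' where "\<mu>' = \<mu> - sing (i, a) 1"
    have \<mu>: "\<mu> = \<mu>' + sing (i, a) 1" unfolding \<mu>'_def
      by (rule poly_mapping_eqI) (use False in \<open>auto simp: lookup_add lookup_minus lookup_single when_def\<close>)
    have "hdeg m N (\<mu>' + sing (j, a) 1) = hdeg m N \<mu>"
      unfolding \<mu> hdeg_add using a assms hdeg_single[of _ N m] by simp
    moreover have "keysof (\<mu>' + sing (j, a) 1) \<subseteq> {1..N} \<times> {1..m}"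
    proof (rule keys_add_subset)
      show "keysof \<mu>' \<subseteq> {1..N} \<times> {1..m}"
        using keys_expo_diff[of \<mu> "sing (i, a) 1"] b by (auto simp: \<mu>'_def bb bounded_basis_def)
    qed (use a assms in auto)
    ultimately show ?thesis
      using b by (auto simp: bb dz_bos zmul_def bounded_basis_def \<mu>'_def[symmetric])
  qed
  then show "keysof (Cz m i j (sing b 1)) \<subseteq> bounded_basis m N d Y"
    unfolding Cz_def euler_z_zmul
    by (intro keys_add_subset keys_smul_subset keys_sum_subset) (use b in auto)
qed

lemma Cz_op_surj:
  assumes "m \<ge> N" "W \<in> columns m N"
  obtains V where "V \<in> columns m N" "Cz_op m N V = W"
proof -
  let ?K = "\<Union>i\<in>{1..N}. keysof (W i)"
  define Y where "Y = (\<lambda>(\<mu>, \<nu>, S). \<nu>) ` ?K"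
  \<comment> \<open>The inserted 0 keeps the maximum meaningful for the zero column.\<close>
  define d where "d = Max (insert 0 ((\<lambda>(\<mu>, \<nu>, S). hdeg m N \<mu>) ` ?K))"
  let ?A = "bounded_basis m N d Y"
  have Wk: "keysof (W i) \<subseteq> pbasis m N" if "i \<in> {1..N}" for i
    using assms(2) that by (auto simp: columns_def PCl_iff)
  have fK: "finite ?K" by auto
  have KA: "(\<mu>, \<nu>, S) \<in> ?A" if "(\<mu>, \<nu>, S) \<in> ?K" for \<mu> \<nu> S
  proof -
    have "hdeg m N \<mu> \<le> d" unfolding d_def using that fK by (intro Max_ge) force+
    moreover have "\<nu> \<in> Y" unfolding Y_def using that by force
    moreover have "(\<mu>, \<nu>, S) \<in> pbasis m N" using that Wk by blast
    ultimately show ?thesis by (simp add: bounded_basis_def pbasis_def)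
  qed
  have "?K \<subseteq> ?A"
  proof
    fix b assume "b \<in> ?K"
    then show "b \<in> ?A" by (cases b) (simp only: KA)
  qed
  then have W: "W \<in> cols_in N ?A" using assms(2) unfolding cols_in_def columns_def by blast
  have YP: "keysof \<nu> \<subseteq> {1..N} \<times> {1..m}" if "\<nu> \<in> Y" for \<nu>
  proof -
    obtain \<mu> S i where "i \<in> {1..N}" "(\<mu>, \<nu>, S) \<in> keysof (W i)" using \<open>\<nu> \<in> Y\<close> by (auto simp: Y_def)
    then have "(\<mu>, \<nu>, S) \<in> pbasis m N" using Wk by blast
    then show ?thesis by (simp add: pbasis_def)
  qed
  have A: "?A \<subseteq> pbasis m N" using YP by (auto simp: bounded_basis_def pbasis_def)
  have "finite Y" unfolding Y_def using fK by simp
  then have fA: "finite ?A" by (rule finite_bounded_basis)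
  have "Cz_op m N ` cols_in N ?A = cols_in N ?A"
    unfolding cols_in_span[OF fA]
  proof (rule col.linear_inj_surj_on_span[OF Cz_op_linear])
    show "Cz_op m N ` col.span (case_prod col_unit ` ({1..N} \<times> ?A)) \<subseteq> col.span (case_prod col_unit ` ({1..N} \<times> ?A))"
      unfolding cols_in_span[OF fA, symmetric]
    proof (rule image_subsetI)
      fix V assume V: "V \<in> cols_in N ?A"
      have "keysof (\<Sum>j=1..N. Cz m i j (V j)) \<subseteq> ?A" if "i \<in> {1..N}" for i
        by (intro keys_sum_subset Cz_bounded_basis that) (use V in \<open>simp_all add: cols_in_def\<close>)
      then show "Cz_op m N V \<in> cols_in N ?A" unfolding cols_in_def Cz_op_def by simp
    qed
    show "inj_on (Cz_op m N) (col.span (case_prod col_unit ` ({1..N} \<times> ?A)))"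
      unfolding cols_in_span[OF fA, symmetric]
      by (rule Cz_op_inj_on[OF assms(1)]) (auto simp: cols_in_def)
  qed (use fA in simp)
  with W have "W \<in> Cz_op m N ` cols_in N ?A" by simp
  then obtain V where V: "W = Cz_op m N V" "V \<in> cols_in N ?A" by (rule imageE)
  have "V \<in> columns m N"
    using V(2) A unfolding columns_cols_in cols_in_def by blast
  then show thesis by (rule that) (simp add: V(1))
qed

section \<open>Contractions as unique solutions of the column system\<close>

subsection \<open>The contractions\<close>

text \<open>Each \<open>V l\<close> solves the system whose right-hand side has the single entry
  \<open>contr m l F\<close> in row \<open>l\<close>; the contractions are the superposition over
  \<open>l\<close>. Later arguments use this characterization instead of
  \<open>inv_into\<close>.\<close>

lemma n_plus_solution:
  assumes "m \<ge> N" "F \<in> PCl m N"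
  shows n_plus_PCl: "i \<in> {1..N} \<Longrightarrow> n_plus m N i F \<in> PCl m N"
    and Cz_n_plus: "i \<in> {1..N} \<Longrightarrow> (\<Sum>j=1..N. Cz m i j (n_plus m N j F)) = contr m i F"
proof -
  let ?e = "\<lambda>l j. if j = l then contr m l F else 0"
  define V where "V l = inv_into (columns m N) (Cz_op m N) (?e l)" for l
  have V: "V l \<in> columns m N" "Cz_op m N (V l) = ?e l" if "l \<in> {1..N}" for l
  proof -
    have "?e l \<in> columns m N"
      using that PCl_contr[OF assms(2)] by (auto simp: columns_def)
    then have "?e l \<in> Cz_op m N ` columns m N"
      using Cz_op_surj[OF assms(1)] by (metis imageI)
    then show "V l \<in> columns m N" "Cz_op m N (V l) = ?e l"
      unfolding V_def by (rule inv_into_into, rule f_inv_into_f)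
  qed
  have n: "n_plus m N i F = (\<Sum>l=1..N. V l i)" for i
    by (simp add: n_plus_def Cz_inv_def V_def)
  show "n_plus m N i F \<in> PCl m N" if "i \<in> {1..N}" for i
    unfolding n by (rule PCl_sum) (use V that in \<open>auto simp: columns_def\<close>)
  show "(\<Sum>j=1..N. Cz m i j (n_plus m N j F)) = contr m i F" if i: "i \<in> {1..N}" for i
  proof -
    have "(\<Sum>j=1..N. Cz m i j (n_plus m N j F)) = (\<Sum>l=1..N. \<Sum>j=1..N. Cz m i j (V l j))"
      by (simp only: n plin_sum[OF plin_Cz]) (rule sum.swap)
    also have "\<dots> = (\<Sum>l=1..N. Cz_op m N (V l) i)"
      using i by (simp add: Cz_op_def)
    also have "\<dots> = (\<Sum>l=1..N. ?e l i)"
      by (rule sum.cong) (simp_all add: V)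
    also have "\<dots> = contr m i F" using i by simp
    finally show ?thesis .
  qed
qed

text \<open>Injectivity of C applied to the difference of two solutions. To identify a contraction
  it is enough to exhibit a column with the right image.\<close>

lemma n_plus_eqI:
  assumes "m \<ge> N" "F \<in> PCl m N" "\<And>k. k \<in> {1..N} \<Longrightarrow> (\<Sum>j=1..N. Cz m k j (V j)) = contr m k F"
    and "i \<in> {1..N}"
  shows "n_plus m N i F = V i"
proof -
  have "n_plus m N i F - V i = 0"
    by (rule Cz_injective[OF assms(1) _ assms(4), where V = "\<lambda>j. n_plus m N j F - V j"])
      (simp add: plin_diff[OF plin_Cz] sum_subtractf assms Cz_n_plus)
  then show ?thesis by simp
qed

text \<open>Linearity on the polynomials in the given variables; outside of them \<^const>\<open>n_plus\<close> is
  junk.\<close>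

definition lin_on :: "nat \<Rightarrow> nat \<Rightarrow> (pcl \<Rightarrow> pcl) \<Rightarrow> bool" where
  "lin_on m N T \<longleftrightarrow> (\<forall>F\<in>PCl m N. T F \<in> PCl m N) \<and>
     (\<forall>F\<in>PCl m N. \<forall>G\<in>PCl m N. T (F + G) = T F + T G) \<and>
     (\<forall>F\<in>PCl m N. \<forall>c. T (smul c F) = smul c (T F))"

lemma lin_onD:
  assumes "lin_on m N T" "F \<in> PCl m N"
  shows "T F \<in> PCl m N" "G \<in> PCl m N \<Longrightarrow> T (F + G) = T F + T G" "T (smul c F) = smul c (T F)"
  using assms by (auto simp: lin_on_def)

lemma lin_on_zero: "lin_on m N T \<Longrightarrow> T 0 = 0"
  using lin_onD(3)[of m N T 0 0] by simp

lemma lin_on_sum: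
  assumes "lin_on m N T" "\<And>i. i \<in> I \<Longrightarrow> F i \<in> PCl m N"
  shows "T (\<Sum>i\<in>I. F i) = (\<Sum>i\<in>I. T (F i))"
  using assms(2)
proof (induction I rule: infinite_finite_induct)
  case (insert i I)
  then show ?case using lin_onD(2)[OF assms(1), of "F i" "\<Sum>i\<in>I. F i"] PCl_sum[of I F m N] by auto
qed (simp_all add: lin_on_zero[OF assms(1)])

lemma plin_lin_on: "plin T \<Longrightarrow> (\<And>F. F \<in> PCl m N \<Longrightarrow> T F \<in> PCl m N) \<Longrightarrow> lin_on m N T"
  by (simp add: lin_on_def plin_add plin_smul)

lemma n_plus_lin_on:
  assumes "m \<ge> N" "i \<in> {1..N}"
  shows "lin_on m N (n_plus m N i)"
  unfolding lin_on_def
proof (intro conjI ballI allI)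
  fix F assume F: "F \<in> PCl m N"
  show "n_plus m N i F \<in> PCl m N" by (rule n_plus_PCl[OF assms(1) F assms(2)])
  show "n_plus m N i (smul c F) = smul c (n_plus m N i F)" for c
    by (rule n_plus_eqI[OF assms(1) _ _ assms(2)])
      (simp_all add: F PCl_smul plin_smul[OF plin_Cz] plin_smul[OF plin_contr] Cz_n_plus[OF assms(1) F]
        flip: smul_sum)
  fix G assume G: "G \<in> PCl m N"
  show "n_plus m N i (F + G) = n_plus m N i F + n_plus m N i G"
    by (rule n_plus_eqI[OF assms(1) _ _ assms(2)])
      (simp_all add: F G PCl_add plin_add[OF plin_Cz] plin_add[OF plin_contr] sum.distrib
        Cz_n_plus[OF assms(1) F] Cz_n_plus[OF assms(1) G])
qed

text \<open>The column \<open>smul \<epsilon> (T (n_plus m N j F))\<close> solves the system for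
  \<open>T F\<close>, because \<open>T\<close> can be moved through C. The scalar
  \<open>\<epsilon> = - 1\<close> handles odd \<open>T\<close>.\<close>

lemma n_plus_intertwine:
  assumes mN: "m \<ge> N" and T: "lin_on m N T" and F: "F \<in> PCl m N" and i: "i \<in> {1..N}"
    and TC: "\<And>i j G. i \<in> {1..N} \<Longrightarrow> j \<in> {1..N} \<Longrightarrow> G \<in> PCl m N \<Longrightarrow> T (Cz m i j G) = Cz m i j (T G)"
    and Tc: "\<And>i G. i \<in> {1..N} \<Longrightarrow> G \<in> PCl m N \<Longrightarrow> contr m i (T G) = smul \<epsilon> (T (contr m i G))"
  shows "n_plus m N i (T F) = smul \<epsilon> (T (n_plus m N i F))"
proof (rule n_plus_eqI[OF mN lin_onD(1)[OF T F] _ i])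
  fix k assume k: "k \<in> {1..N}"
  have "(\<Sum>j=1..N. Cz m k j (smul \<epsilon> (T (n_plus m N j F)))) =
      smul \<epsilon> (\<Sum>j=1..N. T (Cz m k j (n_plus m N j F)))"
    using k by (simp add: plin_smul[OF plin_Cz] TC n_plus_PCl[OF mN F] smul_sum)
  also have "(\<Sum>j=1..N. T (Cz m k j (n_plus m N j F))) = T (\<Sum>j=1..N. Cz m k j (n_plus m N j F))"
    by (rule lin_on_sum[OF T, symmetric]) (simp add: PCl_Cz n_plus_PCl[OF mN F])
  finally show "(\<Sum>j=1..N. Cz m k j (smul \<epsilon> (T (n_plus m N j F)))) = contr m k (T F)"
    using k by (simp add: Cz_n_plus[OF mN F] Tc F)
qed

section \<open>The gl(N) relations and anticommutation of holomorphic contractions\<close>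

subsection \<open>Anticommutation of the contractions\<close>

lemma euler_zmul: "b \<in> {1..m} \<Longrightarrow>
    euler_z m i k (zmul p b F) = zmul p b (euler_z m i k F) + (if k = p then zmul i b F else 0)"
proof -
  assume b: "b \<in> {1..m}"
  have "euler_z m i k (zmul p b F) =
      (\<Sum>a=1..m. zmul p b (zmul i a (dz k a F)) + (if k = p \<and> a = b then zmul i a F else 0))"
    unfolding euler_z_zmul
    by (rule sum.cong) (auto simp: dz_zmul plin_add[of "zmul _ _"] plin_zero[of "zmul _ _"] zmul_zmul[of i _ p])
  also have "\<dots> = zmul p b (euler_z m i k F) + (if k = p then zmul i b F else 0)"
    using b by (auto simp: sum.distrib euler_z_zmul plin_sum[of "zmul _ _"])
  finally show ?thesis .
qed

lemma euler_dz: "b \<in> {1..m} \<Longrightarrow>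
    euler_z m i k (dz l b F) = dz l b (euler_z m i k F) - (if i = l then dz k b F else 0)"
proof -
  assume b: "b \<in> {1..m}"
  have "dz l b (euler_z m i k F) =
      (\<Sum>a=1..m. zmul i a (dz k a (dz l b F)) + (if i = l \<and> a = b then dz k a F else 0))"
    unfolding euler_z_zmul plin_sum[OF plin_elementary(1)]
    by (rule sum.cong) (auto simp: dz_zmul dz_dz[of l b k])
  also have "\<dots> = euler_z m i k (dz l b F) + (if i = l then dz k b F else 0)"
    using b by (auto simp: sum.distrib euler_z_zmul)
  finally show ?thesis by simp
qed

text \<open>The gl(N) relations: the commutator with \<open>euler_z m i k\<close> is a derivation,
  evaluated on the factors \<open>zmul p b\<close> and \<open>dz l b\<close> by
  \<open>euler_zmul\<close> and \<open>euler_dz\<close>.\<close>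

lemma euler_euler:
  "euler_z m i k (euler_z m p l F) = euler_z m p l (euler_z m i k F) +
     (if k = p then euler_z m i l F else 0) - (if i = l then euler_z m p k F else 0)"
proof -
  have "euler_z m i k (euler_z m p l F) = (\<Sum>b=1..m. euler_z m i k (zmul p b (dz l b F)))"
    by (simp add: euler_z_zmul[of m p l] plin_sum[OF plin_euler])
  also have "\<dots> = (\<Sum>b=1..m. zmul p b (dz l b (euler_z m i k F)) +
      (if k = p then zmul i b (dz l b F) else 0) - (if i = l then zmul p b (dz k b F) else 0))"
    by (rule sum.cong) (auto simp: euler_zmul euler_dz plin_diff[of "zmul _ _"] plin_zero[of "zmul _ _"])
  also have "\<dots> = euler_z m p l (euler_z m i k F) +
     (if k = p then euler_z m i l F else 0) - (if i = l then euler_z m p k F else 0)"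
    by (auto simp: euler_z_zmul[of m p l] euler_z_zmul[of m i l] euler_z_zmul[of m p k]
        sum.distrib sum_subtractf)
  finally show ?thesis .
qed

lemma elementary_gcomm:
  assumes "keysof g \<subseteq> cl_consts"
  shows "dz k a (gcomm g F) = gcomm g (dz k a F)" "zmul k a (gcomm g F) = gcomm g (zmul k a F)"
    "dzb k a (gcomm g F) = gcomm g (dzb k a F)" "zbmul k a (gcomm g F) = gcomm g (zbmul k a F)"
  by (simp_all add: dz_bos dzb_def zmul_def zbmul_def bos_gcomm[OF assms])

lemma contr_gcomm: "contr m i F = (\<Sum>a=1..m. gcomm (witt_fd a) (dz i a F))"
  by (simp add: contr_def delta_gcomm)

lemma euler_gcomm:
  "keysof g \<subseteq> cl_consts \<Longrightarrow> euler_z m i k (gcomm g F) = gcomm g (euler_z m i k F)"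
  by (simp add: euler_z_zmul elementary_gcomm plin_sum[OF plin_gcomm])

lemma euler_contr:
  "euler_z m i k (contr m l F) = contr m l (euler_z m i k F) - (if i = l then contr m k F else 0)"
proof -
  have "euler_z m i k (contr m l F) = (\<Sum>a=1..m. gcomm (witt_fd a) (euler_z m i k (dz l a F)))"
    by (simp add: contr_gcomm plin_sum[OF plin_euler] euler_gcomm keys_witt_consts)
  also have "\<dots> = (\<Sum>a=1..m. gcomm (witt_fd a) (dz l a (euler_z m i k F)) -
      (if i = l then gcomm (witt_fd a) (dz k a F) else 0))"
    by (rule sum.cong) (auto simp: euler_dz plin_diff[OF plin_gcomm] plin_zero[OF plin_gcomm])
  also have "\<dots> = contr m l (euler_z m i k F) - (if i = l then contr m k F else 0)"
    by (auto simp: contr_gcomm sum_subtractf)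
  finally show ?thesis .
qed

lemma keys_bos_fin: "keysof F \<subseteq> fin_words \<Longrightarrow> keysof (bos f g c F) \<subseteq> fin_words"
  unfolding bos_def
  by (rule lin_ext_keys_subset[of F fin_words]) (auto simp: fin_words_def split: if_splits)

text \<open>The exponent parts commute and the Clifford parts anticommute by
  \<open>gcomm_gcomm\<close>. Stated for general \<open>g\<close>, \<open>h\<close>,
  \<open>D\<close>, \<open>D'\<close> to cover two holomorphic contractions as well as a mixed
  pair.\<close>

lemma gcomm_contraction_anticomm:
  assumes F: "keysof F \<subseteq> fin_words"
    and g: "\<And>a. keysof (g a) \<subseteq> cl_consts" "\<And>a. grade_inv (g a) = - g a"
    and h: "\<And>a. keysof (h a) \<subseteq> cl_consts" "\<And>a. grade_inv (h a) = - h a"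
    and gh: "\<And>a b. \<exists>c. pmul (g a) (h b) + pmul (h b) (g a) = smul c pone"
    and D: "\<And>a. D a = bos (f1 a) (f2 a) (f3 a)" "\<And>a. D' a = bos (f1' a) (f2' a) (f3' a)"
    and comm: "\<And>a b F. D a (D' b F) = D' b (D a F)"
  shows "(\<Sum>a=1..m. gcomm (g a) (D a (\<Sum>b=1..m. gcomm (h b) (D' b F)))) =
      - (\<Sum>b=1..m. gcomm (h b) (D' b (\<Sum>a=1..m. gcomm (g a) (D a F))))"
proof -
  have pD: "plin (D a)" "plin (D' a)" for a by (simp_all add: D)
  have gD: "D a (gcomm (h b) G) = gcomm (h b) (D a G)" "D' a (gcomm (g b) G) = gcomm (g b) (D' a G)" for a b G
    by (simp_all add: D bos_gcomm g h)
  have 1: "(\<Sum>a=1..m. gcomm (g a) (D a (\<Sum>b=1..m. gcomm (h b) (D' b F)))) =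
      (\<Sum>a=1..m. \<Sum>b=1..m. gcomm (g a) (gcomm (h b) (D a (D' b F))))"
    by (simp add: plin_sum[OF pD(1)] plin_sum[OF plin_gcomm] gD)
  have 2: "(\<Sum>b=1..m. gcomm (h b) (D' b (\<Sum>a=1..m. gcomm (g a) (D a F)))) =
      (\<Sum>b=1..m. \<Sum>a=1..m. gcomm (h b) (gcomm (g a) (D' b (D a F))))"
    by (simp add: plin_sum[OF pD(2)] plin_sum[OF plin_gcomm] gD)
  have "gcomm (g a) (gcomm (h b) (D a (D' b F))) = - gcomm (h b) (gcomm (g a) (D' b (D a F)))" for a b
  proof -
    obtain c where "pmul (g a) (h b) + pmul (h b) (g a) = smul c pone" using gh by blast
    then show ?thesis
      unfolding comm[of a b F]
      by (intro gcomm_gcomm g h) (simp_all add: D keys_bos_fin F)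
  qed
  then show ?thesis unfolding 1 2 sum_negf[symmetric] by (subst sum.swap) simp
qed

lemma contr_contr:
  assumes "keysof F \<subseteq> fin_words"
  shows "contr m i (contr m j F) = - contr m j (contr m i F)"
  unfolding contr_gcomm
proof (rule gcomm_contraction_anticomm[OF assms])
  show "\<exists>c. pmul (witt_fd a) (witt_fd b) + pmul (witt_fd b) (witt_fd a) = smul c pone" for a b
    by (rule exI[of _ 0]) (simp add: witt_fd_fd)
qed (rule keys_witt_consts grade_inv_witt dz_bos dz_dz)+

text \<open>The contractions transform under gl(N) like the derivatives, compare
  \<open>euler_dz\<close>. The proof checks that the column predicted by this rule solves the system
  for \<open>euler_z m i k F\<close>.\<close>

lemma euler_n_plus:
  assumes mN: "m \<ge> N" and F: "F \<in> PCl m N" and ikp: "i \<in> {1..N}" "k \<in> {1..N}" "p \<in> {1..N}"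
  shows "euler_z m i k (n_plus m N p F) =
    n_plus m N p (euler_z m i k F) - (if i = p then n_plus m N k F else 0)"
proof -
  let ?n = "\<lambda>p. n_plus m N p F"
  have EF: "euler_z m i k F \<in> PCl m N" by (rule PCl_euler[OF ikp(1) F])
  have "n_plus m N p (euler_z m i k F) = euler_z m i k (?n p) + (if i = p then ?n k else 0)"
  proof (rule n_plus_eqI[OF mN EF _ ikp(3),
        where V = "\<lambda>p. euler_z m i k (?n p) + (if i = p then ?n k else 0)"])
    fix l assume l: "l \<in> {1..N}"
    have CE: "Cz m l p (euler_z m i k G) = euler_z m i k (Cz m l p G) -
        (if k = p then euler_z m i l G else 0) + (if i = l then euler_z m p k G else 0)" for p G
      using euler_euler[of m i k p l G]
      by (simp add: Cz_def plin_add[OF plin_euler] plin_smul[OF plin_euler] algebra_simps)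
    have "(\<Sum>p=1..N. Cz m l p (euler_z m i k (?n p) + (if i = p then ?n k else 0))) =
        (\<Sum>p=1..N. euler_z m i k (Cz m l p (?n p))) - (\<Sum>p=1..N. if k = p then euler_z m i l (?n p) else 0)
        + (\<Sum>p=1..N. if i = l then euler_z m p k (?n p) else 0)
        + (\<Sum>p=1..N. if i = p then Cz m l p (?n k) else 0)"
      unfolding sum.distrib[symmetric] sum_subtractf[symmetric]
      by (rule sum.cong) (auto simp: plin_add[OF plin_Cz] plin_zero[OF plin_Cz] CE)
    also have "(\<Sum>p=1..N. euler_z m i k (Cz m l p (?n p))) = euler_z m i k (contr m l F)"
      by (simp add: plin_sum[OF plin_euler, symmetric] Cz_n_plus[OF mN F l])
    also have "(\<Sum>p=1..N. if k = p then euler_z m i l (?n p) else 0) = euler_z m i l (?n k)"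
      using ikp by simp
    also have "(\<Sum>p=1..N. if i = p then Cz m l p (?n k) else 0) = Cz m l i (?n k)"
      using ikp by simp
    \<comment> \<open>Row \<open>k\<close> of the column system, with its diagonal part
      \<open>smul (of_nat m) (?n k)\<close> moved to the other side.\<close>
    also have "(\<Sum>p=1..N. if i = l then euler_z m p k (?n p) else 0) =
        (if i = l then contr m k F - smul (of_nat m) (?n k) else 0)"
    proof -
      have "contr m k F = (\<Sum>p=1..N. (if k = p then smul (of_nat m) (?n p) else 0) + euler_z m p k (?n p))"
        unfolding Cz_n_plus[OF mN F ikp(2), symmetric] by (rule sum.cong) (auto simp: Cz_def)
      also have "\<dots> = smul (of_nat m) (?n k) + (\<Sum>p=1..N. euler_z m p k (?n p))"
        using ikp by (simp add: sum.distrib)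
      finally show ?thesis by auto
    qed
    finally show "(\<Sum>p=1..N. Cz m l p (euler_z m i k (?n p) + (if i = p then ?n k else 0))) =
        contr m l (euler_z m i k F)"
      using euler_contr[of m i k l F] by (auto simp: Cz_def)
  qed
  then show ?thesis by simp
qed

text \<open>C annihilates the column of differences of the two sides: moving
  \<open>contr m k\<close> through C leaves \<open>- contr m l (n_k F)\<close>, which cancels
  against C applied to \<open>n_j n_k F\<close>; the remaining terms cancel by
  \<open>contr_contr\<close>.\<close>

lemma contr_n_plus:
  assumes mN: "m \<ge> N" and F: "F \<in> PCl m N" and kj: "k \<in> {1..N}" "j \<in> {1..N}"
  shows "contr m k (n_plus m N j F) + n_plus m N j (contr m k F) = - n_plus m N j (n_plus m N k F)"
proof -
  let ?n = "n_plus m N"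
  let ?V = "\<lambda>j. contr m k (?n j F) + ?n j (contr m k F) + ?n j (?n k F)"
  have nF: "?n k F \<in> PCl m N" by (rule n_plus_PCl[OF mN F kj(1)])
  have "?V j = 0"
  proof (rule Cz_injective[OF mN _ kj(2), where V = ?V])
    fix l assume l: "l \<in> {1..N}"
    have Cc: "Cz m l p (contr m k G) = contr m k (Cz m l p G) - (if p = k then contr m l G else 0)" for p G
      by (simp add: Cz_def plin_add[OF plin_contr] plin_smul[OF plin_contr] euler_contr algebra_simps)
    have "(\<Sum>p=1..N. Cz m l p (?V p)) =
        (\<Sum>p=1..N. contr m k (Cz m l p (?n p F))) - (\<Sum>p=1..N. if p = k then contr m l (?n p F) else 0)
        + (\<Sum>p=1..N. Cz m l p (?n p (contr m k F))) + (\<Sum>p=1..N. Cz m l p (?n p (?n k F)))"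
      unfolding sum.distrib[symmetric] sum_subtractf[symmetric]
      by (rule sum.cong) (auto simp: plin_add[OF plin_Cz] Cc)
    also have "\<dots> = contr m k (contr m l F) - contr m l (?n k F) + contr m l (contr m k F) + contr m l (?n k F)"
      using kj l by (simp add: plin_sum[OF plin_contr, symmetric] Cz_n_plus[OF mN] F nF PCl_contr)
    also have "\<dots> = 0"
      by (simp add: contr_contr[OF PCl_fin_words[OF F], of m k l])
    finally show "(\<Sum>p=1..N. Cz m l p (?V p)) = 0" .
  qed
  then show ?thesis by (simp add: eq_neg_iff_add_eq_0)
qed

text \<open>By \<open>contr_n_plus\<close> and the commutators \<open>[E\<^sub>i\<^sub>k, n\<^sub>j] = - \<delta>\<^sub>i\<^sub>j n\<^sub>k\<close>, the column
  \<open>T\<^sub>i = {n\<^sub>i, n\<^sub>j} F\<close> satisfies \<open>(\<C>\<^sub>z + 1) T = 0\<close>.\<close>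

lemma n_plus_anticomm:
  assumes mN: "m \<ge> N" and F: "F \<in> PCl m N" and ij: "i \<in> {1..N}" "j \<in> {1..N}"
  shows "n_plus m N i (n_plus m N j F) = - n_plus m N j (n_plus m N i F)"
proof -
  let ?n = "n_plus m N"
  let ?T = "\<lambda>i. ?n i (?n j F) + ?n j (?n i F)"
  have n: "?n i F \<in> PCl m N" if "i \<in> {1..N}" for i by (rule n_plus_PCl[OF mN F that])
  note lin = n_plus_lin_on[OF mN ij(2)]
  have "?T i = 0"
  proof (rule Cz_plus_one_injective[OF _ ij(1), where m = m and V = ?T])
    fix k assume k: "k \<in> {1..N}"
    have Cn: "Cz m k p (?n j G) = ?n j (Cz m k p G) - (if p = j then ?n k G else 0)"
      if "p \<in> {1..N}" "G \<in> PCl m N" for p G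
      using that
      by (simp add: Cz_def lin_onD[OF lin] PCl_smul PCl_euler euler_n_plus[OF mN that(2,1) k ij(2)])
    have "(\<Sum>p=1..N. Cz m k p (?T p)) =
        (\<Sum>p=1..N. Cz m k p (?n p (?n j F))) + (\<Sum>p=1..N. ?n j (Cz m k p (?n p F)))
        - (\<Sum>p=1..N. if p = j then ?n k (?n p F) else 0)"
      unfolding sum.distrib[symmetric] sum_subtractf[symmetric]
      by (rule sum.cong) (auto simp: plin_add[OF plin_Cz] Cn n)
    also have "(\<Sum>p=1..N. ?n j (Cz m k p (?n p F))) = ?n j (\<Sum>p=1..N. Cz m k p (?n p F))"
      by (rule lin_on_sum[OF lin, symmetric]) (simp add: PCl_Cz n)
    finally have "(\<Sum>p=1..N. Cz m k p (?T p)) = contr m k (?n j F) + ?n j (contr m k F) - ?n k (?n j F)"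
      using ij k by (simp add: Cz_n_plus[OF mN] F n)
    \<comment> \<open>By \<open>contr_n_plus\<close> the first two terms above amount to
      \<open>- n_j n_k F\<close>, so together with the third they give
      \<open>- ?T k\<close>.\<close>
    then show "(\<Sum>p=1..N. Cz m k p (?T p)) + ?T k = 0"
      by (simp add: contr_n_plus[OF mN F k ij(2)])
  qed
  then show ?thesis by (simp add: eq_neg_iff_add_eq_0)
qed

section \<open>Conjugation, and anticommutation of holomorphic with antiholomorphic
  contractions\<close>

subsection \<open>The conjugate contractions\<close>

lemma lookup_map_cnj: "coef (Poly_Mapping.map cnj F) b = cnj (coef F b)" for F :: pcl
  by (simp add: map.rep_eq when_def)

fun bswap :: "pbase \<Rightarrow> pbase" where
  "bswap (\<mu>, \<nu>, S) = (\<nu>, \<mu>, S)"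

text \<open>The generators with odd index are the differences of Witt vectors, which conjugation
  negates. Thus \<open>pdag\<close> is the basis swap with this sign and conjugated
  coefficients.\<close>

fun bsign :: "pbase \<Rightarrow> complex" where
  "bsign (\<mu>, \<nu>, S) = (- 1) ^ card {i \<in> S. odd i}"

lemma bswap_bswap [simp]: "bswap (bswap b) = b"
  by (cases b) simp

lemma bsign_bswap [simp]: "bsign (bswap b) = bsign b"
  by (cases b) simp

lemma bsign_square [simp]: "bsign b * bsign b = 1" "cnj (bsign b) = bsign b"
  by (cases b; simp flip: power_mult_distrib)+

lemma bsign_neq_0 [simp]: "bsign b \<noteq> 0"
  by (cases b) simp

lemma pdag_add: "pdag (F + G) = pdag F + pdag G"
proof -
  have "Poly_Mapping.map cnj (F + G) = Poly_Mapping.map cnj F + Poly_Mapping.map cnj G"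
    by (rule poly_mapping_eqI) (simp add: lookup_map_cnj lookup_add)
  then show ?thesis by (simp add: pdag_def lin_ext_add)
qed

lemma pdag_smul: "pdag (smul c F) = smul (cnj c) (pdag F)"
proof -
  have "Poly_Mapping.map cnj (smul c F) = smul (cnj c) (Poly_Mapping.map cnj F)"
    by (rule poly_mapping_eqI) (simp add: lookup_map_cnj)
  then show ?thesis by (simp add: pdag_def lin_ext_smul)
qed

lemma pdag_single: "pdag (sing b c) = sing (bswap b) (bsign b * cnj c)"
proof -
  have "Poly_Mapping.map cnj (sing b c) = sing b (cnj c)"
    by (rule poly_mapping_eqI) (simp add: lookup_map_cnj lookup_single when_def)
  then show ?thesis by (cases b) (simp add: pdag_def smul_single mult.commute)
qed

lemma pdag_zero [simp]: "pdag 0 = 0"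
  using pdag_smul[of 0 0] by simp

lemma pdag_minus: "pdag (- F) = - pdag F"
  using pdag_smul[of "- 1" F] by (simp add: smul_minus)

lemma pdag_diff: "pdag (F - G) = pdag F - pdag G"
  using pdag_add[of F "- G"] by (simp add: pdag_minus)

lemma pdag_sum: "pdag (\<Sum>i\<in>I. F i) = (\<Sum>i\<in>I. pdag (F i))"
  by (induction I rule: infinite_finite_induct) (simp_all add: pdag_add)

lemma coef_pdag: "coef (pdag F) b = bsign b * cnj (coef F (bswap b))"
proof -
  have U: "keysof F \<subseteq> UNIV" by simp
  then show ?thesis
  proof (induction F rule: keys_induct)
    case (single b' c)
    have "bswap b' = b \<longleftrightarrow> b' = bswap b" by auto
    then show ?case by (auto simp: pdag_single lookup_single when_def)
  qed (simp_all add: pdag_add lookup_add algebra_simps)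
qed

lemma pdag_pdag [simp]: "pdag (pdag F) = F"
  by (rule poly_mapping_eqI) (simp add: coef_pdag mult.assoc[symmetric])

lemma keys_pdag: "keysof (pdag F) = bswap ` keysof F"
proof -
  have "b \<in> keysof (pdag F) \<longleftrightarrow> bswap b \<in> keysof F" for b
    by (simp add: in_keys_iff coef_pdag)
  moreover have "b \<in> bswap ` A \<longleftrightarrow> bswap b \<in> A" for A b
    by (auto intro: image_eqI[of _ _ "bswap b"])
  ultimately show ?thesis by blast
qed

lemma pdag_PCl: "F \<in> PCl m N \<Longrightarrow> pdag F \<in> PCl m N"
  unfolding PCl_iff keys_pdag by (force simp: pbasis_def)

lemma pdag_bos: "pdag (bos f g c F) =
    bos (\<lambda>\<mu> \<nu>. g \<nu> \<mu>) (\<lambda>\<mu> \<nu>. f \<nu> \<mu>) (\<lambda>\<mu> \<nu>. cnj (c \<nu> \<mu>)) (pdag F)"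
proof -
  have U: "keysof F \<subseteq> UNIV" by simp
  then show ?thesis
  proof (induction F rule: keys_induct)
    case (single b x)
    then show ?case by (cases b) (simp add: pdag_single mult_ac)
  qed (simp_all add: pdag_add plin_add[OF plin_bos] plin_zero[OF plin_bos])
qed

lemma pdag_elementary: "pdag (dz k a F) = dzb k a (pdag F)" "pdag (zmul k a F) = zbmul k a (pdag F)"
  "pdag (dzb k a F) = dz k a (pdag F)" "pdag (zbmul k a F) = zmul k a (pdag F)"
  by (simp_all add: dz_bos dzb_def zmul_def zbmul_def pdag_bos)

text \<open>Conjugation preserves the order of factors: its sign is multiplicative under symmetric
  difference of words, and the structure constants \<open>cl_sign S T\<close> are real.\<close>

lemma pdag_pmul:
  assumes "keysof x \<subseteq> fin_words" "keysof y \<subseteq> fin_words"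
  shows "pdag (pmul x y) = pmul (pdag x) (pdag y)"
  using assms(1)
proof (induction x rule: keys_induct)
  case (single b c)
  from assms(2) show ?case
  proof (induction y rule: keys_induct)
    case (single b' c')
    obtain \<mu> \<nu> S \<mu>' \<nu>' T where b: "b = (\<mu>, \<nu>, S)" "finite S" "b' = (\<mu>', \<nu>', T)" "finite T"
      using \<open>b \<in> fin_words\<close> \<open>b' \<in> fin_words\<close> by (auto simp: fin_words_def)
    have odd: "(- 1 :: complex) ^ card {i \<in> X. odd i} = (\<Prod>i\<in>X. if odd i then - 1 else 1)"
      if "finite X" for X :: "nat set"
      using that by (simp add: prod.If_cases Int_def)
    have s: "(- 1 :: complex) ^ card {i \<in> symdiff S T. odd i} =
        (- 1) ^ card {i \<in> S. odd i} * (- 1) ^ card {i \<in> T. odd i}"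
      using b by (simp only: odd finite_symdiff, intro prod_symdiff) simp_all
    have "cnj (cl_sign S T) = cl_sign S T"
      unfolding cl_sign_def cnj_prod by (intro prod.cong refl) (simp add: chi_def)
    then show ?case
      by (simp add: b pmul_single smul_single pdag_single s mult_ac)
  qed (simp_all add: pmul_add_right pdag_add)
qed (simp_all add: pmul_add_left pdag_add)

lemma pdag_grade_inv: "pdag (grade_inv F) = grade_inv (pdag F)"
proof -
  have U: "keysof F \<subseteq> UNIV" by simp
  then show ?thesis
  proof (induction F rule: keys_induct)
    case (single b x)
    then show ?case by (cases b) (simp add: grade_inv_def smul_single pdag_single mult_ac)
  qed (simp_all add: pdag_add plin_add[OF plin_grade_inv] plin_zero[OF plin_grade_inv])
qed

lemma pdag_witt: "pdag (witt_fd a) = witt_f a" "pdag (witt_f a) = witt_fd a"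
proof -
  have e: "{i. i = 2 * a \<and> odd i} = {}" "{i. i = 2 * a + 1 \<and> odd i} = {2 * a + 1}" by auto
  show "pdag (witt_fd a) = witt_f a"
    by (simp add: witt_fd_def witt_f_def cl_gen_def pdag_smul pdag_diff pdag_single e single_uminus)
  then show "pdag (witt_f a) = witt_fd a" by (metis pdag_pdag)
qed

lemma pdag_gcomm:
  assumes "keysof g \<subseteq> cl_consts" "keysof F \<subseteq> fin_words"
  shows "pdag (gcomm g F) = gcomm (pdag g) (pdag F)"
  using assms cl_consts_fin_words
  by (simp add: gcomm_def pdag_diff pdag_pmul keys_grade_inv_fin pdag_grade_inv)

definition contrb :: "nat \<Rightarrow> nat \<Rightarrow> pcl \<Rightarrow> pcl" where
  "contrb m i F = (\<Sum>a=1..m. gcomm (witt_f a) (dzb i a F))"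

text \<open>Taken in the form of \<open>Cz_dz_zmul\<close>, since \<open>pdag\<close> exchanges
  derivatives and multiplications factor by factor.\<close>

definition Czb :: "nat \<Rightarrow> nat \<Rightarrow> nat \<Rightarrow> pcl \<Rightarrow> pcl" where
  "Czb m i j F = (\<Sum>a=1..m. dzb i a (zbmul j a F))"

lemma plin_contrb [simp]: "plin (contrb m i)"
  unfolding contrb_def[abs_def]
  by (intro plin_fun_sum plin_comp[of "gcomm _" "dzb _ _"]) simp_all

lemma plin_Czb [simp]: "plin (Czb m i j)"
  unfolding Czb_def[abs_def]
  by (intro plin_fun_sum plin_comp[of "dzb _ _" "zbmul _ _"]) simp_all

lemma PCl_contrb: "F \<in> PCl m N \<Longrightarrow> contrb m i F \<in> PCl m N"
  unfolding contrb_def by (intro PCl_sum PCl_gcomm PCl_witt PCl_elementary)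

lemma PCl_Czb: "j \<in> {1..N} \<Longrightarrow> F \<in> PCl m N \<Longrightarrow> Czb m i j F \<in> PCl m N"
  unfolding Czb_def by (intro PCl_sum PCl_elementary)

lemma pdag_Cz: "pdag (Cz m i j F) = Czb m i j (pdag F)" "pdag (Czb m i j F) = Cz m i j (pdag F)"
  by (simp_all add: Cz_dz_zmul Czb_def pdag_sum pdag_elementary)

lemma pdag_contr:
  assumes "keysof F \<subseteq> fin_words"
  shows "pdag (contr m i F) = contrb m i (pdag F)" "pdag (contrb m i F) = contr m i (pdag F)"
  using assms by (simp_all add: contr_gcomm contrb_def pdag_sum pdag_gcomm keys_witt_consts dz_bos dzb_def
      keys_bos_fin pdag_witt pdag_bos)

lemma Cz_Czb: "Cz m i j (Czb m k l F) = Czb m k l (Cz m i j F)"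
  unfolding Cz_dz_zmul Czb_def
  by (simp add: plin_sum[of "dz _ _"] plin_sum[of "zmul _ _"] plin_sum[of "dzb _ _"] plin_sum[of "zbmul _ _"]
      holo_antiholo) (rule sum.swap)

lemma Cz_contrb: "Cz m i j (contrb m k F) = contrb m k (Cz m i j F)"
  unfolding Cz_dz_zmul contrb_def
  by (simp add: plin_sum[of "dz _ _"] plin_sum[of "zmul _ _"] plin_sum[of "dzb _ _"] plin_sum[OF plin_gcomm]
      elementary_gcomm keys_witt_consts holo_antiholo) (rule sum.swap)

lemma contr_Czb: "contr m i (Czb m k l F) = Czb m k l (contr m i F)"
  unfolding Czb_def contr_gcomm
  by (simp add: plin_sum[of "dz _ _"] plin_sum[of "zbmul _ _"] plin_sum[of "dzb _ _"] plin_sum[OF plin_gcomm]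
      elementary_gcomm keys_witt_consts holo_antiholo) (rule sum.swap)

text \<open>Here the Clifford anticommutator is the Kronecker symbol and not 0. A scalar is enough
  for \<open>gcomm_gcomm\<close>, so the contractions still anticommute.\<close>

lemma contr_contrb:
  assumes "keysof F \<subseteq> fin_words"
  shows "contr m i (contrb m j F) = - contrb m j (contr m i F)"
  unfolding contr_gcomm contrb_def
proof (rule gcomm_contraction_anticomm[OF assms])
  show "\<exists>c. pmul (witt_fd a) (witt_f b) + pmul (witt_f b) (witt_fd a) = smul c pone" for a b
    by (rule exI[of _ "if a = b then 1 else 0"]) (use witt_f_fd[of b a] in \<open>auto simp: add.commute\<close>)
qed (rule keys_witt_consts grade_inv_witt dz_bos dzb_def holo_antiholo)+

lemma n_minus_eq: "n_minus m N i F = pdag (n_plus m N i (pdag F))"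
  by (simp add: n_minus_def)

context
  fixes m N :: nat
  assumes mN: "N \<le> m"
begin

lemma n_minus_lin_on: "i \<in> {1..N} \<Longrightarrow> lin_on m N (n_minus m N i)"
  using n_plus_lin_on[OF mN, of i]
  by (simp add: lin_on_def n_minus_eq pdag_add pdag_smul pdag_PCl)

lemma n_plus_Czb:
  "i \<in> {1..N} \<Longrightarrow> k \<in> {1..N} \<Longrightarrow> l \<in> {1..N} \<Longrightarrow> F \<in> PCl m N \<Longrightarrow>
    n_plus m N i (Czb m k l F) = Czb m k l (n_plus m N i F)"
  using n_plus_intertwine[OF mN, of "Czb m k l" F i 1]
  by (simp add: plin_lin_on PCl_Czb Cz_Czb contr_Czb)

lemma n_plus_contrb:
  "i \<in> {1..N} \<Longrightarrow> k \<in> {1..N} \<Longrightarrow> F \<in> PCl m N \<Longrightarrow>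
    n_plus m N i (contrb m k F) = - contrb m k (n_plus m N i F)"
  using n_plus_intertwine[OF mN, of "contrb m k" F i "- 1"]
  by (simp add: plin_lin_on PCl_contrb Cz_contrb contr_contrb PCl_fin_words smul_minus)

lemma n_minus_Cz:
  "i \<in> {1..N} \<Longrightarrow> k \<in> {1..N} \<Longrightarrow> l \<in> {1..N} \<Longrightarrow> F \<in> PCl m N \<Longrightarrow>
    n_minus m N i (Cz m k l F) = Cz m k l (n_minus m N i F)"
  by (simp add: n_minus_eq pdag_Cz n_plus_Czb pdag_PCl)

lemma n_minus_contr:
  "i \<in> {1..N} \<Longrightarrow> k \<in> {1..N} \<Longrightarrow> F \<in> PCl m N \<Longrightarrow>
    n_minus m N i (contr m k F) = - contr m k (n_minus m N i F)"
  by (simp add: n_minus_eq pdag_contr PCl_fin_words[of _ m N] n_plus_contrb pdag_PCl pdag_minus n_plus_PCl[OF mN])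

text \<open>The conjugate contraction is itself admissible as \<open>T\<close> in
  \<open>n_plus_intertwine\<close>, with scalar -1: conjugating \<open>n_plus_Czb\<close> and
  \<open>n_plus_contrb\<close> gives its relations with \<open>Cz\<close> and
  \<open>contr\<close>.\<close>

lemma n_plus_n_minus:
  assumes "i \<in> {1..N}" "j \<in> {1..N}" "F \<in> PCl m N"
  shows "n_plus m N i (n_minus m N j F) = - n_minus m N j (n_plus m N i F)"
  using n_plus_intertwine[OF mN n_minus_lin_on[OF assms(2)] assms(3,1), of "- 1"] assms
  by (simp add: n_minus_Cz n_minus_contr smul_minus)

lemma n_minus_anticomm:
  assumes "i \<in> {1..N}" "j \<in> {1..N}" "F \<in> PCl m N"
  shows "n_minus m N i (n_minus m N j F) = - n_minus m N j (n_minus m N i F)"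
  using n_plus_anticomm[OF mN pdag_PCl[OF assms(3)] assms(1,2)]
  by (simp add: n_minus_eq pdag_minus)

end

section \<open>Effect of the contractions on parity and Euler degrees\<close>

subsection \<open>Degrees and parity\<close>

text \<open>A claim about the degree or parity of every basis element in a support becomes an
  eigenvector equation for a diagonal operator, see \<open>dg_eigenvector\<close>.\<close>

definition dg :: "(pbase \<Rightarrow> complex) \<Rightarrow> pcl \<Rightarrow> pcl" where
  "dg g = lin_ext (\<lambda>b. sing b (g b))"

lemma coef_dg: "coef (dg g F) b = g b * coef F b"
proof -
  have U: "keysof F \<subseteq> UNIV" by simp
  then show ?thesis
    by (induction F rule: keys_induct)
      (auto simp: dg_def smul_single lookup_single when_def lin_ext_add lookup_add algebra_simps)
qed

lemma dg_eigenvector: "dg g F = smul c F \<Longrightarrow> b \<in> keysof F \<Longrightarrow> g b = c"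
  using coef_dg[of g F b] by (simp add: in_keys_iff)

lemma sing_PCl: "b \<in> pbasis m N \<Longrightarrow> sing b c \<in> PCl m N"
  by (simp add: PCl_iff)

lemma pbasis_bswap: "b \<in> pbasis m N \<Longrightarrow> bswap b \<in> pbasis m N"
  by (cases b) (simp add: pbasis_def)

lemma euler_dg:
  assumes "F \<in> PCl m N" "k \<in> {1..N}"
  shows "euler_z m k k F = dg (\<lambda>b. of_nat (zdeg k b)) F"
proof (rule plin_eqI[OF plin_euler _ assms(1)[unfolded PCl_iff]])
  show "plin (dg (\<lambda>b. of_nat (zdeg k b)))" by (simp add: dg_def)
  fix b assume b: "b \<in> pbasis m N"
  obtain \<mu> \<nu> S where bb: "b = (\<mu>, \<nu>, S)" by (cases b)
  have e: "zmul k a (dz k a (sing b 1)) = sing b (of_nat (coef \<mu> (k, a)))" for a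
  proof (cases "coef \<mu> (k, a) = 0")
    case True
    then have "dz k a (sing b 1) = 0" by (simp add: bb dz_bos)
    with True show ?thesis by (simp add: plin_zero)
  next
    case False
    have "\<mu> - sing (k, a) 1 + sing (k, a) 1 = \<mu>"
      by (rule poly_mapping_eqI) (use False in \<open>auto simp: lookup_add lookup_minus lookup_single when_def\<close>)
    then show ?thesis by (simp add: bb dz_bos zmul_def)
  qed
  have "zdeg k b = (\<Sum>p\<in>Pair k ` {1..m}. coef \<mu> p)"
    unfolding bb zdeg.simps
  proof (rule sum.mono_neutral_left)
    show "{p \<in> keysof \<mu>. fst p = k} \<subseteq> Pair k ` {1..m}"
      using b by (auto simp: bb pbasis_def)
  qed (auto simp: in_keys_iff)
  also have "\<dots> = (\<Sum>a=1..m. coef \<mu> (k, a))"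
    by (subst sum.reindex) (auto intro: inj_onI)
  finally have "sing b (of_nat (zdeg k b) :: complex) = (\<Sum>a=1..m. sing b (of_nat (coef \<mu> (k, a))))"
    by (intro poly_mapping_eqI) (simp add: lookup_sum lookup_single when_def)
  then show "euler_z m k k (sing b 1) = dg (\<lambda>b. of_nat (zdeg k b)) (sing b 1)"
    by (simp add: euler_z_zmul e dg_def)
qed

lemma bswap_degrees [simp]: "zdeg k (bswap b) = zbdeg k b" "zbdeg k (bswap b) = zdeg k b"
  "pparity (bswap b) = pparity b"
  by (cases b; simp)+

context
  fixes m N :: nat
  assumes mN: "N \<le> m"
begin

text \<open>The grading commutes with C and anticommutes with \<open>contr\<close>, hence with the
  contractions. Parity enters as a sign because this is the form in which the Koszul rule uses
  it.\<close>

lemma n_plus_parity: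
  assumes "i \<in> {1..N}" "b \<in> pbasis m N" "b' \<in> keysof (n_plus m N i (sing b 1))"
  shows "(- 1 :: complex) ^ pparity b' = - ((- 1) ^ pparity b)"
proof (rule dg_eigenvector[OF _ assms(3)])
  let ?F = "sing b 1 :: pcl"
  have F: "?F \<in> PCl m N" by (rule sing_PCl[OF assms(2)])
  have l: "lin_on m N grade_inv" by (simp add: plin_lin_on PCl_grade_inv)
  have TC: "grade_inv (Cz m i j G) = Cz m i j (grade_inv G)" for i j G
    by (simp add: Cz_dz_zmul plin_sum[OF plin_grade_inv] dz_bos zmul_def bos_grade_inv)
  have Tc: "contr m i (grade_inv G) = smul (- 1) (grade_inv (contr m i G))" if "G \<in> PCl m N" for i G
    using PCl_fin_words[OF that]
    by (simp add: contr_gcomm smul_minus plin_sum[OF plin_grade_inv] dz_bos bos_grade_inv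
        gcomm_grade_inv keys_witt_consts grade_inv_witt keys_bos_fin sum_negf)
  have "n_plus m N i (grade_inv ?F) = smul (- 1) (grade_inv (n_plus m N i ?F))"
    by (rule n_plus_intertwine[OF mN l F assms(1)]) (auto simp: TC Tc)
  moreover have "grade_inv ?F = smul ((- 1) ^ pparity b) ?F"
    by (simp add: grade_inv_def smul_single)
  ultimately have "grade_inv (n_plus m N i ?F) = - smul ((- 1) ^ pparity b) (n_plus m N i ?F)"
    using lin_onD(3)[OF n_plus_lin_on[OF mN assms(1)] F] by (simp add: smul_minus)
  then show "dg (\<lambda>b. (- 1) ^ pparity b) (n_plus m N i ?F) =
      smul (- ((- 1) ^ pparity b)) (n_plus m N i ?F)"
    by (simp add: grade_inv_def dg_def smul_minus)
qed

text \<open>The zbar-degree operator acts on the second exponent only and therefore commutes with C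
  and \<open>contr\<close>. This holds for every \<open>k\<close>, including
  \<open>k = i\<close>.\<close>

lemma n_plus_zbdeg:
  assumes "i \<in> {1..N}" "b \<in> pbasis m N" "b' \<in> keysof (n_plus m N i (sing b 1))"
  shows "zbdeg k b' = zbdeg k b"
proof -
  let ?F = "sing b 1 :: pcl"
  let ?T = "bos (\<lambda>\<mu> \<nu>. \<mu>) (\<lambda>\<mu> \<nu>. \<nu>) (\<lambda>\<mu> \<nu>. of_nat (zbdeg k (0, \<nu>, {})))"
  have F: "?F \<in> PCl m N" by (rule sing_PCl[OF assms(2)])
  have l: "lin_on m N ?T" by (intro plin_lin_on bos_PCl) simp_all
  have comm: "?T (dz i a G) = dz i a (?T G)" "?T (zmul i a G) = zmul i a (?T G)" for i a G
    unfolding dz_bos zmul_def bos_bos by (rule bos_cong; simp add: mult_ac)+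
  have TC: "?T (Cz m i j G) = Cz m i j (?T G)" for i j G
    by (simp only: Cz_dz_zmul plin_sum[OF plin_bos] comm)
  have Tc: "contr m i (?T G) = smul 1 (?T (contr m i G))" for i G
    by (simp only: contr_gcomm plin_sum[OF plin_bos] bos_gcomm[OF keys_witt_consts(1)] comm smul_one)
  have dg: "?T = dg (\<lambda>b. of_nat (zbdeg k b))"
    by (auto simp: bos_def dg_def intro!: arg_cong[of _ _ lin_ext])
  have "n_plus m N i (?T ?F) = smul 1 (?T (n_plus m N i ?F))"
    by (rule n_plus_intertwine[OF mN l F assms(1)]) (auto simp only: TC Tc)
  moreover have "?T ?F = smul (of_nat (zbdeg k b)) ?F"
    unfolding dg by (simp add: dg_def smul_single)
  ultimately have "?T (n_plus m N i ?F) = smul (of_nat (zbdeg k b)) (n_plus m N i ?F)"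
    using lin_onD(3)[OF n_plus_lin_on[OF mN assms(1)] F] by simp
  from dg_eigenvector[OF this[unfolded dg] assms(3)] show ?thesis by simp
qed

text \<open>By \<open>euler_n_plus\<close>, \<open>euler_z m k k\<close> commutes with the
  contraction of label \<open>i \<noteq> k\<close>. For \<open>k = i\<close> the same relation
  lowers the degree by one.\<close>

lemma n_plus_zdeg:
  assumes "i \<in> {1..N}" "k \<in> {1..N}" "k \<noteq> i" "b \<in> pbasis m N" "b' \<in> keysof (n_plus m N i (sing b 1))"
  shows "zdeg k b' = zdeg k b"
proof -
  let ?F = "sing b 1 :: pcl"
  have F: "?F \<in> PCl m N" by (rule sing_PCl[OF assms(4)])
  have "dg (\<lambda>b. of_nat (zdeg k b)) (n_plus m N i ?F) = euler_z m k k (n_plus m N i ?F)"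
    by (rule euler_dg[symmetric]) (use assms F n_plus_PCl[OF mN] in auto)
  also have "\<dots> = n_plus m N i (dg (\<lambda>b. of_nat (zdeg k b)) ?F)"
    using euler_n_plus[OF mN F assms(2,2,1)] assms(3) euler_dg[OF F assms(2)] by simp
  also have "\<dots> = smul (of_nat (zdeg k b)) (n_plus m N i ?F)"
    using lin_onD(3)[OF n_plus_lin_on[OF mN assms(1)] F, of "of_nat (zdeg k b)"]
    by (simp add: dg_def smul_single)
  finally show ?thesis using dg_eigenvector[OF _ assms(5)] by fastforce
qed

lemma keys_n_minus:
  assumes "i \<in> {1..N}" "b \<in> pbasis m N"
  shows "keysof (n_minus m N i (sing b 1)) = bswap ` keysof (n_plus m N i (sing (bswap b) 1))"
proof -
  have "n_minus m N i (sing b 1) = smul (bsign b) (pdag (n_plus m N i (sing (bswap b) 1)))"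
    using lin_onD(3)[OF n_plus_lin_on[OF mN assms(1)] sing_PCl[OF pbasis_bswap[OF assms(2)]], of "bsign b" 1]
    by (simp add: n_minus_eq pdag_single pdag_smul smul_single)
  moreover have "keysof (smul (bsign b) G) = keysof G" for G :: pcl
    by (rule set_eqI) (simp add: in_keys_iff)
  ultimately show ?thesis by (simp only: keys_pdag)
qed

text \<open>Supports are transported by \<open>bswap\<close>, so z and zbar change roles: now only
  the zbar-degree of the own label may change.\<close>

lemma n_minus_degrees:
  assumes "i \<in> {1..N}" "b \<in> pbasis m N" "b' \<in> keysof (n_minus m N i (sing b 1))"
  shows "(- 1 :: complex) ^ pparity b' = - ((- 1) ^ pparity b)" "zdeg k b' = zdeg k b"
    "k \<in> {1..N} \<Longrightarrow> k \<noteq> i \<Longrightarrow> zbdeg k b' = zbdeg k b"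
proof -
  obtain b'' where b'': "b' = bswap b''" "b'' \<in> keysof (n_plus m N i (sing (bswap b) 1))"
    using assms(3) unfolding keys_n_minus[OF assms(1,2)] by auto
  note P = pbasis_bswap[OF assms(2)]
  show "(- 1 :: complex) ^ pparity b' = - ((- 1) ^ pparity b)"
    using n_plus_parity[OF assms(1) P b''(2)] by (simp add: b''(1))
  show "zdeg k b' = zdeg k b"
    using n_plus_zbdeg[OF assms(1) P b''(2), of k] by (simp add: b''(1))
  show "zbdeg k b' = zbdeg k b" if "k \<in> {1..N}" "k \<noteq> i"
    using n_plus_zdeg[OF assms(1) that P b''(2)] by (simp add: b''(1))
qed

end

section \<open>Closure properties of the localized coefficient ring\<close>

section \<open>The coefficient rings\<close>

lemma bpolys_add: "p \<in> bpolys N n \<Longrightarrow> r \<in> bpolys N n \<Longrightarrow> p + r \<in> bpolys N n"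
  using keys_add[of p r] by (auto simp: bpolys_def)

lemma bpolys_minus: "p \<in> bpolys N n \<Longrightarrow> - p \<in> bpolys N n"
  by (auto simp: bpolys_def in_keys_iff)

lemma bpolys_diff: "p \<in> bpolys N n \<Longrightarrow> r \<in> bpolys N n \<Longrightarrow> p - r \<in> bpolys N n"
  using bpolys_add[of p N n "- r"] bpolys_minus[of r] by simp

lemma bpolys_mult:
  assumes "p \<in> bpolys N n" "r \<in> bpolys N n"
  shows "p * r \<in> bpolys N n"
  unfolding bpolys_def
proof (clarify del: subsetI)
  fix \<mu> assume "\<mu> \<in> keysof (p * r)"
  then obtain \<mu>1 \<mu>2 where m: "\<mu> = \<mu>1 + \<mu>2" "\<mu>1 \<in> keysof p" "\<mu>2 \<in> keysof r"
    using keys_mult[of p r] by blast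
  have "keysof \<mu>1 \<subseteq> prod_encode ` ({1..N} \<times> {1..n})" "keysof \<mu>2 \<subseteq> prod_encode ` ({1..N} \<times> {1..n})"
    using assms m by (simp_all add: bpolys_def)
  then show "keysof \<mu> \<subseteq> prod_encode ` ({1..N} \<times> {1..n})"
    unfolding m(1) by (rule keys_add_subset)
qed

lemma bpolys_bpconst: "bpconst c \<in> bpolys N n"
  by (simp add: bpolys_def bpconst_def)

lemma bpolys_bpvar: "k \<in> {1..N} \<Longrightarrow> j \<in> {1..n} \<Longrightarrow> bpvar k j \<in> bpolys N n"
  by (simp add: bpolys_def bpvar_def)

lemma bpolys_one: "1 \<in> bpolys N n"
  using bpolys_bpconst[of 1] by (simp add: bpconst_def)

lemma bpconst_hom: "bpconst (c + d) = bpconst c + bpconst d" "bpconst (- c) = - bpconst c"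
  "bpconst (c * d) = bpconst c * bpconst d"
  by (simp_all add: bpconst_def single_add single_uminus mult_single)

lemma affine_neq_0:
  assumes "c \<noteq> 0"
  shows "bpconst d + bpconst c * bpvar k j \<noteq> 0"
proof
  let ?\<mu> = "sing (prod_encode (k, j)) 1 :: nat \<Rightarrow>\<^sub>0 nat"
  assume "bpconst d + bpconst c * bpvar k j = 0"
  then have "coef (bpconst d + bpconst c * bpvar k j) ?\<mu> = 0" by simp
  moreover have "?\<mu> \<noteq> 0" by (metis lookup_single_eq lookup_zero zero_neq_one)
  ultimately show False
    using assms by (simp add: bpconst_def bpvar_def mult_single lookup_add lookup_single)
qed

lemma denoms_gens_neq_0:
  "(bpvar k j + bpconst (2 * \<i> * of_int l)) - bpconst \<i> \<noteq> 0"
  "bpconst s - bpconst (2 * \<i>) * (bpvar k j + bpconst (2 * \<i> * of_int l)) \<noteq> 0"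
  "bpconst s + bpconst (2 * \<i>) * (bpvar k j + bpconst (2 * \<i> * of_int l)) \<noteq> 0"
proof -
  have 1: "(bpvar k j + bpconst (2 * \<i> * of_int l)) - bpconst \<i> =
      bpconst (2 * \<i> * of_int l + - \<i>) + bpconst 1 * bpvar k j"
    unfolding bpconst_hom by (simp add: bpconst_def)
  have 2: "bpconst s - bpconst (2 * \<i>) * (bpvar k j + bpconst (2 * \<i> * of_int l)) =
      bpconst (s + - (2 * \<i> * (2 * \<i> * of_int l))) + bpconst (- (2 * \<i>)) * bpvar k j"
    unfolding bpconst_hom by (simp add: algebra_simps)
  have 3: "bpconst s + bpconst (2 * \<i>) * (bpvar k j + bpconst (2 * \<i> * of_int l)) =
      bpconst (s + 2 * \<i> * (2 * \<i> * of_int l)) + bpconst (2 * \<i>) * bpvar k j"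
    unfolding bpconst_hom by (simp add: algebra_simps)
  show "(bpvar k j + bpconst (2 * \<i> * of_int l)) - bpconst \<i> \<noteq> 0"
    unfolding 1 by (rule affine_neq_0) simp
  show "bpconst s - bpconst (2 * \<i>) * (bpvar k j + bpconst (2 * \<i> * of_int l)) \<noteq> 0"
    unfolding 2 by (rule affine_neq_0) simp
  show "bpconst s + bpconst (2 * \<i>) * (bpvar k j + bpconst (2 * \<i> * of_int l)) \<noteq> 0"
    unfolding 3 by (rule affine_neq_0) simp
qed

lemma denoms_neq_0: "d \<in> denoms s N n \<Longrightarrow> d \<noteq> 0"
  by (induction rule: denoms.induct)
    (simp_all only: mult_eq_0_iff denoms_gens_neq_0 one_neq_zero simp_thms not_False_eq_True)

lemma denoms_bpolys: "d \<in> denoms s N n \<Longrightarrow> d \<in> bpolys N n"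
  by (induction rule: denoms.induct)
    (intro bpolys_one bpolys_mult bpolys_add bpolys_diff bpolys_bpvar bpolys_bpconst; assumption)+

lemma denoms_mult: "d \<in> denoms s N n \<Longrightarrow> d' \<in> denoms s N n \<Longrightarrow> d * d' \<in> denoms s N n"
proof (induction rule: denoms.induct)
  case (gen1 d k j l)
  then show ?case using denoms.gen1[of "d * d'" s N n k j l] by (simp only: mult.assoc[symmetric])
next
  case (gen2 d k j l)
  then show ?case using denoms.gen2[of "d * d'" s N n k j l] by (simp only: mult.assoc[symmetric])
next
  case (gen3 d k j l)
  then show ?case using denoms.gen3[of "d * d'" s N n k j l] by (simp only: mult.assoc[symmetric])
qed simp

text \<open>Conjugation fixes the variables and negates the imaginary shifts. The first family of
  generators is reindexed by \<open>1 - l\<close>, where the 1 compensates the conjugated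
  \<open>\<i>\<close>; the other two are exchanged, with \<open>- l\<close> for
  \<open>l\<close>.\<close>

lemma denoms_bpcnj:
  assumes "cnj s = s"
  shows "d \<in> denoms s N n \<Longrightarrow> bpcnj d \<in> denoms s N n"
proof (induction rule: denoms.induct)
  have d: "bpcnj (p - r) = bpcnj p - bpcnj r" for p r
    by (rule poly_mapping_eqI) (simp add: lookup_minus)
  have c: "bpcnj (bpconst c) = bpconst (cnj c)" for c by (simp add: bpconst_def)
  have v: "bpcnj (bpvar k j) = bpvar k j" for k j by (simp add: bpvar_def)
  { case (gen1 d k j l)
    have "2 * \<i> * of_int (1 - l) + - \<i> = - (2 * \<i> * of_int l) + \<i>" by (simp add: algebra_simps)
    then have "bpconst (2 * \<i> * of_int (1 - l)) - bpconst \<i> = bpconst (- (2 * \<i> * of_int l)) + bpconst \<i>"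
      by (metis bpconst_hom(1,2) diff_conv_add_uminus)
    then have "bpcnj (bpvar k j + bpconst (2 * \<i> * of_int l) - bpconst \<i>) =
        bpvar k j + bpconst (2 * \<i> * of_int (1 - l)) - bpconst \<i>"
      by (simp add: d c v bpcnj_add bpconst_hom(2) algebra_simps)
    then show ?case unfolding bpcnj_mult using denoms.gen1[OF gen1(4,2,3), of "1 - l"] by simp
  next
    case (gen2 d k j l)
    have "bpcnj (bpconst s - bpconst (2 * \<i>) * (bpvar k j + bpconst (2 * \<i> * of_int l))) =
        bpconst s + bpconst (2 * \<i>) * (bpvar k j + bpconst (2 * \<i> * of_int (- l)))"
      by (simp add: d c v bpcnj_add bpcnj_mult bpconst_hom(2) assms)
    then show ?case unfolding bpcnj_mult using denoms.gen3[OF gen2(4,2,3), of "- l"] by simp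
  next
    case (gen3 d k j l)
    have "bpcnj (bpconst s + bpconst (2 * \<i>) * (bpvar k j + bpconst (2 * \<i> * of_int l))) =
        bpconst s - bpconst (2 * \<i>) * (bpvar k j + bpconst (2 * \<i> * of_int (- l)))"
      by (simp add: d c v bpcnj_add bpcnj_mult bpconst_hom(2) assms)
    then show ?case unfolding bpcnj_mult using denoms.gen2[OF gen3(4,2,3), of "- l"] by simp
  next
    case one
    show ?case by (simp add: denoms.one) }
qed

lemma AminI: "p \<in> bpolys N n \<Longrightarrow> d \<in> denoms s N n \<Longrightarrow> Fract p d \<in> Amin s N n"
  by (auto simp: Amin_def)

lemma AminE:
  assumes "x \<in> Amin s N n"
  obtains p d where "x = Fract p d" "p \<in> bpolys N n" "d \<in> denoms s N n" "d \<noteq> 0"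
  using assms by (auto simp: Amin_def dest: denoms_neq_0)

lemma Amin_add: "x \<in> Amin s N n \<Longrightarrow> y \<in> Amin s N n \<Longrightarrow> x + y \<in> Amin s N n"
  by (elim AminE) (auto intro!: AminI denoms_mult bpolys_add bpolys_mult intro: denoms_bpolys)

lemma Amin_mult: "x \<in> Amin s N n \<Longrightarrow> y \<in> Amin s N n \<Longrightarrow> x * y \<in> Amin s N n"
  by (elim AminE) (auto intro!: AminI denoms_mult bpolys_mult)

lemma Amin_uminus: "x \<in> Amin s N n \<Longrightarrow> - x \<in> Amin s N n"
  by (elim AminE) (auto intro!: AminI bpolys_minus)

lemma Amin_diff: "x \<in> Amin s N n \<Longrightarrow> y \<in> Amin s N n \<Longrightarrow> x - y \<in> Amin s N n"
  using Amin_add[of x s N n "- y"] by (simp add: Amin_uminus)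

lemma Amin_cst [simp]: "cst c \<in> Amin s N n"
  unfolding cst_def by (intro AminI bpolys_bpconst denoms.one)

lemma Amin_0_1 [simp]: "0 \<in> Amin s N n" "1 \<in> Amin s N n"
  using Amin_cst[of 0] Amin_cst[of 1] by (simp_all del: Amin_cst)

lemma Amin_Bvar: "k \<in> {1..N} \<Longrightarrow> j \<in> {1..n} \<Longrightarrow> Bvar k j \<in> Amin s N n"
  unfolding Bvar_def by (intro AminI bpolys_bpvar denoms.one)

lemma Amin_sum: "(\<And>i. i \<in> I \<Longrightarrow> f i \<in> Amin s N n) \<Longrightarrow> sum f I \<in> Amin s N n"
  by (induction I rule: infinite_finite_induct) (simp_all add: Amin_add)

lemma Amin_prod: "(\<And>i. i \<in> I \<Longrightarrow> f i \<in> Amin s N n) \<Longrightarrow> prod f I \<in> Amin s N n"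
  by (induction I rule: infinite_finite_induct) (simp_all add: Amin_mult)

lemma Amin_of_nat: "of_nat t \<in> Amin s N n"
  by (induction t) (simp_all add: Amin_add)

lemma Amin_neg_one_power: "(- 1) ^ t \<in> Amin s N n"
  by (induction t) (simp_all add: Amin_uminus)

lemma Amin_ccnj: "cnj s = s \<Longrightarrow> x \<in> Amin s N n \<Longrightarrow> ccnj x \<in> Amin s N n"
proof (elim AminE)
  fix p d assume "cnj s = s" and x: "x = Fract p d" "p \<in> bpolys N n" "d \<in> denoms s N n"
  moreover have "bpcnj p \<in> bpolys N n"
    using x(2) by (auto simp: bpolys_def in_keys_iff)
  ultimately show "ccnj x \<in> Amin s N n" by (auto intro!: AminI denoms_bpcnj)
qed

lemma Fract_one_hom: "Fract (p + r) 1 = Fract p 1 + Fract r 1" "Fract (p - r) 1 = Fract p 1 - Fract r 1"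
  "Fract (p * r) 1 = Fract p 1 * Fract r 1" for p r :: bpoly
  by simp_all

context
  fixes s :: complex and N n k j :: nat
  assumes kj: "k \<in> {1..N}" "j \<in> {1..n}"
begin

lemma Amin_inverse_denom: "d \<in> denoms s N n \<Longrightarrow> inverse (Fract d 1) \<in> Amin s N n"
  by (auto intro!: AminI bpolys_one)

lemma Amin_inverse_gen1: "inverse (Bvar k j + cst (of_int (2 * l - 1) * \<i>)) \<in> Amin s N n"
proof -
  have "cst (of_int (2 * l - 1) * \<i>) = cst (2 * \<i> * of_int l + - \<i>)"
    by (rule arg_cong[of _ _ cst]) (simp add: algebra_simps)
  then have "Bvar k j + cst (of_int (2 * l - 1) * \<i>) =
      Fract (((bpvar k j + bpconst (2 * \<i> * of_int l)) - bpconst \<i>) * 1) 1"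
    unfolding cst_add cst_minus
    by (simp only: Fract_one_hom mult_1_right Bvar_def cst_def) (simp only: diff_conv_add_uminus add.assoc)
  then show ?thesis using Amin_inverse_denom[OF denoms.gen1[OF denoms.one kj, where l = l]] by (simp only:)
qed

lemma Amin_inverse_gen2:
  "inverse (cst s - cst (2 * \<i>) * (Bvar k j + cst (2 * \<i> * of_int l))) \<in> Amin s N n"
proof -
  have "cst s - cst (2 * \<i>) * (Bvar k j + cst (2 * \<i> * of_int l)) =
     Fract ((bpconst s - bpconst (2 * \<i>) * (bpvar k j + bpconst (2 * \<i> * of_int l))) * 1) 1"
    by (simp only: Fract_one_hom mult_1_right Bvar_def cst_def)
  then show ?thesis using Amin_inverse_denom[OF denoms.gen2[OF denoms.one kj, where l = l]] by (simp only:)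
qed

lemma Amin_beta: "beta_c c (Bvar k j) \<in> Amin s N n" "inverse (beta_c c (Bvar k j)) \<in> Amin s N n"
  unfolding beta_c_def
  by (cases "c \<ge> 1"; simp only: if_True if_False inverse_1 Amin_add Amin_Bvar[OF kj] Amin_cst
      Amin_inverse_gen1 Amin_0_1)+

lemma Amin_alpha: "alpha_c c (Bvar k j) \<in> Amin s N n"
  using Amin_Bvar[OF kj, of s] by (simp add: alpha_c_def Amin_add)

text \<open>The shift by \<open>2 * \<i> * (c + 1)\<close> in \<open>Phi_s\<close> contributes
  \<open>-4 (c + 1)\<close> to the numerator, and one of these -4 cancels the constant 4. Up to
  sign, numerator and denominator are then generators of the localization.\<close>

lemma Phi_factors:
  "cst (4 - s) + cst (2 * \<i>) * (Bvar k j + cst (2 * \<i> * of_int (c + 1))) =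
      - (cst s - cst (2 * \<i>) * (Bvar k j + cst (2 * \<i> * of_int c)))"
  "Bvar k j + cst (2 * \<i> * of_int (c + 1)) - cst \<i> = Bvar k j + cst (of_int (2 * (c + 1) - 1) * \<i>)"
proof -
  have "4 - s + 2 * \<i> * (2 * \<i> * of_int (c + 1)) = - s + 2 * \<i> * (2 * \<i> * of_int c)"
    by (simp add: algebra_simps)
  then have "cst (4 - s) + cst (2 * \<i>) * cst (2 * \<i> * of_int (c + 1)) =
      - cst s + cst (2 * \<i>) * cst (2 * \<i> * of_int c)"
    by (metis cst_add cst_mult cst_minus)
  then show "cst (4 - s) + cst (2 * \<i>) * (Bvar k j + cst (2 * \<i> * of_int (c + 1))) =
      - (cst s - cst (2 * \<i>) * (Bvar k j + cst (2 * \<i> * of_int c)))"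
    by (simp add: algebra_simps)
  have "2 * \<i> * of_int (c + 1) + - \<i> = of_int (2 * (c + 1) - 1) * \<i>" by (simp add: algebra_simps)
  then have "cst (2 * \<i> * of_int (c + 1)) - cst \<i> = cst (of_int (2 * (c + 1) - 1) * \<i>)"
    by (metis cst_add cst_minus diff_conv_add_uminus)
  then show "Bvar k j + cst (2 * \<i> * of_int (c + 1)) - cst \<i> = Bvar k j + cst (of_int (2 * (c + 1) - 1) * \<i>)"
    by (simp add: algebra_simps)
qed

lemma Amin_sigma_plus: "sigma_plus s c (Bvar k j) \<in> Amin s N n"
  unfolding sigma_plus_def Phi_s_def Phi_factors divide_inverse
  by (intro Amin_mult Amin_beta Amin_uminus Amin_diff Amin_add Amin_cst Amin_Bvar Amin_inverse_gen1 kj)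

lemma Amin_pi_plus: "pi_plus s c (Bvar k j) \<in> Amin s N n"
  unfolding pi_plus_def by (intro Amin_mult Amin_cst Amin_sigma_plus)

text \<open>All factors of \<open>pi_plus\<close> are units of the localization, which keeps the
  homotopy \<open>h1_plus\<close> inside it.\<close>

lemma Amin_inverse_pi_plus: "inverse (pi_plus s c (Bvar k j)) \<in> Amin s N n"
proof -
  have "inverse (cst (- 1 / 4)) = cst (- 4)"
    by (rule inverse_unique) (simp flip: cst_mult)
  then show ?thesis
    unfolding pi_plus_def sigma_plus_def Phi_s_def Phi_factors divide_inverse inverse_mult_distrib
      inverse_inverse_eq inverse_minus_eq
    by (simp only:) (intro Amin_mult Amin_beta Amin_uminus Amin_add Amin_cst Amin_Bvar
        Amin_inverse_gen2 kj)
qed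

lemma Amin_Q1_plus: "Q1_plus s (Bvar k j) c \<epsilon> \<epsilon>' \<in> Amin s N n"
  by (cases "(s, Bvar k j, c, \<epsilon>, \<epsilon>')" rule: Q1_plus.cases)
    (simp_all add: Amin_pi_plus Amin_mult Amin_beta)

lemma Amin_h1_plus: "h1_plus s (Bvar k j) c \<epsilon> \<epsilon>' \<in> Amin s N n"
  by (cases "(s, Bvar k j, c, \<epsilon>, \<epsilon>')" rule: h1_plus.cases)
    (simp_all add: Amin_inverse_pi_plus Amin_mult Amin_beta)

lemma Amin_kappa_plus: "kappa_plus s c (Bvar k j) \<in> Amin s N n"
  unfolding kappa_plus_def by (intro Amin_mult Amin_cst Amin_sigma_plus Amin_alpha)

lemma Amin_K_c: "K_c c (Bvar k j) \<in> Amin s N n"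
  unfolding K_c_def by (intro Amin_mult Amin_cst Amin_beta Amin_alpha)

end

lemma cnj_s_par [simp]: "cnj (s_par q m n) = s_par q m n"
  by (simp only: s_par_def complex_cnj_complex_of_real)

section \<open>Koszul signs, and anticommutation of fermionic operators of different labels\<close>

section \<open>The fermionic operators\<close>

definition odd_state :: "fstate \<Rightarrow> bool" where
  "odd_state \<epsilon> \<longleftrightarrow> \<epsilon> \<in> {Et, Etb}"

definition odd_map :: "pair_map \<Rightarrow> bool" where
  "odd_map T \<longleftrightarrow> (\<forall>X c \<epsilon> \<epsilon>'. odd_state \<epsilon> = odd_state \<epsilon>' \<longrightarrow> T X c \<epsilon> \<epsilon>' = 0)"

lemma odd_maps: "odd_map (h1_plus s)" "odd_map (h1_minus s)"
proof -
  have "h1_plus s X c \<epsilon> \<epsilon>' = 0 \<and> h1_minus s X c \<epsilon> \<epsilon>' = 0" if "odd_state \<epsilon> = odd_state \<epsilon>'" for X c \<epsilon> \<epsilon>'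
    using that by (cases \<epsilon>; cases \<epsilon>'; simp add: odd_state_def)
  then show "odd_map (h1_plus s)" "odd_map (h1_minus s)" by (auto simp: odd_map_def)
qed

abbreviation lex_less :: "nat \<times> nat \<Rightarrow> nat \<times> nat \<Rightarrow> bool" where
  "lex_less p p' \<equiv> fst p < fst p' \<or> (fst p = fst p' \<and> snd p < snd p')"

lemma odd_before_alt: "odd_before k j e = card {p. lex_less p (k, j) \<and> odd_state (snd (e p))}"
  unfolding odd_before_def odd_state_def by (rule arg_cong[of _ _ card]) auto

lemma finite_odd_fbasis: "e \<in> fbasis N n \<Longrightarrow> finite {p. odd_state (snd (e p))}"
proof (rule finite_subset)
  assume e: "e \<in> fbasis N n"
  show "{p. odd_state (snd (e p))} \<subseteq> {1..N} \<times> {1..n}"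
  proof
    fix p assume "p \<in> {p. odd_state (snd (e p))}"
    then have "e p \<noteq> (0, E0)" by (auto simp: odd_state_def)
    then show "p \<in> {1..N} \<times> {1..n}" using e unfolding fbasis_def by blast
  qed
qed simp

text \<open>Changing the state at \<open>p\<close> alters the number of odd factors before
  \<open>(k, j)\<close> only if \<open>p\<close> precedes it and the parity of the state changes;
  finiteness makes the cardinalities genuine.\<close>

lemma odd_before_update:
  assumes "finite {p. odd_state (snd (e p))}"
  shows "(- 1 :: coeff) ^ odd_before k j (e(p := (c, \<epsilon>))) =
    (if lex_less p (k, j) \<and> odd_state \<epsilon> \<noteq> odd_state (snd (e p)) then - 1 else 1) * (- 1) ^ odd_before k j e"
proof -
  let ?Z = "{p'. lex_less p' (k, j) \<and> p' \<noteq> p \<and> odd_state (snd (e p'))}"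
  have fin: "finite ?Z" by (rule finite_subset[OF _ assms]) auto
  have 1: "{p'. lex_less p' (k, j) \<and> odd_state (snd ((e(p := (c, \<epsilon>))) p'))} =
      (if lex_less p (k, j) \<and> odd_state \<epsilon> then insert p ?Z else ?Z)"
    by (auto split: if_splits)
  have 2: "{p'. lex_less p' (k, j) \<and> odd_state (snd (e p'))} =
      (if lex_less p (k, j) \<and> odd_state (snd (e p)) then insert p ?Z else ?Z)"
    by (auto split: if_splits)
  have nZ: "p \<notin> ?Z" by simp
  show ?thesis
    unfolding odd_before_alt 1 2 using card_insert_disjoint[OF fin nZ] by auto
qed

abbreviation "states \<equiv> {E0, Et, Etb, E2}"

lemma hat_odd_single:
  "hat_odd T k j (sing e r) = (\<Sum>\<epsilon>\<in>states. sing (e((k, j) := (fst (e (k, j)), \<epsilon>)))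
     (r * ((- 1) ^ odd_before k j e * T (Bvar k j) (fst (e (k, j))) (snd (e (k, j))) \<epsilon>)))"
  unfolding hat_odd_def lin_ext_single smul_sum smul_single ..

lemma plin_hat_odd [simp]: "plin (hat_odd T k j)"
  by (simp add: hat_odd_def)

text \<open>Of two different positions exactly one precedes the other in the lexicographic order, so
  exactly one order of composition meets a Koszul sign already flipped by the other map. The signs
  \<open>x\<close> and \<open>x'\<close> record this.\<close>

lemma hat_odd_anticomm_single:
  assumes T: "odd_map T" "odd_map T'" and fin: "finite {p. odd_state (snd (e p))}"
    and ne: "(k, j) \<noteq> (k', j')"
  shows "hat_odd T k j (hat_odd T' k' j' (sing e r)) = - hat_odd T' k' j' (hat_odd T k j (sing e r))"
proof -
  let ?p = "(k, j)" and ?p' = "(k', j')"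
  let ?c = "fst (e ?p)" and ?c' = "fst (e ?p')" and ?s = "snd (e ?p)" and ?s' = "snd (e ?p')"
  let ?o = "(- 1 :: coeff) ^ odd_before k j e" and ?o' = "(- 1 :: coeff) ^ odd_before k' j' e"
  let ?e = "\<lambda>\<epsilon> \<epsilon>'. e(?p := (?c, \<epsilon>), ?p' := (?c', \<epsilon>'))"
  let ?t = "\<lambda>\<epsilon>. T (Bvar k j) ?c ?s \<epsilon>" and ?t' = "\<lambda>\<epsilon>'. T' (Bvar k' j') ?c' ?s' \<epsilon>'"
  define x where "x = (if lex_less ?p' ?p then - 1 else 1 :: coeff)"
  define x' where "x' = (if lex_less ?p ?p' then - 1 else 1 :: coeff)"
  have xx: "x' = - x" using ne unfolding x_def x'_def by auto
  have tw: "e(?p' := (?c', \<epsilon>'), ?p := (?c, \<epsilon>)) = ?e \<epsilon> \<epsilon>'" for \<epsilon> \<epsilon>'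
    by (rule fun_upd_twist) (use ne in auto)
  have o: "(- 1) ^ odd_before k j (e(?p' := (?c', \<epsilon>'))) * ?t' \<epsilon>' = x * ?o * ?t' \<epsilon>'" for \<epsilon>'
  proof (cases "odd_state \<epsilon>' = odd_state ?s'")
    case True
    then show ?thesis using T(2) by (auto simp: odd_map_def)
  next
    case False
    then show ?thesis unfolding odd_before_update[OF fin] x_def by auto
  qed
  have o': "(- 1) ^ odd_before k' j' (e(?p := (?c, \<epsilon>))) * ?t \<epsilon> = x' * ?o' * ?t \<epsilon>" for \<epsilon>
  proof (cases "odd_state \<epsilon> = odd_state ?s")
    case True
    then show ?thesis using T(1) by (auto simp: odd_map_def)
  next
    case False
    then show ?thesis unfolding odd_before_update[OF fin] x'_def by auto
  qed
  have at: "(e(?p' := y)) ?p = e ?p" "(e(?p := y)) ?p' = e ?p'" for y using ne by auto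
  have "hat_odd T k j (hat_odd T' k' j' (sing e r)) = (\<Sum>\<epsilon>'\<in>states. \<Sum>\<epsilon>\<in>states. sing (?e \<epsilon> \<epsilon>')
      (r * (?o' * ?t' \<epsilon>') * ((- 1) ^ odd_before k j (e(?p' := (?c', \<epsilon>'))) * ?t \<epsilon>)))"
    unfolding hat_odd_single[of T' k' j' e] plin_sum[OF plin_hat_odd] hat_odd_single[of T k j]
    by (simp only: at tw fst_conv snd_conv)
  also have "\<dots> = (\<Sum>\<epsilon>'\<in>states. \<Sum>\<epsilon>\<in>states. sing (?e \<epsilon> \<epsilon>') (x * (r * ?o * ?o' * ?t \<epsilon> * ?t' \<epsilon>')))"
  proof (intro sum.cong refl arg_cong[of _ _ "sing _"])
    fix \<epsilon> \<epsilon>'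
    have "r * (?o' * ?t' \<epsilon>') * ((- 1) ^ odd_before k j (e(?p' := (?c', \<epsilon>'))) * ?t \<epsilon>) =
        r * ?o' * ?t \<epsilon> * ((- 1) ^ odd_before k j (e(?p' := (?c', \<epsilon>'))) * ?t' \<epsilon>')"
      by (simp only: mult_ac)
    then show "r * (?o' * ?t' \<epsilon>') * ((- 1) ^ odd_before k j (e(?p' := (?c', \<epsilon>'))) * ?t \<epsilon>) =
        x * (r * ?o * ?o' * ?t \<epsilon> * ?t' \<epsilon>')"
      unfolding o by (simp only: mult_ac)
  qed
  finally have L: "hat_odd T k j (hat_odd T' k' j' (sing e r)) =
      (\<Sum>\<epsilon>'\<in>states. \<Sum>\<epsilon>\<in>states. sing (?e \<epsilon> \<epsilon>') (x * (r * ?o * ?o' * ?t \<epsilon> * ?t' \<epsilon>')))" .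
  have "hat_odd T' k' j' (hat_odd T k j (sing e r)) = (\<Sum>\<epsilon>\<in>states. \<Sum>\<epsilon>'\<in>states. sing (?e \<epsilon> \<epsilon>')
      (r * (?o * ?t \<epsilon>) * ((- 1) ^ odd_before k' j' (e(?p := (?c, \<epsilon>))) * ?t' \<epsilon>')))"
    unfolding hat_odd_single[of T k j e] plin_sum[OF plin_hat_odd] hat_odd_single[of T' k' j']
    by (simp only: at fst_conv snd_conv)
  also have "\<dots> = (\<Sum>\<epsilon>\<in>states. \<Sum>\<epsilon>'\<in>states. sing (?e \<epsilon> \<epsilon>') (x' * (r * ?o * ?o' * ?t \<epsilon> * ?t' \<epsilon>')))"
  proof (intro sum.cong refl arg_cong[of _ _ "sing _"])
    fix \<epsilon> \<epsilon>'
    have "r * (?o * ?t \<epsilon>) * ((- 1) ^ odd_before k' j' (e(?p := (?c, \<epsilon>))) * ?t' \<epsilon>') =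
        r * ?o * ?t' \<epsilon>' * ((- 1) ^ odd_before k' j' (e(?p := (?c, \<epsilon>))) * ?t \<epsilon>)"
      by (simp only: mult_ac)
    then show "r * (?o * ?t \<epsilon>) * ((- 1) ^ odd_before k' j' (e(?p := (?c, \<epsilon>))) * ?t' \<epsilon>') =
        x' * (r * ?o * ?o' * ?t \<epsilon> * ?t' \<epsilon>')"
      unfolding o' by (simp only: mult_ac)
  qed
  also have "\<dots> = - (\<Sum>\<epsilon>\<in>states. \<Sum>\<epsilon>'\<in>states. sing (?e \<epsilon> \<epsilon>') (x * (r * ?o * ?o' * ?t \<epsilon> * ?t' \<epsilon>')))"
    unfolding xx mult_minus_left single_uminus sum_negf ..
  also have "\<dots> = - (\<Sum>\<epsilon>'\<in>states. \<Sum>\<epsilon>\<in>states. sing (?e \<epsilon> \<epsilon>') (x * (r * ?o * ?o' * ?t \<epsilon> * ?t' \<epsilon>')))"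
    by (subst sum.swap) (rule refl)
  finally show ?thesis unfolding L by simp
qed

definition fdiag :: "(fbase \<Rightarrow> coeff) \<Rightarrow> fmod \<Rightarrow> fmod" where
  "fdiag D = lin_ext (\<lambda>e. sing e (D e))"

lemma plin_fdiag [simp]: "plin (fdiag D)"
  by (simp add: fdiag_def)

lemma fdiag_single [simp]: "fdiag D (sing e r) = sing e (r * D e)"
  by (simp add: fdiag_def smul_single)

text \<open>The property of the diagonal coefficients of one label that lets them pass through the
  one-pair maps of every other label.\<close>

definition label_local :: "nat \<Rightarrow> (fbase \<Rightarrow> coeff) \<Rightarrow> bool" where
  "label_local k D \<longleftrightarrow> (\<forall>e e'. (\<forall>j. e (k, j) = e' (k, j)) \<longrightarrow> D e = D e')"

text \<open>The common form of \<open>N\<^sup>+\<close> and \<open>N\<^sup>-\<close>: \<open>T\<close> is a homotopy \<open>h\<close>, and the diagonal \<open>M\<close> and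
  the scalar \<open>-1/n\<close> are absorbed in \<open>D\<close>.\<close>

definition label_op :: "nat \<Rightarrow> nat \<Rightarrow> pair_map \<Rightarrow> (fbase \<Rightarrow> coeff) \<Rightarrow> fmod \<Rightarrow> fmod" where
  "label_op n k T D u = (\<Sum>j=1..n. hat_odd T k j (fdiag D u))"

lemma plin_label_op [simp]: "plin (label_op n k T D)"
  unfolding label_op_def[abs_def] by (intro plin_fun_sum plin_comp[of "hat_odd _ _ _" "fdiag D"]) simp_all

lemma fdiag_hat_odd:
  assumes "label_local k D" "k \<noteq> k'"
  shows "fdiag D (hat_odd T k' j' u) = hat_odd T k' j' (fdiag D u)"
proof (rule plin_eqI[where f = "\<lambda>u. fdiag D (hat_odd T k' j' u)"
      and g = "\<lambda>u. hat_odd T k' j' (fdiag D u)", OF _ _ subset_UNIV])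
  show "plin (\<lambda>u. fdiag D (hat_odd T k' j' u))" by (rule plin_comp[of "fdiag D"]) simp_all
  show "plin (\<lambda>u. hat_odd T k' j' (fdiag D u))" by (rule plin_comp[of "hat_odd T k' j'"]) simp_all
  fix e :: fbase
  have "D (e((k', j') := y)) = D e" for y
    using assms unfolding label_local_def by (metis fst_conv fun_upd_apply)
  then show "fdiag D (hat_odd T k' j' (sing e 1)) = hat_odd T k' j' (fdiag D (sing e 1))"
    unfolding fdiag_single hat_odd_single plin_sum[OF plin_fdiag] by (simp only: mult_ac)
qed

text \<open>Both diagonal operators are moved to the right by \<open>fdiag_hat_odd\<close>; what
  remains is a double sum of pairwise anticommuting graded embeddings.\<close>

lemma label_op_anticomm:
  assumes "odd_map T" "odd_map T'" "label_local k D" "label_local k' D'" "k \<noteq> k'"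
    and u: "keysof u \<subseteq> fbasis N n"
  shows "label_op l k T D (label_op l' k' T' D' u) = - label_op l' k' T' D' (label_op l k T D u)"
proof (rule plin_eqI[where f = "\<lambda>u. label_op l k T D (label_op l' k' T' D' u)"
      and g = "\<lambda>u. - label_op l' k' T' D' (label_op l k T D u)", OF _ _ u])
  show "plin (\<lambda>u. label_op l k T D (label_op l' k' T' D' u))"
    by (rule plin_comp[of "label_op l k T D"]) simp_all
  show "plin (\<lambda>u. - label_op l' k' T' D' (label_op l k T D u))"
    by (rule plin_fun_uminus, rule plin_comp[of "label_op l' k' T' D'"]) simp_all
  fix e assume e: "e \<in> fbasis N n"
  have "hat_odd T k j (hat_odd T' k' j' (fdiag D (fdiag D' (sing e 1)))) =
      - hat_odd T' k' j' (hat_odd T k j (fdiag D' (fdiag D (sing e 1))))" for j j'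
    using hat_odd_anticomm_single[OF assms(1,2) finite_odd_fbasis[OF e], of k j k' j'] assms(5)
    by (simp add: mult_ac)
  then have "(\<Sum>j=1..l. \<Sum>j'=1..l'. hat_odd T k j (hat_odd T' k' j' (fdiag D (fdiag D' (sing e 1))))) =
      - (\<Sum>j=1..l. \<Sum>j'=1..l'. hat_odd T' k' j' (hat_odd T k j (fdiag D' (fdiag D (sing e 1)))))"
    by (simp only: sum_negf)
  also have "\<dots> = - (\<Sum>j'=1..l'. \<Sum>j=1..l. hat_odd T' k' j' (hat_odd T k j (fdiag D' (fdiag D (sing e 1)))))"
    by (subst sum.swap) (rule refl)
  finally show "label_op l k T D (label_op l' k' T' D' (sing e 1)) =
      - label_op l' k' T' D' (label_op l k T D (sing e 1))"
    unfolding label_op_def plin_sum[OF plin_fdiag] plin_sum[OF plin_hat_odd]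
      fdiag_hat_odd[OF assms(3,5)] fdiag_hat_odd[OF assms(4) not_sym[OF assms(5)]] .
qed

definition Fmod :: "real \<Rightarrow> nat \<Rightarrow> nat \<Rightarrow> nat \<Rightarrow> fmod set" where
  "Fmod q m N n = {u. \<forall>e\<in>keysof u. e \<in> fbasis N n \<and> coef u e \<in> Amin (s_par q m n) N n}"

lemma Fmod_iff: "u \<in> Fmod q m N n \<longleftrightarrow>
    keysof u \<subseteq> fbasis N n \<and> (\<forall>e. coef u e \<in> Amin (s_par q m n) N n)"
proof -
  have "coef u e \<in> Amin (s_par q m n) N n" if "e \<notin> keysof u" for e
    using that by (simp add: in_keys_iff)
  then show ?thesis unfolding Fmod_def by blast
qed

lemma Fmod_zero [simp]: "0 \<in> Fmod q m N n"
  by (simp add: Fmod_iff)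

lemma Fmod_add: "u \<in> Fmod q m N n \<Longrightarrow> w \<in> Fmod q m N n \<Longrightarrow> u + w \<in> Fmod q m N n"
  by (simp add: Fmod_iff keys_add_subset lookup_add Amin_add)

lemma Fmod_uminus: "u \<in> Fmod q m N n \<Longrightarrow> - u \<in> Fmod q m N n"
  by (simp add: Fmod_iff keys_minus_subset Amin_uminus)

lemma Fmod_smul: "c \<in> Amin (s_par q m n) N n \<Longrightarrow> u \<in> Fmod q m N n \<Longrightarrow> smul c u \<in> Fmod q m N n"
  by (simp add: Fmod_iff keys_smul_subset Amin_mult)

lemma Fmod_sum: "(\<And>i. i \<in> I \<Longrightarrow> f i \<in> Fmod q m N n) \<Longrightarrow> sum f I \<in> Fmod q m N n"
  by (induction I rule: infinite_finite_induct) (simp_all add: Fmod_add)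

lemma Fmod_single: "e \<in> fbasis N n \<Longrightarrow> r \<in> Amin (s_par q m n) N n \<Longrightarrow> sing e r \<in> Fmod q m N n"
  by (simp add: Fmod_iff lookup_single when_def)

lemma Fmod_lin_ext:
  assumes "u \<in> Fmod q m N n" "\<And>e. e \<in> fbasis N n \<Longrightarrow> \<phi> e \<in> Fmod q m N n"
  shows "lin_ext \<phi> u \<in> Fmod q m N n"
  unfolding lin_ext_def
  by (intro Fmod_sum Fmod_smul) (use assms in \<open>auto simp: Fmod_def\<close>)

lemma fbasis_update: "e \<in> fbasis N n \<Longrightarrow> k \<in> {1..N} \<Longrightarrow> j \<in> {1..n} \<Longrightarrow> e((k, j) := x) \<in> fbasis N n"
  by (auto simp: fbasis_def)

lemma Fmod_hat_odd:
  assumes "k \<in> {1..N}" "j \<in> {1..n}" "u \<in> Fmod q m N n"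
    and "\<And>c \<epsilon> \<epsilon>'. T (Bvar k j) c \<epsilon> \<epsilon>' \<in> Amin (s_par q m n) N n"
  shows "hat_odd T k j u \<in> Fmod q m N n"
  unfolding hat_odd_def
  by (intro Fmod_lin_ext Fmod_sum Fmod_single fbasis_update Amin_mult Amin_neg_one_power assms)

lemma Fmod_fdiag:
  assumes "u \<in> Fmod q m N n" "\<And>e. D e \<in> Amin (s_par q m n) N n"
  shows "fdiag D u \<in> Fmod q m N n"
  unfolding fdiag_def by (intro Fmod_lin_ext Fmod_single assms)

lemma Fmod_label_op:
  assumes "k \<in> {1..N}" "u \<in> Fmod q m N n" "\<And>e. D e \<in> Amin (s_par q m n) N n"
    and "\<And>j c \<epsilon> \<epsilon>'. j \<in> {1..n} \<Longrightarrow> T (Bvar k j) c \<epsilon> \<epsilon>' \<in> Amin (s_par q m n) N n"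
  shows "label_op n k T D u \<in> Fmod q m N n"
  unfolding label_op_def by (intro Fmod_sum Fmod_hat_odd Fmod_fdiag assms)

definition Mcoef :: "real \<Rightarrow> nat \<Rightarrow> nat \<Rightarrow> nat \<Rightarrow> nat \<Rightarrow> fbase \<Rightarrow> coeff" where
  "Mcoef q m n k r e = cst (of_real (delta_m q m)) +
      (\<Sum>S\<in>Pow {1..n} - {{}}. PS_plus n k S e *
        ((\<Sum>j\<in>S. kappa_plus (s_par q m n) (fst (e (k, j))) (Bvar k j))
         - of_nat (card S)
         - cst (of_real (Bq q (card S) r)) * (\<Sum>j\<in>S. K_c (fst (e (k, j))) (Bvar k j))))"

definition Ncoef :: "real \<Rightarrow> nat \<Rightarrow> nat \<Rightarrow> nat \<Rightarrow> nat \<Rightarrow> fbase \<Rightarrow> coeff" where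
  "Ncoef q m n k r e = - cst (1 / of_nat n) * Mcoef q m n k r e"

lemma N_plus_label_op: "N_plus q m n k r = label_op n k (h1_plus (s_par q m n)) (Ncoef q m n k r)"
proof
  fix u
  have D: "fdiag (Ncoef q m n k r) u = smul (- cst (1 / of_nat n)) (fdiag (Mcoef q m n k r) u)"
    unfolding fdiag_def lin_ext_fun_smul[symmetric] smul_single Ncoef_def ..
  have M: "M_plus q m n k r = fdiag (Mcoef q m n k r)"
    by (simp add: M_plus_def fdiag_def Mcoef_def)
  show "N_plus q m n k r u = label_op n k (h1_plus (s_par q m n)) (Ncoef q m n k r) u"
    unfolding N_plus_def h_plus_def label_op_def D M plin_smul[OF plin_hat_odd] smul_sum[symmetric]
    by (simp add: smul_minus)
qed

lemma label_local_Ncoef: "label_local k (Ncoef q m n k r)"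
  unfolding label_local_def Ncoef_def Mcoef_def PS_plus_def P1_plus_def by simp

lemma Amin_Ncoef:
  assumes k: "k \<in> {1..N}"
  shows "Ncoef q m n k r e \<in> Amin (s_par q m n) N n"
proof -
  have P: "P1_plus k j e \<in> Amin (s_par q m n) N n" for j
    by (simp add: P1_plus_def)
  have "PS_plus n k S e \<in> Amin (s_par q m n) N n" for S
    unfolding PS_plus_def by (intro Amin_mult Amin_prod Amin_diff P Amin_0_1)
  moreover have "(\<Sum>j\<in>S. kappa_plus (s_par q m n) (fst (e (k, j))) (Bvar k j)) \<in> Amin (s_par q m n) N n"
    "(\<Sum>j\<in>S. K_c (fst (e (k, j))) (Bvar k j)) \<in> Amin (s_par q m n) N n"
    if "S \<in> Pow {1..n} - {{}}" for S
    using that k by (auto intro!: Amin_sum Amin_kappa_plus Amin_K_c)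
  ultimately show ?thesis
    unfolding Ncoef_def Mcoef_def
    by (intro Amin_mult Amin_uminus Amin_add Amin_cst, intro Amin_sum,
        intro Amin_mult Amin_diff Amin_cst Amin_of_nat) blast+
qed

definition fbdag :: "fbase \<Rightarrow> fbase" where
  "fbdag e = (\<lambda>p. (- fst (e p), state_dag (snd (e p))))"

lemma fdag_sing: "fdag (sing e r) = sing (fbdag e) ((- 1) ^ card {p. snd (e p) = E2} * ccnj r)"
  unfolding fbdag_def by (rule fdag_single)

lemma fdag_zero [simp]: "fdag 0 = 0"
  using fdag_add[of 0 0] by simp

lemma fdag_sum: "fdag (\<Sum>i\<in>I. f i) = (\<Sum>i\<in>I. fdag (f i))"
  by (induction I rule: infinite_finite_induct) (simp_all add: fdag_add)

lemma fbasis_fbdag: "e \<in> fbasis N n \<Longrightarrow> fbdag e \<in> fbasis N n"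
  by (auto simp: fbasis_def fbdag_def)

lemma Fmod_fdag:
  assumes "u \<in> Fmod q m N n"
  shows "fdag u \<in> Fmod q m N n"
proof -
  have "fdag u = (\<Sum>e\<in>keysof u. fdag (sing e (coef u e)))"
    by (subst poly_mapping_expand[of u]) (rule fdag_sum)
  also have "\<dots> \<in> Fmod q m N n"
    unfolding fdag_sing
    by (intro Fmod_sum Fmod_single fbasis_fbdag Amin_mult Amin_neg_one_power Amin_ccnj)
      (use assms in \<open>auto simp: Fmod_def\<close>)
  finally show ?thesis .
qed

lemma finite_E2: "e \<in> fbasis N n \<Longrightarrow> finite {p. snd (e p) = E2}"
proof (rule finite_subset)
  assume e: "e \<in> fbasis N n"
  show "{p. snd (e p) = E2} \<subseteq> {1..N} \<times> {1..n}"
  proof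
    fix p assume "p \<in> {p. snd (e p) = E2}"
    then have "e p \<noteq> (0, E0)" by auto
    then show "p \<in> {1..N} \<times> {1..n}" using e unfolding fbasis_def by blast
  qed
qed simp

text \<open>Conjugation turns \<open>h1_plus\<close> into \<open>h1_minus\<close> and the diagonal
  entry at \<open>fbdag e\<close> into its conjugate at \<open>e\<close>. The basis is restricted
  because the sign in \<open>fdag\<close> counts the states \<open>E2\<close>, which must be
  finitely many.\<close>

lemma N_minus_label_op:
  assumes "keysof u \<subseteq> fbasis N n"
  shows "N_minus q m n k r u =
    label_op n k (h1_minus (s_par q m n)) (\<lambda>e. ccnj (Ncoef q m n k r (fbdag e))) u"
  using assms
proof (induction u rule: keys_induct)
  case zero
  show ?case by (simp add: N_minus_def N_plus_label_op plin_zero)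
next
  case (add u w)
  then show ?case by (simp add: N_minus_def N_plus_label_op plin_add fdag_add)
next
  case (single e r')
  let ?D = "Ncoef q m n k r"
  have "fdiag ?D (fdag (sing e r')) = fdag (sing e (r' * ccnj (?D (fbdag e))))"
    unfolding fdag_sing fdiag_single by (simp add: ccnj_mult mult.assoc)
  then have "N_minus q m n k r (sing e r') =
      (\<Sum>j=1..n. fdag (hat_odd (h1_plus (s_par q m n)) k j (fdag (sing e (r' * ccnj (?D (fbdag e)))))))"
    by (simp add: N_minus_def N_plus_label_op label_op_def fdag_sum)
  also have "\<dots> = (\<Sum>j=1..n. hat_odd (h1_minus (s_par q m n)) k j (sing e (r' * ccnj (?D (fbdag e)))))"
    by (simp only: Q1_h1_minus_dag(2)[OF finite_E2[OF single]])
  finally show ?case by (simp add: label_op_def)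
qed

lemma label_local_Ncoef_dag: "label_local k (\<lambda>e. ccnj (Ncoef q m n k r (fbdag e)))"
  unfolding label_local_def
proof (intro allI impI)
  fix e e' :: fbase assume "\<forall>j. e (k, j) = e' (k, j)"
  then have "\<forall>j. fbdag e (k, j) = fbdag e' (k, j)" by (simp add: fbdag_def)
  with label_local_Ncoef[of k q m n r] have "Ncoef q m n k r (fbdag e) = Ncoef q m n k r (fbdag e')"
    unfolding label_local_def by blast
  then show "ccnj (Ncoef q m n k r (fbdag e)) = ccnj (Ncoef q m n k r (fbdag e'))" by simp
qed

lemma Fmod_N_plus: "k \<in> {1..N} \<Longrightarrow> u \<in> Fmod q m N n \<Longrightarrow> N_plus q m n k r u \<in> Fmod q m N n"
  unfolding N_plus_label_op by (intro Fmod_label_op Amin_Ncoef Amin_h1_plus)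

lemma Fmod_N_minus: "k \<in> {1..N} \<Longrightarrow> u \<in> Fmod q m N n \<Longrightarrow> N_minus q m n k r u \<in> Fmod q m N n"
  using Fmod_N_plus[of k N "fdag u" q m n r] by (simp add: N_minus_def Fmod_fdag)

lemma Fmod_Q_plus: "k \<in> {1..N} \<Longrightarrow> u \<in> Fmod q m N n \<Longrightarrow> Q_plus q m n k u \<in> Fmod q m N n"
  unfolding Q_plus_def by (intro Fmod_sum Fmod_hat_odd Amin_Q1_plus)

text \<open>The degrees \<open>r\<close> and \<open>r'\<close> are free parameters, as they affect
  only the diagonal coefficients; the anticommutation comes from the odd homotopies of different
  labels.\<close>

lemma N_anticomm:
  assumes "u \<in> Fmod q m N n" "k \<in> {1..N}" "k' \<in> {1..N}" "k \<noteq> k'"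
  shows "N_plus q m n k r (N_plus q m n k' r' u) = - N_plus q m n k' r' (N_plus q m n k r u)"
    and "N_plus q m n k r (N_minus q m n k' r' u) = - N_minus q m n k' r' (N_plus q m n k r u)"
    and "N_minus q m n k r (N_minus q m n k' r' u) = - N_minus q m n k' r' (N_minus q m n k r u)"
proof -
  have k: "keysof u \<subseteq> fbasis N n" "keysof (N_plus q m n k r u) \<subseteq> fbasis N n"
    "keysof (N_minus q m n k r u) \<subseteq> fbasis N n" "keysof (N_minus q m n k' r' u) \<subseteq> fbasis N n"
    using assms(1) Fmod_N_plus[OF assms(2,1), of r] Fmod_N_minus[OF assms(2,1), of r]
      Fmod_N_minus[OF assms(3,1), of r'] by (simp_all add: Fmod_iff)
  show "N_plus q m n k r (N_plus q m n k' r' u) = - N_plus q m n k' r' (N_plus q m n k r u)"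
    unfolding N_plus_label_op
    by (rule label_op_anticomm[OF _ _ _ _ assms(4) k(1)])
      (rule odd_maps label_local_Ncoef)+
  show "N_plus q m n k r (N_minus q m n k' r' u) = - N_minus q m n k' r' (N_plus q m n k r u)"
    unfolding N_minus_label_op[OF k(2)] N_minus_label_op[OF k(1)] unfolding N_plus_label_op
    by (rule label_op_anticomm[OF _ _ _ _ assms(4) k(1)])
      (rule odd_maps label_local_Ncoef label_local_Ncoef_dag)+
  show "N_minus q m n k r (N_minus q m n k' r' u) = - N_minus q m n k' r' (N_minus q m n k r u)"
    unfolding N_minus_label_op[OF k(3)] N_minus_label_op[OF k(4)] unfolding N_minus_label_op[OF k(1)]
    by (rule label_op_anticomm[OF _ _ _ _ assms(4) k(1)])
      (rule odd_maps label_local_Ncoef_dag)+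
qed

section \<open>Graded tensor products of operators; squares and commutation of H\<close>

section \<open>Operators on the total space\<close>

lemma Mspace_iff: "v \<in> Mspace q m N n \<longleftrightarrow> keysof v \<subseteq> pbasis m N \<and> (\<forall>b. coef v b \<in> Fmod q m N n)"
proof -
  have "coef v b \<in> Fmod q m N n" if "b \<notin> keysof v" for b
    using that by (simp add: in_keys_iff)
  then show ?thesis unfolding Mspace_def Fmod_def[symmetric] by (auto simp: Fmod_def)
qed

lemma Mspace_zero [simp]: "0 \<in> Mspace q m N n"
  by (simp add: Mspace_iff)

lemma Mspace_add: "v \<in> Mspace q m N n \<Longrightarrow> w \<in> Mspace q m N n \<Longrightarrow> v + w \<in> Mspace q m N n"
  by (simp add: Mspace_iff keys_add_subset lookup_add Fmod_add)

lemma Mspace_uminus: "v \<in> Mspace q m N n \<Longrightarrow> - v \<in> Mspace q m N n"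
  by (simp add: Mspace_iff keys_minus_subset Fmod_uminus)

lemma Mspace_sum: "(\<And>i. i \<in> I \<Longrightarrow> f i \<in> Mspace q m N n) \<Longrightarrow> sum f I \<in> Mspace q m N n"
  by (induction I rule: infinite_finite_induct) (simp_all add: Mspace_add)

lemma coef_tens: "coef (tens F u) b = smul (cst (coef F b)) u"
  by (cases "b \<in> keysof F") (auto simp: tens_def lookup_sum lookup_single when_def in_keys_iff)

lemma coef_mscale: "coef (mscale c v) b = smul (cst c) (coef v b)"
  by (simp add: mscale_def map.rep_eq when_def)

lemma tens_zero [simp]: "tens 0 u = 0" "tens F 0 = 0"
  by (rule poly_mapping_eqI, simp add: coef_tens)+

lemma tens_add: "tens (F + G) u = tens F u + tens G u" "tens F (u + w) = tens F u + tens F w"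
  by (rule poly_mapping_eqI, simp add: coef_tens lookup_add cst_add smul_add_left smul_add)+

lemma tens_minus: "tens (- F) u = - tens F u" "tens F (- u) = - tens F u"
  by (rule poly_mapping_eqI, simp add: coef_tens cst_minus smul_minus)+

lemma tens_sum: "tens (\<Sum>i\<in>I. F i) u = (\<Sum>i\<in>I. tens (F i) u)"
  by (induction I rule: infinite_finite_induct) (simp_all add: tens_add)

lemma tens_smul: "tens (smul c F) u = mscale c (tens F u)" "tens F (smul (cst c) u) = mscale c (tens F u)"
  by (rule poly_mapping_eqI, simp add: coef_tens coef_mscale smul_smul cst_mult mult.commute)+

lemma mscale_simps [simp]: "mscale c 0 = 0" "mscale 1 v = v"
  by (rule poly_mapping_eqI, simp add: coef_mscale)+

lemma mscale_add: "mscale c (v + w) = mscale c v + mscale c w"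
  by (rule poly_mapping_eqI) (simp add: coef_mscale lookup_add smul_add)

lemma mscale_mscale: "mscale c (mscale d v) = mscale (c * d) v"
  by (rule poly_mapping_eqI) (simp add: coef_mscale smul_smul cst_mult)

lemma mscale_minus: "mscale (- c) v = - mscale c v"
  by (rule poly_mapping_eqI) (simp add: coef_mscale smul_minus cst_minus)

lemma Mspace_mscale: "v \<in> Mspace q m N n \<Longrightarrow> mscale c v \<in> Mspace q m N n"
proof -
  assume v: "v \<in> Mspace q m N n"
  have "keysof (mscale c v) \<subseteq> keysof v"
    by (rule subsetI) (auto simp: in_keys_iff coef_mscale)
  then show ?thesis using v by (auto simp: Mspace_iff coef_mscale Fmod_smul)
qed

lemma Mspace_tens: "F \<in> PCl m N \<Longrightarrow> u \<in> Fmod q m N n \<Longrightarrow> tens F u \<in> Mspace q m N n"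
proof -
  assume F: "F \<in> PCl m N" and u: "u \<in> Fmod q m N n"
  have "keysof (tens F u) \<subseteq> keysof F"
    by (rule subsetI) (auto simp: in_keys_iff coef_tens)
  then show ?thesis using F u by (auto simp: Mspace_iff PCl_iff coef_tens Fmod_smul)
qed

lemma gtens_superset:
  assumes "finite A" "keysof v \<subseteq> A" "\<And>b. Y b 0 = 0"
  shows "gtens y X Y v = (\<Sum>b\<in>A. mscale ((- 1) ^ (y * pparity b))
       (tens (X (sing b 1)) (Y b (coef v b))))"
  unfolding gtens_def
  by (rule sum.mono_neutral_left) (use assms in \<open>auto simp: in_keys_iff\<close>)

lemma gtens_add:
  assumes "\<And>b u w. Y b (u + w) = Y b u + Y b w"
  shows "gtens y X Y (v + w) = gtens y X Y v + gtens y X Y w"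
proof -
  have 0: "Y b 0 = 0" for b using assms[of b 0 0] by simp
  let ?A = "keysof v \<union> keysof w"
  have "keysof (v + w) \<subseteq> ?A" by (rule keys_add)
  then show ?thesis
    by (simp add: gtens_superset[where A = ?A and Y = Y, OF _ _ 0] lookup_add assms tens_add mscale_add sum.distrib)
qed

lemma gtens_zero [simp]: "gtens y X Y 0 = 0"
  by (simp add: gtens_def)

lemma gtens_sum:
  assumes "\<And>b u w. Y b (u + w) = Y b u + Y b w"
  shows "gtens y X Y (\<Sum>i\<in>I. f i) = (\<Sum>i\<in>I. gtens y X Y (f i))"
  by (induction I rule: infinite_finite_induct) (simp_all add: gtens_add[of Y, OF assms])

lemma gtens_single:
  assumes "\<And>b. Y b 0 = 0"
  shows "gtens y X Y (sing b u) = mscale ((- 1) ^ (y * pparity b)) (tens (X (sing b 1)) (Y b u))"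
  by (subst gtens_superset[of "{b}"]) (auto simp: assms)

lemma Mspace_gtens:
  assumes "v \<in> Mspace q m N n" "\<And>b. b \<in> pbasis m N \<Longrightarrow> X (sing b 1) \<in> PCl m N"
    and "\<And>b u. u \<in> Fmod q m N n \<Longrightarrow> Y b u \<in> Fmod q m N n"
  shows "gtens y X Y v \<in> Mspace q m N n"
  unfolding gtens_def
  by (intro Mspace_sum Mspace_mscale Mspace_tens) (use assms in \<open>auto simp: Mspace_iff\<close>)

lemma lin_on_expand:
  assumes "lin_on m N X" "F \<in> PCl m N"
  shows "X F = (\<Sum>b\<in>keysof F. smul (coef F b) (X (sing b 1)))"
proof -
  have p: "sing b c \<in> PCl m N" if "b \<in> keysof F" for b c
    using assms(2) that by (auto simp: PCl_iff)
  have "X F = X (\<Sum>b\<in>keysof F. smul (coef F b) (sing b 1))"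
    by (subst poly_mapping_expand[of F]) (simp add: smul_single)
  also have "\<dots> = (\<Sum>b\<in>keysof F. X (smul (coef F b) (sing b 1)))"
    by (rule lin_on_sum[OF assms(1)]) (simp add: p PCl_smul)
  also have "\<dots> = (\<Sum>b\<in>keysof F. smul (coef F b) (X (sing b 1)))"
    by (rule sum.cong) (simp_all add: lin_onD(3)[OF assms(1) p])
  finally show ?thesis .
qed

text \<open>The two Koszul signs belong to basis elements of opposite parity and multiply to -1. The
  last assumption says that the outer fermionic operator, although chosen by the degrees of
  \<open>b'\<close>, sends the inner result to one \<open>w\<close> for all \<open>b'\<close> in the
  support.\<close>

lemma gtens_gtens_single:
  assumes X: "lin_on m N X" "X' (sing b 1) \<in> PCl m N"
    and Y: "\<And>b u w. Y b (u + w) = Y b u + Y b w" "\<And>b. Y' b 0 = 0"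
    and par: "\<And>b'. b' \<in> keysof (X' (sing b 1)) \<Longrightarrow> (- 1 :: complex) ^ pparity b' = - ((- 1) ^ pparity b)"
    and YW: "\<And>b' c. b' \<in> keysof (X' (sing b 1)) \<Longrightarrow> Y b' (smul (cst c) (Y' b u)) = smul (cst c) w"
  shows "gtens 1 X Y (gtens 1 X' Y' (sing b u)) = - tens (X (X' (sing b 1))) w"
proof -
  let ?F = "X' (sing b 1)" and ?\<sigma> = "(- 1) ^ pparity b :: complex"
  have Y0: "Y b' 0 = 0" for b' using Y(1)[of b' 0 0] by simp
  have ss: "?\<sigma> * ?\<sigma> = 1" by (simp flip: power_mult_distrib)
  have "gtens 1 X' Y' (sing b u) = (\<Sum>b'\<in>keysof ?F. sing b' (smul (cst (?\<sigma> * coef ?F b')) (Y' b u)))"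
    by (rule poly_mapping_eqI)
      (auto simp: gtens_single[of Y', OF Y(2)] coef_mscale coef_tens smul_smul cst_mult lookup_sum
        lookup_single when_def in_keys_iff)
  then have "gtens 1 X Y (gtens 1 X' Y' (sing b u)) =
      (\<Sum>b'\<in>keysof ?F. gtens 1 X Y (sing b' (smul (cst (?\<sigma> * coef ?F b')) (Y' b u))))"
    by (simp only: gtens_sum[of Y, OF Y(1)])
  also have "\<dots> = (\<Sum>b'\<in>keysof ?F. - tens (smul (coef ?F b') (X (sing b' 1))) w)"
  proof (rule sum.cong[OF refl])
    fix b' assume b': "b' \<in> keysof ?F"
    have "gtens 1 X Y (sing b' (smul (cst (?\<sigma> * coef ?F b')) (Y' b u))) =
        mscale (- ?\<sigma>) (tens (X (sing b' 1)) (smul (cst (?\<sigma> * coef ?F b')) w))"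
      by (simp only: gtens_single[of Y, OF Y0] par[OF b'] YW[OF b'] mult_1_left)
    also have "\<dots> = mscale (- (?\<sigma> * ?\<sigma>) * coef ?F b') (tens (X (sing b' 1)) w)"
      by (simp only: tens_smul mscale_mscale mult.assoc mult_minus_left)
    finally show "gtens 1 X Y (sing b' (smul (cst (?\<sigma> * coef ?F b')) (Y' b u))) =
        - tens (smul (coef ?F b') (X (sing b' 1))) w"
      unfolding ss by (simp add: tens_smul mscale_minus)
  qed
  also have "\<dots> = - tens (X ?F) w"
    unfolding lin_on_expand[OF X] tens_sum sum_negf ..
  finally show ?thesis .
qed

text \<open>Additivity suffices: the fermionic coefficients \<open>u\<close> range over all of
  \<open>Fmod\<close>, so every vector is a sum of vectors \<open>sing b u\<close>.\<close>

lemma mtot_eqI: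
  assumes "v \<in> Mspace q m N n" "\<And>v w. f (v + w) = f v + f w" "\<And>v w. g (v + w) = g v + g w"
    and "\<And>b u. b \<in> pbasis m N \<Longrightarrow> u \<in> Fmod q m N n \<Longrightarrow> f (sing b u) = g (sing b u)"
  shows "f v = (g v :: mtot)"
proof -
  have s: "h (\<Sum>i\<in>I. k i) = (\<Sum>i\<in>I. h (k i))" if "\<And>v w. h (v + w) = h v + h w"
    for h :: "mtot \<Rightarrow> mtot" and k and I :: "pbase set"
  proof -
    have "h 0 = 0" using that[of 0 0] by simp
    then show ?thesis by (induction I rule: infinite_finite_induct) (simp_all add: that)
  qed
  have "f v = (\<Sum>b\<in>keysof v. f (sing b (coef v b)))"
    by (subst poly_mapping_expand[of v]) (rule s[OF assms(2)])
  also have "\<dots> = (\<Sum>b\<in>keysof v. g (sing b (coef v b)))"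
    by (rule sum.cong) (use assms(1,4) in \<open>auto simp: Mspace_iff\<close>)
  also have "\<dots> = g v"
    by (subst (3) poly_mapping_expand[of v]) (rule s[OF assms(3), symmetric])
  finally show ?thesis .
qed

lemma N_plus_add: "N_plus q m n k r (u + w) = N_plus q m n k r u + N_plus q m n k r w"
  by (simp add: N_plus_label_op plin_add)

lemma N_minus_add: "N_minus q m n k r (u + w) = N_minus q m n k r u + N_minus q m n k r w"
  by (simp add: N_minus_def N_plus_add fdag_add)

lemma N_zero [simp]: "N_plus q m n k r 0 = 0" "N_minus q m n k r 0 = 0"
  by (simp_all add: N_minus_def N_plus_label_op plin_zero)

lemma N_smul:
  assumes "u \<in> Fmod q m N n"
  shows "N_plus q m n k r (smul (cst c) u) = smul (cst c) (N_plus q m n k r u)"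
    "N_minus q m n k r (smul (cst c) u) = smul (cst c) (N_minus q m n k r u)"
proof -
  have "keysof u \<subseteq> fbasis N n" "keysof (smul (cst c) u) \<subseteq> fbasis N n"
    using assms by (simp_all add: Fmod_iff keys_smul_subset)
  then show "N_plus q m n k r (smul (cst c) u) = smul (cst c) (N_plus q m n k r u)"
    "N_minus q m n k r (smul (cst c) u) = smul (cst c) (N_minus q m n k r u)"
    by (simp_all add: N_plus_label_op N_minus_label_op plin_smul)
qed

lemma H_plus_add: "H_plus q m N n i (v + w) = H_plus q m N n i v + H_plus q m N n i w"
  unfolding H_plus_def by (rule gtens_add) (rule N_plus_add)

lemma H_minus_add: "H_minus q m N n i (v + w) = H_minus q m N n i v + H_minus q m N n i w"
  unfolding H_minus_def by (rule gtens_add) (rule N_minus_add)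

lemma self_neg_eq_0: "x = - x \<Longrightarrow> x = 0" for x :: pcl
proof (rule poly_mapping_eqI)
  fix b assume "x = - x"
  then have "coef x b = - coef x b" by (metis lookup_uminus)
  then show "coef x b = coef 0 b" by simp
qed

context
  fixes q :: real and m N n :: nat
  assumes mN: "N \<le> m"
begin

lemma n_plus_sing: "i \<in> {1..N} \<Longrightarrow> b \<in> pbasis m N \<Longrightarrow> n_plus m N i (sing b 1) \<in> PCl m N"
  by (intro n_plus_PCl mN sing_PCl)

lemma n_minus_sing: "i \<in> {1..N} \<Longrightarrow> b \<in> pbasis m N \<Longrightarrow> n_minus m N i (sing b 1) \<in> PCl m N"
  using n_minus_lin_on[OF mN] sing_PCl[of b m N 1] by (simp add: lin_on_def)

lemma H_plus_Mspace: "i \<in> {1..N} \<Longrightarrow> v \<in> Mspace q m N n \<Longrightarrow> H_plus q m N n i v \<in> Mspace q m N n"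
  unfolding H_plus_def by (intro Mspace_gtens n_plus_sing Fmod_N_plus)

lemma H_minus_Mspace: "i \<in> {1..N} \<Longrightarrow> v \<in> Mspace q m N n \<Longrightarrow> H_minus q m N n i v \<in> Mspace q m N n"
  unfolding H_minus_def by (intro Mspace_gtens n_minus_sing Fmod_N_minus)

text \<open>The zbar-degree read by the outer operator is unchanged by the inner contraction for
  every label, so \<open>i = j\<close> is included; \<open>H_square\<close> uses that case.\<close>

lemma H_plus_H_plus_single:
  assumes "i \<in> {1..N}" "j \<in> {1..N}" "b \<in> pbasis m N" "u \<in> Fmod q m N n"
  shows "H_plus q m N n i (H_plus q m N n j (sing b u)) =
    - tens (n_plus m N i (n_plus m N j (sing b 1)))
       (N_plus q m n i (zbdeg i b) (N_plus q m n j (zbdeg j b) u))"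
  unfolding H_plus_def
  by (rule gtens_gtens_single[where X = "n_plus m N i" and X' = "n_plus m N j",
      OF n_plus_lin_on[OF mN assms(1)] n_plus_sing[OF assms(2,3)]])
    (simp_all add: N_plus_add n_plus_parity[OF mN assms(2,3)] n_plus_zbdeg[OF mN assms(2,3)]
      N_smul[OF Fmod_N_plus[OF assms(2,4)]])

text \<open>The inner \<open>n_minus\<close> may change the zbar-degree of its own label
  \<open>j\<close>; the outer operator reads that of \<open>i\<close>, hence
  \<open>i \<noteq> j\<close>.\<close>

lemma H_plus_H_minus_single:
  assumes "i \<in> {1..N}" "j \<in> {1..N}" "i \<noteq> j" "b \<in> pbasis m N" "u \<in> Fmod q m N n"
  shows "H_plus q m N n i (H_minus q m N n j (sing b u)) =
    - tens (n_plus m N i (n_minus m N j (sing b 1)))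
       (N_plus q m n i (zbdeg i b) (N_minus q m n j (zdeg j b) u))"
  unfolding H_plus_def H_minus_def
  by (rule gtens_gtens_single[where X = "n_plus m N i" and X' = "n_minus m N j",
      OF n_plus_lin_on[OF mN assms(1)] n_minus_sing[OF assms(2,4)]])
    (simp_all add: N_plus_add n_minus_degrees(1,2)[OF mN assms(2,4)] n_minus_degrees(3)[OF mN assms(2,4) _ assms(1,3)]
      N_smul[OF Fmod_N_minus[OF assms(2,5)]])

lemma H_minus_H_plus_single:
  assumes "i \<in> {1..N}" "j \<in> {1..N}" "i \<noteq> j" "b \<in> pbasis m N" "u \<in> Fmod q m N n"
  shows "H_minus q m N n i (H_plus q m N n j (sing b u)) =
    - tens (n_minus m N i (n_plus m N j (sing b 1)))
       (N_minus q m n i (zdeg i b) (N_plus q m n j (zbdeg j b) u))"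
  unfolding H_plus_def H_minus_def
  by (rule gtens_gtens_single[where X = "n_minus m N i" and X' = "n_plus m N j",
      OF n_minus_lin_on[OF mN assms(1)] n_plus_sing[OF assms(2,4)]])
    (simp_all add: N_minus_add n_plus_parity[OF mN assms(2,4)] n_plus_zdeg[OF mN assms(2,1,3,4)]
      N_smul[OF Fmod_N_plus[OF assms(2,5)]])

lemma H_minus_H_minus_single:
  assumes "i \<in> {1..N}" "j \<in> {1..N}" "b \<in> pbasis m N" "u \<in> Fmod q m N n"
  shows "H_minus q m N n i (H_minus q m N n j (sing b u)) =
    - tens (n_minus m N i (n_minus m N j (sing b 1)))
       (N_minus q m n i (zdeg i b) (N_minus q m n j (zdeg j b) u))"
  unfolding H_minus_def
  by (rule gtens_gtens_single[where X = "n_minus m N i" and X' = "n_minus m N j",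
      OF n_minus_lin_on[OF mN assms(1)] n_minus_sing[OF assms(2,3)]])
    (simp_all add: N_minus_add n_minus_degrees[OF mN assms(2,3)]
      N_smul[OF Fmod_N_minus[OF assms(2,4)]])

text \<open>Anticommutation of a contraction with itself gives square zero in the bosonic factor, so
  the composite vanishes whatever the fermionic factor is.\<close>

lemma H_square:
  assumes "i \<in> {1..N}" "v \<in> Mspace q m N n"
  shows "H_plus q m N n i (H_plus q m N n i v) = 0" "H_minus q m N n i (H_minus q m N n i v) = 0"
proof -
  have n: "n_plus m N i (n_plus m N i (sing b 1)) = 0" "n_minus m N i (n_minus m N i (sing b 1)) = 0"
    if "b \<in> pbasis m N" for b
    using n_plus_anticomm[OF mN sing_PCl[OF that] assms(1,1)]
      n_minus_anticomm[OF mN assms(1,1) sing_PCl[OF that]] by (metis self_neg_eq_0)+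
  show "H_plus q m N n i (H_plus q m N n i v) = 0"
    by (rule mtot_eqI[OF assms(2), where f = "\<lambda>v. H_plus q m N n i (H_plus q m N n i v)" and g = "\<lambda>v. 0"])
      (simp_all add: H_plus_add H_plus_H_plus_single[OF assms(1,1)] n)
  show "H_minus q m N n i (H_minus q m N n i v) = 0"
    by (rule mtot_eqI[OF assms(2), where f = "\<lambda>v. H_minus q m N n i (H_minus q m N n i v)" and g = "\<lambda>v. 0"])
      (simp_all add: H_minus_add H_minus_H_minus_single[OF assms(1,1)] n)
qed

text \<open>Interchanging the labels gives one minus sign from the contractions and one from the
  fermionic operators. The degrees are those of the original basis element in both orders.\<close>

lemma H_commute:
  assumes "i \<in> {1..N}" "j \<in> {1..N}" "i \<noteq> j" "v \<in> Mspace q m N n"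
  shows "H_plus q m N n i (H_plus q m N n j v) = H_plus q m N n j (H_plus q m N n i v)"
    "H_plus q m N n i (H_minus q m N n j v) = H_minus q m N n j (H_plus q m N n i v)"
    "H_minus q m N n i (H_minus q m N n j v) = H_minus q m N n j (H_minus q m N n i v)"
proof -
  have ji: "j \<noteq> i" using assms(3) by simp
  show "H_plus q m N n i (H_plus q m N n j v) = H_plus q m N n j (H_plus q m N n i v)"
  proof (rule mtot_eqI[OF assms(4), where f = "\<lambda>v. H_plus q m N n i (H_plus q m N n j v)"
        and g = "\<lambda>v. H_plus q m N n j (H_plus q m N n i v)"])
    fix b u assume b: "b \<in> pbasis m N" and u: "u \<in> Fmod q m N n"
    show "H_plus q m N n i (H_plus q m N n j (sing b u)) = H_plus q m N n j (H_plus q m N n i (sing b u))"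
      unfolding H_plus_H_plus_single[OF assms(1,2) b u] H_plus_H_plus_single[OF assms(2,1) b u]
        n_plus_anticomm[OF mN sing_PCl[OF b] assms(1,2)] N_anticomm(1)[OF u assms(1-3)] tens_minus
      by simp
  qed (simp_all add: H_plus_add)
  show "H_plus q m N n i (H_minus q m N n j v) = H_minus q m N n j (H_plus q m N n i v)"
  proof (rule mtot_eqI[OF assms(4), where f = "\<lambda>v. H_plus q m N n i (H_minus q m N n j v)"
        and g = "\<lambda>v. H_minus q m N n j (H_plus q m N n i v)"])
    fix b u assume b: "b \<in> pbasis m N" and u: "u \<in> Fmod q m N n"
    show "H_plus q m N n i (H_minus q m N n j (sing b u)) = H_minus q m N n j (H_plus q m N n i (sing b u))"
      unfolding H_plus_H_minus_single[OF assms(1-3) b u] H_minus_H_plus_single[OF assms(2,1) ji b u]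
        n_plus_n_minus[OF mN assms(1,2) sing_PCl[OF b]] N_anticomm(2)[OF u assms(1-3)] tens_minus
      by simp
  qed (simp_all add: H_plus_add H_minus_add)
  show "H_minus q m N n i (H_minus q m N n j v) = H_minus q m N n j (H_minus q m N n i v)"
  proof (rule mtot_eqI[OF assms(4), where f = "\<lambda>v. H_minus q m N n i (H_minus q m N n j v)"
        and g = "\<lambda>v. H_minus q m N n j (H_minus q m N n i v)"])
    fix b u assume b: "b \<in> pbasis m N" and u: "u \<in> Fmod q m N n"
    show "H_minus q m N n i (H_minus q m N n j (sing b u)) = H_minus q m N n j (H_minus q m N n i (sing b u))"
      unfolding H_minus_H_minus_single[OF assms(1,2) b u] H_minus_H_minus_single[OF assms(2,1) b u]
        n_minus_anticomm[OF mN assms(1,2) sing_PCl[OF b]] N_anticomm(3)[OF u assms(1-3)] tens_minus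
      by simp
  qed (simp_all add: H_minus_add)
qed

end

lemma dirac_PCl: "F \<in> PCl m N \<Longrightarrow> dirac m k F \<in> PCl m N"
  unfolding dirac_def by (intro PCl_sum PCl_pmul PCl_witt PCl_elementary)

lemma A_plus_Mspace:
  assumes "k \<in> {1..N}" "v \<in> Mspace q m N n"
  shows "A_plus q m n k v \<in> Mspace q m N n"
  unfolding A_plus_def
  by (intro Mspace_add Mspace_gtens[OF assms(2)]) (simp_all add: dirac_PCl sing_PCl Fmod_Q_plus[OF assms(1)])

lemma mdag_Mspace: "v \<in> Mspace q m N n \<Longrightarrow> mdag v \<in> Mspace q m N n"
  unfolding mdag_def
  by (intro Mspace_sum Mspace_tens pdag_PCl sing_PCl Fmod_fdag) (auto simp: Mspace_iff)

lemma A_minus_Mspace: "k \<in> {1..N} \<Longrightarrow> v \<in> Mspace q m N n \<Longrightarrow> A_minus q m n k v \<in> Mspace q m N n"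
  by (simp add: A_minus_def mdag_Mspace A_plus_Mspace)

section \<open>Ordered products of commuting endomorphisms of a subgroup\<close>

section \<open>Compositions of families of maps\<close>

lemma comp_list_simps [simp]: "comp_list f [] v = v" "comp_list f (x # xs) v = f x (comp_list f xs v)"
  by (simp_all add: comp_list_def)

lemma comp_list_append: "comp_list f (xs @ ys) v = comp_list f xs (comp_list f ys v)"
  by (induction xs) simp_all

lemma comp_list_in:
  assumes "\<And>i v. i \<in> set xs \<Longrightarrow> v \<in> S \<Longrightarrow> f i v \<in> S" "v \<in> S"
  shows "comp_list f xs v \<in> S"
  using assms by (induction xs) auto

lemma comp_list_commute:
  assumes "\<And>i v. i \<in> set xs \<Longrightarrow> v \<in> S \<Longrightarrow> f i v \<in> S"
    and "\<And>i v. i \<in> set xs \<Longrightarrow> v \<in> S \<Longrightarrow> g (f i v) = f i (g v)" and "v \<in> S"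
  shows "g (comp_list f xs v) = comp_list f xs (g v)"
  using assms by (induction xs) (simp_all add: comp_list_in[where S = S])

text \<open>The map \<open>g x\<close> is moved left through the \<open>f i\<close> of the remaining
  list and stops next to \<open>f x\<close>. Only maps of different indices pass each other, so
  \<open>f x\<close> and \<open>g x\<close> keep their order.\<close>

lemma comp_list_mult:
  assumes "distinct xs"
    and "\<And>i v. i \<in> set xs \<Longrightarrow> v \<in> S \<Longrightarrow> f i v \<in> S" "\<And>i v. i \<in> set xs \<Longrightarrow> v \<in> S \<Longrightarrow> g i v \<in> S"
    and "\<And>i j v. i \<in> set xs \<Longrightarrow> j \<in> set xs \<Longrightarrow> i \<noteq> j \<Longrightarrow> v \<in> S \<Longrightarrow> f i (g j v) = g j (f i v)"
    and "v \<in> S"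
  shows "comp_list f xs (comp_list g xs v) = comp_list (\<lambda>i w. f i (g i w)) xs v"
  using assms
proof (induction xs)
  case (Cons x xs)
  have G: "comp_list g xs v \<in> S" by (rule comp_list_in[where S = S]) (use Cons.prems in auto)
  have c: "g x (f i w) = f i (g x w)" if "i \<in> set xs" "w \<in> S" for i w
    using that Cons.prems(1) by (intro Cons.prems(4)[symmetric]) auto
  have "comp_list f xs (g x (comp_list g xs v)) = g x (comp_list f xs (comp_list g xs v))"
    by (rule comp_list_commute[where S = S, symmetric]) (use Cons.prems(2) G c in auto)
  also have "comp_list f xs (comp_list g xs v) = comp_list (\<lambda>i w. f i (g i w)) xs v"
    by (rule Cons.IH) (use Cons.prems in auto)
  finally show ?case by simp
qed simp

text \<open>In the reversed order the factors cancel from the inside in adjacent pairs, without any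
  commutation.\<close>

lemma comp_list_inverse:
  assumes "\<And>i v. i \<in> set xs \<Longrightarrow> v \<in> S \<Longrightarrow> g i v \<in> S"
    and "\<And>i v. i \<in> set xs \<Longrightarrow> v \<in> S \<Longrightarrow> f i (g i v) = v" and "v \<in> S"
  shows "comp_list f xs (comp_list g (rev xs) v) = v"
  using assms
  by (induction xs arbitrary: v) (simp_all add: comp_list_append comp_list_in[where S = S])

definition endo :: "'v::ab_group_add set \<Rightarrow> ('v \<Rightarrow> 'v) \<Rightarrow> bool" where
  "endo S f \<longleftrightarrow> (\<forall>v\<in>S. f v \<in> S) \<and> (\<forall>v\<in>S. \<forall>w\<in>S. f (v + w) = f v + f w)"

lemma endo_in: "endo S f \<Longrightarrow> v \<in> S \<Longrightarrow> f v \<in> S"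
  by (simp add: endo_def)

lemma endo_add: "endo S f \<Longrightarrow> v \<in> S \<Longrightarrow> w \<in> S \<Longrightarrow> f (v + w) = f v + f w"
  by (simp add: endo_def)

lemma endo_comp: "endo S f \<Longrightarrow> endo S g \<Longrightarrow> endo S (\<lambda>v. f (g v))"
  by (simp add: endo_def)

locale subgroup_of =
  fixes S :: "'v::ab_group_add set"
  assumes zero_in: "0 \<in> S" and add_in: "v \<in> S \<Longrightarrow> w \<in> S \<Longrightarrow> v + w \<in> S"
    and uminus_in: "v \<in> S \<Longrightarrow> - v \<in> S"
begin

lemma diff_in: "v \<in> S \<Longrightarrow> w \<in> S \<Longrightarrow> v - w \<in> S"
  using add_in[of v "- w"] uminus_in[of w] by simp

lemma sum_in: "(\<And>i. i \<in> I \<Longrightarrow> f i \<in> S) \<Longrightarrow> sum f I \<in> S"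
  by (induction I rule: infinite_finite_induct) (simp_all add: zero_in add_in)

lemma endo_zero: "endo S f \<Longrightarrow> f 0 = 0"
  using endo_add[of S f 0 0] zero_in by simp

lemma endo_uminus: "endo S f \<Longrightarrow> v \<in> S \<Longrightarrow> f (- v) = - f v"
  using endo_add[of S f v "- v"] by (simp add: endo_zero uminus_in eq_neg_iff_add_eq_0 add.commute)

lemma endo_diff: "endo S f \<Longrightarrow> v \<in> S \<Longrightarrow> w \<in> S \<Longrightarrow> f (v - w) = f v - f w"
  using endo_add[of S f v "- w"] by (simp add: endo_uminus uminus_in)

lemma endo_sum:
  assumes "endo S f" "\<And>i. i \<in> I \<Longrightarrow> g i \<in> S"
  shows "f (sum g I) = (\<Sum>i\<in>I. f (g i))"
  using assms(2)
  by (induction I rule: infinite_finite_induct) (simp_all add: endo_zero[OF assms(1)] endo_add[OF assms(1)] sum_in)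

lemma endo_one_plus: "endo S f \<Longrightarrow> endo S (\<lambda>v. v + f v)"
  by (simp add: endo_def add_in algebra_simps)

lemma endo_one_minus: "endo S f \<Longrightarrow> endo S (\<lambda>v. v - f v)"
  by (simp add: endo_def diff_in algebra_simps)

text \<open>Bundles commutation with \<open>endo\<close>, so that the relation passes to
  \<open>1 + f\<close>, \<open>1 - f\<close> and composites by rules alone.\<close>

definition commute_on :: "('v \<Rightarrow> 'v) \<Rightarrow> ('v \<Rightarrow> 'v) \<Rightarrow> bool" where
  "commute_on f g \<longleftrightarrow> endo S f \<and> endo S g \<and> (\<forall>v\<in>S. f (g v) = g (f v))"

lemma commute_onD: "commute_on f g \<Longrightarrow> v \<in> S \<Longrightarrow> f (g v) = g (f v)"
  by (simp add: commute_on_def)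

lemma commute_on_one:
  assumes "commute_on f g"
  shows "commute_on (\<lambda>v. v + f v) g" "commute_on (\<lambda>v. v - f v) g"
    "commute_on f (\<lambda>v. v + g v)" "commute_on f (\<lambda>v. v - g v)"
  using assms
  by (auto simp: commute_on_def endo_one_plus endo_one_minus endo_in endo_add[of S f] endo_add[of S g]
      endo_diff[of f] endo_diff[of g])

lemma commute_on_comp:
  "commute_on f g \<Longrightarrow> commute_on f h \<Longrightarrow> commute_on f (\<lambda>v. g (h v))"
  "commute_on f h \<Longrightarrow> commute_on g h \<Longrightarrow> commute_on (\<lambda>v. f (g v)) h"
  by (simp_all add: commute_on_def endo_comp endo_in)

end

text \<open>Replaces the \<open>inv_into\<close> of the definitions by an explicit inverse on
  \<open>S\<close>.\<close>

lemma bij_betw_inverse: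
  assumes "\<And>v. v \<in> S \<Longrightarrow> f v \<in> S" "\<And>v. v \<in> S \<Longrightarrow> g v \<in> S"
    and "\<And>v. v \<in> S \<Longrightarrow> g (f v) = v" "\<And>v. v \<in> S \<Longrightarrow> f (g v) = v"
  shows "bij_betw f S S" "v \<in> S \<Longrightarrow> inv_into S f v = g v"
proof -
  show b: "bij_betw f S S"
    by (rule bij_betw_byWitness[where f' = g]) (use assms in auto)
  show "inv_into S f v = g v" if "v \<in> S"
    by (rule inv_into_f_eq[OF bij_betw_imp_inj_on[OF b]]) (use assms that in auto)
qed

section \<open>Products of the maps 1 + K as conjugations, and their expansion over subsets\<close>

section \<open>Expansion of a product of commuting conjugations\<close>

text \<open>The maps \<open>K i\<close> are only known on \<open>S\<close>; on operators \<open>X\<close> preserving \<open>S\<close> they are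
  \<open>Ad(R\<^sub>i) - 1\<close>.\<close>

locale conjugations = subgroup_of S for S :: "'v::ab_group_add set" +
  fixes L :: "nat set" and R Ri :: "nat \<Rightarrow> 'v \<Rightarrow> 'v" and K :: "nat \<Rightarrow> ('v \<Rightarrow> 'v) \<Rightarrow> 'v \<Rightarrow> 'v"
  assumes R: "i \<in> L \<Longrightarrow> endo S (R i)" and Ri: "i \<in> L \<Longrightarrow> endo S (Ri i)"
    and R_comm: "i \<in> L \<Longrightarrow> j \<in> L \<Longrightarrow> i \<noteq> j \<Longrightarrow> v \<in> S \<Longrightarrow> R i (R j v) = R j (R i v)"
    and Ri_comm: "i \<in> L \<Longrightarrow> j \<in> L \<Longrightarrow> i \<noteq> j \<Longrightarrow> v \<in> S \<Longrightarrow> Ri i (Ri j v) = Ri j (Ri i v)"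
    and K: "i \<in> L \<Longrightarrow> v \<in> S \<Longrightarrow> K i X v = R i (X (Ri i v)) - X v"
begin

definition preserves :: "('v \<Rightarrow> 'v) \<Rightarrow> bool" where
  "preserves X \<longleftrightarrow> (\<forall>v\<in>S. X v \<in> S)"

lemma preserves_K: "i \<in> L \<Longrightarrow> preserves X \<Longrightarrow> preserves (K i X)"
  by (auto simp: preserves_def K intro!: diff_in endo_in[OF R] endo_in[OF Ri])

lemma preserves_comp_list: "set is \<subseteq> L \<Longrightarrow> preserves X \<Longrightarrow> preserves (comp_list K is X)"
  by (induction "is") (simp_all add: preserves_K)

text \<open>On \<open>S\<close> the value of \<open>K i X\<close> depends only on \<open>X\<close>
  restricted to \<open>S\<close>. This allows rewriting inside \<open>K\<close> with equations known
  on \<open>S\<close> only.\<close>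

lemma K_cong: "i \<in> L \<Longrightarrow> (\<And>v. v \<in> S \<Longrightarrow> X v = Y v) \<Longrightarrow> v \<in> S \<Longrightarrow> K i X v = K i Y v"
  by (simp add: K endo_in[OF Ri])

lemma K_sum:
  assumes "i \<in> L" "\<And>x. x \<in> A \<Longrightarrow> preserves (X x)" "v \<in> S"
  shows "K i (\<lambda>w. \<Sum>x\<in>A. X x w) v = (\<Sum>x\<in>A. K i (X x) v)"
  using assms
  by (simp add: K sum_subtractf endo_sum[OF R] preserves_def endo_in[OF Ri])

text \<open>Expanding both sides gives \<open>X\<close>, minus the two single conjugates, plus the
  double conjugate, which is symmetric in \<open>i\<close> and \<open>j\<close> because the
  \<open>R\<close> and their inverses commute.\<close>

lemma K_commute:
  assumes "i \<in> L" "j \<in> L" "preserves X" "v \<in> S"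
  shows "K i (K j X) v = K j (K i X) v"
proof (cases "i = j")
  case False
  have in_S: "Ri i v \<in> S" "Ri j v \<in> S" "Ri j (Ri i v) \<in> S"
    using assms by (auto intro: endo_in[OF Ri])
  have XS: "X w \<in> S" if "w \<in> S" for w using assms(3) that by (simp add: preserves_def)
  have "R i (R j (X (Ri j (Ri i v)))) = R j (R i (X (Ri i (Ri j v))))"
    using R_comm[OF assms(1,2) False XS[OF in_S(3)]] Ri_comm[OF assms(1,2) False assms(4)] by simp
  then show ?thesis
    using assms(1,2,4) in_S XS
    by (simp add: K endo_diff[OF R] endo_in[OF R] endo_in[OF Ri])
qed simp

lemma comp_list_K_move:
  assumes "set is \<subseteq> L" "i \<in> L" "preserves X" "v \<in> S"
  shows "comp_list K is (K i X) v = K i (comp_list K is X) v"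
  using assms(1,4)
proof (induction "is" arbitrary: v)
  case (Cons j "is")
  then have "comp_list K (j # is) (K i X) v = K j (K i (comp_list K is X)) v"
    by (simp add: K_cong[of j "comp_list K is (K i X)" "K i (comp_list K is X)"])
  also have "\<dots> = K i (K j (comp_list K is X)) v"
    by (rule K_commute) (use Cons.prems assms preserves_comp_list in auto)
  finally show ?case by simp
qed simp

text \<open>The head of the first list is located in the second and pulled to its front by
  \<open>comp_list_K_move\<close>; the rest is induction.\<close>

lemma comp_list_K_perm:
  assumes "distinct is" "distinct js" "set is = set js" "set is \<subseteq> L" "preserves X" "v \<in> S"
  shows "comp_list K is X v = comp_list K js X v"
  using assms
proof (induction "is" arbitrary: js v)
  case (Cons i "is")
  then obtain js1 js2 where js: "js = js1 @ i # js2"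
    by (metis list.set_intros(1) split_list)
  have L: "set is \<subseteq> L" "set js1 \<subseteq> L" "set js2 \<subseteq> L" "i \<in> L"
    using Cons.prems js by auto
  have "comp_list K (i # is) X v = K i (comp_list K (js1 @ js2) X) v"
    using Cons.prems by (auto simp: js intro!: K_cong Cons.IH)
  also have "\<dots> = K i (comp_list K js1 (comp_list K js2 X)) v"
    by (simp add: comp_list_append)
  also have "\<dots> = comp_list K js1 (K i (comp_list K js2 X)) v"
    using L Cons.prems by (intro comp_list_K_move[symmetric] preserves_comp_list) auto
  finally show ?case by (simp add: js comp_list_append)
qed simp

text \<open>On \<open>S\<close>, \<open>X + K i X\<close> is the conjugate of \<open>X\<close> by
  \<open>R i\<close>; iterated conjugation is conjugation by the product, with the inverses in
  reversed order.\<close>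

lemma comp_list_conj:
  assumes "set is \<subseteq> L" "preserves X" "v \<in> S"
  shows "comp_list (\<lambda>i X w. X w + K i X w) is X v = comp_list R is (X (comp_list Ri (rev is) v))"
  using assms(1,3)
proof (induction "is" arbitrary: v)
  case (Cons i "is")
  have i: "i \<in> L" "Ri i v \<in> S" using Cons.prems endo_in[OF Ri] by auto
  have "comp_list (\<lambda>i X w. X w + K i X w) (i # is) X v =
      R i (comp_list (\<lambda>i X w. X w + K i X w) is X (Ri i v))"
    by (simp add: K[OF i(1) Cons.prems(2)])
  also have "\<dots> = R i (comp_list R is (X (comp_list Ri (rev is) (Ri i v))))"
    using Cons i by simp
  finally show ?case by (simp add: comp_list_append)
qed simp

text \<open>Subsets of \<open>i # is\<close> are split by whether they contain \<open>i\<close>.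
  Sortedness makes \<open>i\<close> the least element, so inserting it into a subset puts
  \<open>K i\<close> in front of the corresponding product.\<close>

lemma comp_list_expand:
  assumes "sorted is" "distinct is" "set is \<subseteq> L" "preserves X" "v \<in> S"
  shows "comp_list (\<lambda>i X w. X w + K i X w) is X v =
    (\<Sum>I\<in>Pow (set is). comp_list K (sorted_list_of_set I) X v)"
  using assms(1-3,5)
proof (induction "is" arbitrary: v)
  case (Cons i "is")
  let ?Y = "comp_list (\<lambda>i X w. X w + K i X w) is X"
  let ?P = "Pow (set is)"
  let ?s = "\<lambda>I. sorted_list_of_set I"
  have i: "i \<in> L" "i \<notin> set is" using Cons.prems by auto
  have IH: "?Y w = (\<Sum>I\<in>?P. comp_list K (?s I) X w)" if "w \<in> S" for w
    using Cons that by simp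
  have fin: "finite I" "set (?s I) \<subseteq> L" if "I \<in> ?P" for I
    using that Cons.prems finite_subset[of I "set is"] by auto
  have ins: "?s (insert i I) = i # ?s I" if "I \<in> ?P" for I
  proof -
    have "sorted (i # ?s I)" "distinct (i # ?s I)"
      using Cons.prems(1,2) fin(1)[OF that] that by auto
    then have "?s (set (i # ?s I)) = i # ?s I" by (rule sorted_list_of_set.idem_if_sorted_distinct)
    then show ?thesis using fin(1)[OF that] by simp
  qed
  have "K i ?Y v = K i (\<lambda>w. \<Sum>I\<in>?P. comp_list K (?s I) X w) v"
    by (rule K_cong[OF i(1) _ Cons.prems(4)]) (rule IH)
  also have "\<dots> = (\<Sum>I\<in>?P. K i (comp_list K (?s I) X) v)"
    by (rule K_sum[OF i(1) _ Cons.prems(4)]) (intro preserves_comp_list fin(2) assms(4))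
  also have "\<dots> = (\<Sum>I\<in>?P. comp_list K (?s (insert i I)) X v)"
    by (rule sum.cong) (simp_all add: ins)
  also have "\<dots> = (\<Sum>I\<in>insert i ` ?P. comp_list K (?s I) X v)"
    by (rule sum.reindex_cong[symmetric, where l = "insert i"])
      (use i(2) in \<open>auto simp: inj_on_def\<close>)
  finally have "comp_list (\<lambda>i X w. X w + K i X w) (i # is) X v =
      (\<Sum>I\<in>?P. comp_list K (?s I) X v) + (\<Sum>I\<in>insert i ` ?P. comp_list K (?s I) X v)"
    using IH[OF Cons.prems(4)] by simp
  also have "\<dots> = (\<Sum>I\<in>?P \<union> insert i ` ?P. comp_list K (?s I) X v)"
    by (rule sum.union_disjoint[symmetric]) (use i(2) in auto)
  finally show ?case by (simp add: Pow_insert)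
qed simp

end

section \<open>The exponential of a sum of commuting maps of square zero\<close>

section \<open>The exponentials\<close>

lemma op_exp_bounded:
  assumes "\<And>t. t > k \<Longrightarrow> (A ^^ t) v = 0"
  shows "op_exp A v = (\<Sum>t\<le>k. mscale (1 / fact t) ((A ^^ t) v))"
  unfolding op_exp_def
proof (rule sum.mono_neutral_left)
  show "{t. (A ^^ t) v \<noteq> 0} \<subseteq> {..k}" using assms by (auto simp: not_less[symmetric])
qed auto

lemma mscale_add_left: "mscale (c + d) v = mscale c v + mscale d v"
  by (rule poly_mapping_eqI) (simp add: coef_mscale lookup_add cst_add smul_add_left)

lemma mscale_zero_left: "mscale 0 v = 0"
  by (rule poly_mapping_eqI) (simp add: coef_mscale)

lemma mspace_subgroup: "subgroup_of (Mspace q m N n)"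
  by unfold_locales (auto intro: Mspace_add Mspace_uminus)

text \<open>Since \<open>H i\<close> has square zero and commutes with \<open>A\<close>, one has
  \<open>(A + H i)\<^sup>t = A\<^sup>t + t A\<^sup>t\<^sup>-\<^sup>1 H i\<close>, hence \<open>exp (A + H i) = exp A (1 + H i)\<close>.\<close>

lemma op_exp_sum:
  fixes H :: "nat \<Rightarrow> mtot \<Rightarrow> mtot"
  assumes "subgroup_of S" and endo: "\<And>i. i \<in> {1..N} \<Longrightarrow> endo S (H i)"
    and sq: "\<And>i v. i \<in> {1..N} \<Longrightarrow> v \<in> S \<Longrightarrow> H i (H i v) = 0"
    and comm: "\<And>i j v. i \<in> {1..N} \<Longrightarrow> j \<in> {1..N} \<Longrightarrow> i \<noteq> j \<Longrightarrow> v \<in> S \<Longrightarrow> H i (H j v) = H j (H i v)"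
    and v: "v \<in> S"
  shows "op_exp (\<lambda>v. \<Sum>i=1..N. H i v) v = comp_list (\<lambda>i v. v + H i v) [1..<Suc N] v"
proof -
  interpret subgroup_of S by (rule assms(1))
  define A where "A k = (\<lambda>v. \<Sum>i=1..k. H i v)" for k
  have eA: "endo S (A k)" if "k \<le> N" for k
    using that endo unfolding endo_def A_def
    by (auto simp: sum.distrib intro!: sum_in)
  have eAt: "endo S (A k ^^ t)" if "k \<le> N" for k t
  proof (induction t)
    case (Suc t)
    then show ?case using eA[OF that] by (simp add: endo_def)
  qed (simp add: endo_def)
  \<comment> \<open>The induction also carries the vanishing of the powers above \<open>k\<close>,
    which truncates the series, and is over all \<open>v\<close>, since it is applied to
    \<open>?h v\<close> and \<open>v + ?h v\<close> as well.\<close>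
  have "(\<forall>t>k. (A k ^^ t) v = 0) \<and>
      (\<Sum>t\<le>k. mscale (1 / fact t) ((A k ^^ t) v)) = comp_list (\<lambda>i v. v + H i v) [1..<Suc k] v"
    if "k \<le> N" "v \<in> S" for k v
    using that
  proof (induction k arbitrary: v)
    case 0
    have "(A 0 ^^ t) v = 0" if "t > 0" for t
      using that by (cases t) (simp_all add: A_def)
    then show ?case by simp
  next
    case (Suc k)
    let ?h = "H (Suc k)"
    have k: "k \<le> N" "Suc k \<in> {1..N}" using Suc.prems by auto
    have h: "endo S ?h" by (rule endo[OF k(2)])
    have hA: "?h (A k w) = A k (?h w)" if "w \<in> S" for w
    proof -
      have i: "i \<in> {1..N} \<and> i \<noteq> Suc k" if "i \<in> {1..k}" for i using that k(1) by auto
      have "?h (\<Sum>i=1..k. H i w) = (\<Sum>i=1..k. ?h (H i w))"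
        by (rule endo_sum[OF h]) (use i in \<open>blast intro: endo_in[OF endo] that\<close>)
      also have "\<dots> = (\<Sum>i=1..k. H i (?h w))"
        by (rule sum.cong[OF refl], rule comm[OF k(2) _ _ that]) (use i in blast)+
      finally show ?thesis by (simp add: A_def)
    qed
    have AS: "A (Suc k) w = A k w + ?h w" for w by (simp add: A_def)
    \<comment> \<open>For \<open>t = 0\<close> the truncated \<open>t - 1\<close> is harmless, since
      its coefficient is 0.\<close>
    have pow: "(A (Suc k) ^^ t) w = (A k ^^ t) w + mscale (of_nat t) ((A k ^^ (t - 1)) (?h w))"
      if "w \<in> S" for t w
      using that
    proof (induction t arbitrary: w)
      case 0
      then show ?case by (simp add: mscale_zero_left)
    next
      case (Suc t)
      have w: "A k w \<in> S" "?h w \<in> S" "A k w + ?h w \<in> S"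
        using Suc.prems endo_in[OF eA[OF k(1)]] endo_in[OF h] add_in by auto
      have hh: "?h (A k w + ?h w) = A k (?h w)"
        using w Suc.prems by (simp add: endo_add[OF h] hA sq[OF k(2)])
      have "(A (Suc k) ^^ Suc t) w = (A (Suc k) ^^ t) (A k w + ?h w)"
        by (simp add: funpow_swap1 AS)
      also have "\<dots> = (A k ^^ t) (A k w + ?h w) + mscale (of_nat t) ((A k ^^ (t - 1)) (A k (?h w)))"
        using Suc.IH[OF w(3)] by (simp add: hh)
      also have "(A k ^^ t) (A k w + ?h w) = (A k ^^ Suc t) w + (A k ^^ t) (?h w)"
        by (simp add: endo_add[OF eAt[OF k(1)] w(1,2)] funpow_swap1)
      also have "mscale (of_nat t) ((A k ^^ (t - 1)) (A k (?h w))) = mscale (of_nat t) ((A k ^^ t) (?h w))"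
        by (cases t) (simp_all add: mscale_zero_left funpow_swap1)
      finally show ?case
        by (simp add: mscale_add_left add.assoc)
    qed
    have hv: "?h v \<in> S" "v + ?h v \<in> S" using Suc.prems endo_in[OF h] add_in by auto
    note IH = Suc.IH[OF k(1)]
    have "(A (Suc k) ^^ t) v = 0" if "t > Suc k" for t
    proof -
      have "(A k ^^ t) v = 0" using IH[OF Suc.prems(2)] that by auto
      moreover have "(A k ^^ (t - 1)) (?h v) = 0" using IH[OF hv(1)] that by auto
      ultimately show ?thesis by (simp add: pow[OF Suc.prems(2)])
    qed
    moreover have "(\<Sum>t\<le>Suc k. mscale (1 / fact t) ((A (Suc k) ^^ t) v)) =
        comp_list (\<lambda>i v. v + H i v) [1..<Suc (Suc k)] v"
    proof -
      have "(\<Sum>t\<le>Suc k. mscale (1 / fact t) ((A (Suc k) ^^ t) v)) =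
          (\<Sum>t\<le>Suc k. mscale (1 / fact t) ((A k ^^ t) v)) +
          (\<Sum>t\<le>Suc k. mscale (of_nat t / fact t) ((A k ^^ (t - 1)) (?h v)))"
        by (simp add: pow[OF Suc.prems(2)] mscale_add mscale_mscale sum.distrib del: sum.atMost_Suc)
      also have "(\<Sum>t\<le>Suc k. mscale (1 / fact t) ((A k ^^ t) v)) =
          (\<Sum>t\<le>k. mscale (1 / fact t) ((A k ^^ t) v))"
      proof -
        have "(A k ^^ Suc k) v = 0" using IH[OF Suc.prems(2)] by blast
        then show ?thesis unfolding sum.atMost_Suc by (simp only: mscale_simps add_0_right)
      qed
      \<comment> \<open>The term \<open>t = 0\<close> vanishes, and \<open>t / t!\<close> is
        \<open>1 / (t - 1)!\<close>, so the index shift gives the exponential series applied to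
        \<open>?h v\<close>.\<close>
      also have "(\<Sum>t\<le>Suc k. mscale (of_nat t / fact t) ((A k ^^ (t - 1)) (?h v))) =
          (\<Sum>t\<le>k. mscale (1 / fact t) ((A k ^^ t) (?h v)))"
      proof -
        have "(of_nat (Suc t) :: complex) / fact (Suc t) = 1 / fact t" for t
          by (simp add: divide_simps del: of_nat_Suc)
        then show ?thesis unfolding sum.atMost_Suc_shift by (simp add: mscale_zero_left del: fact_Suc of_nat_Suc)
      qed
      also have "(\<Sum>t\<le>k. mscale (1 / fact t) ((A k ^^ t) v)) + \<dots> =
          (\<Sum>t\<le>k. mscale (1 / fact t) ((A k ^^ t) (v + ?h v)))"
        by (simp add: endo_add[OF eAt[OF k(1)] Suc.prems(2) hv(1)] mscale_add sum.distrib)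
      also have "\<dots> = comp_list (\<lambda>i v. v + H i v) [1..<Suc k] (v + ?h v)"
        using IH[OF hv(2)] by simp
      finally show ?thesis by (simp add: comp_list_append)
    qed
    ultimately show ?case by blast
  qed
  from this[OF order_refl v] show ?thesis
    using op_exp_bounded[of N "A N" v] by (simp add: A_def)
qed

section \<open>Explicit inverses, regrouping by label, and the expansion of Omega\<close>

section \<open>The labelwise conjugations\<close>

context
  fixes q :: real and m N n :: nat
  assumes mN: "N \<le> m"
begin

private abbreviation (input) "V \<equiv> Mspace q m N n"
private abbreviation (input) "Hp \<equiv> H_plus q m N n"
private abbreviation (input) "Hm \<equiv> H_minus q m N n"

text \<open>The product of \<open>1 + Hm i\<close> and \<open>1 - Hp i\<close>: square zero means
  that each factor of \<open>R_lab\<close> is inverted by a change of sign, and the order of the two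
  factors is reversed.\<close>

definition R_inv :: "nat \<Rightarrow> mtot \<Rightarrow> mtot" where
  "R_inv i v = (v - Hp i v) + Hm i (v - Hp i v)"

interpretation subgroup_of V
  by (rule mspace_subgroup)

lemma endo_H: "i \<in> {1..N} \<Longrightarrow> endo V (Hp i)" "i \<in> {1..N} \<Longrightarrow> endo V (Hm i)"
  by (auto simp: endo_def H_plus_add H_minus_add intro: H_plus_Mspace[OF mN] H_minus_Mspace[OF mN])

lemma commute_on_H:
  assumes "i \<in> {1..N}" "j \<in> {1..N}" "i \<noteq> j"
  shows "commute_on (Hp i) (Hp j)" "commute_on (Hp i) (Hm j)" "commute_on (Hm i) (Hp j)"
    "commute_on (Hm i) (Hm j)"
  unfolding commute_on_def
  by (intro conjI ballI endo_H assms H_commute[OF mN assms]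
      H_commute(2)[OF mN assms(2,1) not_sym[OF assms(3)], symmetric]; assumption)+

lemma R_lab_eq: "R_lab q m N n i v = (v - Hm i v) + Hp i (v - Hm i v)"
  by (simp add: R_lab_def)

lemma endo_R: "i \<in> {1..N} \<Longrightarrow> endo V (R_lab q m N n i)" "i \<in> {1..N} \<Longrightarrow> endo V (R_inv i)"
  unfolding R_lab_eq[abs_def] R_inv_def[abs_def]
  by (rule endo_comp[of V "\<lambda>v. v + Hp i v" "\<lambda>v. v - Hm i v"]
        endo_comp[of V "\<lambda>v. v + Hm i v" "\<lambda>v. v - Hp i v"];
      intro endo_one_plus endo_one_minus endo_H; assumption)+

lemma commute_on_R:
  assumes "i \<in> {1..N}" "j \<in> {1..N}" "i \<noteq> j"
  shows "commute_on (R_lab q m N n i) (R_lab q m N n j)" "commute_on (R_inv i) (R_inv j)"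
  unfolding R_lab_eq[abs_def] R_inv_def[abs_def]
  by (rule commute_on_comp(1)[where g = "\<lambda>v. v + _ v" and h = "\<lambda>v. v - _ v"];
      rule commute_on_comp(2)[where f = "\<lambda>v. v + _ v" and g = "\<lambda>v. v - _ v"];
      intro commute_on_one commute_on_H assms)+

lemma one_plus_minus:
  assumes "i \<in> {1..N}" "v \<in> V"
  shows "(v - Hp i v) + Hp i (v - Hp i v) = v" "(v + Hp i v) - Hp i (v + Hp i v) = v"
    "(v - Hm i v) + Hm i (v - Hm i v) = v" "(v + Hm i v) - Hm i (v + Hm i v) = v"
  using assms endo_in[OF endo_H(1), of i v] endo_in[OF endo_H(2), of i v] H_square[OF mN assms]
  by (simp_all add: endo_diff[OF endo_H(1)] endo_diff[OF endo_H(2)] H_plus_add H_minus_add)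

lemma R_lab_inverse:
  assumes i: "i \<in> {1..N}" and v: "v \<in> V"
  shows "R_lab q m N n i (R_inv i v) = v" "R_inv i (R_lab q m N n i v) = v"
proof -
  have 1: "v - Hp i v \<in> V" "v - Hm i v \<in> V"
    using v endo_in[OF endo_H(1)[OF i] v] endo_in[OF endo_H(2)[OF i] v] by (simp_all add: diff_in)
  show "R_lab q m N n i (R_inv i v) = v"
    unfolding R_lab_eq R_inv_def one_plus_minus(4)[OF i 1(1)] by (rule one_plus_minus(1)[OF i v])
  show "R_inv i (R_lab q m N n i v) = v"
    unfolding R_lab_eq R_inv_def one_plus_minus(2)[OF i 1(2)] by (rule one_plus_minus(3)[OF i v])
qed

lemma bij_R_lab:
  assumes "i \<in> {1..N}"
  shows "bij_betw (R_lab q m N n i) V V" "v \<in> V \<Longrightarrow> inv_into V (R_lab q m N n i) v = R_inv i v"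
  by (rule bij_betw_inverse[where g = "R_inv i"];
      use assms in \<open>auto intro: endo_in[OF endo_R(1)] endo_in[OF endo_R(2)] simp: R_lab_inverse\<close>)+

lemma U_plus_eq: "v \<in> V \<Longrightarrow> U_plus q m N n v = comp_list (\<lambda>i v. v + Hp i v) [1..<Suc N] v"
  unfolding U_plus_def
  by (rule op_exp_sum[OF mspace_subgroup endo_H(1) H_square(1)[OF mN] commute_onD[OF commute_on_H(1)]])

lemma U_minus_eq: "v \<in> V \<Longrightarrow> U_minus q m N n v = comp_list (\<lambda>i v. v + Hm i v) [1..<Suc N] v"
  unfolding U_minus_def
  by (rule op_exp_sum[OF mspace_subgroup endo_H(2) H_square(2)[OF mN] commute_onD[OF commute_on_H(4)]])

lemma one_H_in: "i \<in> set [1..<Suc N] \<Longrightarrow> v \<in> V \<Longrightarrow> v + Hp i v \<in> V"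
  "i \<in> set [1..<Suc N] \<Longrightarrow> v \<in> V \<Longrightarrow> v + Hm i v \<in> V"
  "i \<in> set [1..<Suc N] \<Longrightarrow> v \<in> V \<Longrightarrow> v - Hm i v \<in> V"
  using endo_in[OF endo_one_plus[OF endo_H(1)], of i v] endo_in[OF endo_one_plus[OF endo_H(2)], of i v]
    endo_in[OF endo_one_minus[OF endo_H(2)], of i v]
  by (auto simp: less_Suc_eq_le)

lemma comp_list_id: "(\<And>i v. i \<in> set xs \<Longrightarrow> v \<in> V \<Longrightarrow> f i v = v) \<Longrightarrow> v \<in> V \<Longrightarrow> comp_list f xs v = v"
  by (induction xs) simp_all

lemma labels: "set [1..<Suc N] = {1..N}"
  by auto

text \<open>Pairing the factors label by label with \<open>comp_list_mult\<close> leaves products of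
  \<open>1 + Hm i\<close> and \<open>1 - Hm i\<close>, which are the identity by square
  zero.\<close>

lemma U_minus_inverse:
  assumes "v \<in> V"
  shows "comp_list (\<lambda>i v. v - Hm i v) [1..<Suc N] (U_minus q m N n v) = v"
    "U_minus q m N n (comp_list (\<lambda>i v. v - Hm i v) [1..<Suc N] v) = v"
proof -
  have c: "(w + Hm j w) - Hm i (w + Hm j w) = (w - Hm i w) + Hm j (w - Hm i w)"
    if "i \<in> set [1..<Suc N]" "j \<in> set [1..<Suc N]" "i \<noteq> j" "w \<in> V" for i j w
    using commute_onD[OF commute_on_one(2)[OF commute_on_one(3)[OF commute_on_H(4)]], of i j w] that
    unfolding labels by simp
  have "comp_list (\<lambda>i v. v - Hm i v) [1..<Suc N] (comp_list (\<lambda>i v. v + Hm i v) [1..<Suc N] v) =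
      comp_list (\<lambda>i v. (v + Hm i v) - Hm i (v + Hm i v)) [1..<Suc N] v"
    by (rule comp_list_mult[where S = V]) (use assms c one_H_in in auto)
  also have "\<dots> = v"
    by (rule comp_list_id) (use assms one_plus_minus(4) labels in auto)
  finally show "comp_list (\<lambda>i v. v - Hm i v) [1..<Suc N] (U_minus q m N n v) = v"
    by (simp only: U_minus_eq[OF assms])
  have M: "comp_list (\<lambda>i v. v - Hm i v) [1..<Suc N] v \<in> V"
    by (rule comp_list_in[where S = V]) (use assms one_H_in in auto)
  have "comp_list (\<lambda>i v. v + Hm i v) [1..<Suc N] (comp_list (\<lambda>i v. v - Hm i v) [1..<Suc N] v) =
      comp_list (\<lambda>i v. (v - Hm i v) + Hm i (v - Hm i v)) [1..<Suc N] v"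
    by (rule comp_list_mult[where S = V]) (use assms c[symmetric] one_H_in in auto)
  also have "\<dots> = v"
    by (rule comp_list_id) (use assms one_plus_minus(3) labels in auto)
  finally show "U_minus q m N n (comp_list (\<lambda>i v. v - Hm i v) [1..<Suc N] v) = v"
    by (simp only: U_minus_eq[OF M])
qed

lemma bij_U_minus:
  shows "bij_betw (U_minus q m N n) V V"
    "v \<in> V \<Longrightarrow> inv_into V (U_minus q m N n) v = comp_list (\<lambda>i v. v - Hm i v) [1..<Suc N] v"
proof -
  have a: "U_minus q m N n v \<in> V" if "v \<in> V" for v
    unfolding U_minus_eq[OF that] by (rule comp_list_in[where S = V]) (use that one_H_in in auto)
  have b: "comp_list (\<lambda>i v. v - Hm i v) [1..<Suc N] v \<in> V" if "v \<in> V" for v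
    by (rule comp_list_in[where S = V]) (use that one_H_in in auto)
  note c = bij_betw_inverse[of V "U_minus q m N n" "comp_list (\<lambda>i v. v - Hm i v) [1..<Suc N]",
      OF a b U_minus_inverse]
  show "bij_betw (U_minus q m N n) V V" by (rule c(1))
  show "v \<in> V \<Longrightarrow> inv_into V (U_minus q m N n) v = comp_list (\<lambda>i v. v - Hm i v) [1..<Suc N] v"
    by (rule c(2))
qed

text \<open>The factors \<open>1 - Hm i\<close> of the inverse exponential pass the factors
  \<open>1 + Hp j\<close> with \<open>j \<noteq> i\<close> until they meet their own label, which
  assembles the \<open>R_lab\<close>.\<close>

lemma R_q_eq:
  assumes "v \<in> V"
  shows "R_q q m N n v = comp_list (R_lab q m N n) [1..<Suc N] v"
proof -
  have M: "comp_list (\<lambda>i v. v - Hm i v) [1..<Suc N] v \<in> V"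
    by (rule comp_list_in[where S = V]) (use assms one_H_in in auto)
  have c: "(w - Hm j w) + Hp i (w - Hm j w) = (w + Hp i w) - Hm j (w + Hp i w)"
    if "i \<in> set [1..<Suc N]" "j \<in> set [1..<Suc N]" "i \<noteq> j" "w \<in> V" for i j w
    using commute_onD[OF commute_on_one(1)[OF commute_on_one(4)[OF commute_on_H(2)]], of i j w] that
    unfolding labels by simp
  have "R_q q m N n v = comp_list (\<lambda>i v. v + Hp i v) [1..<Suc N]
      (comp_list (\<lambda>i v. v - Hm i v) [1..<Suc N] v)"
    by (simp only: R_q_def o_apply bij_U_minus(2)[OF assms] U_plus_eq[OF M])
  also have "\<dots> = comp_list (\<lambda>i v. (v - Hm i v) + Hp i (v - Hm i v)) [1..<Suc N] v"
    by (rule comp_list_mult[where S = V]) (use assms c one_H_in in auto)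
  finally show ?thesis by (simp only: R_lab_eq[abs_def])
qed

lemma bij_R_q:
  shows "bij_betw (R_q q m N n) V V"
    "v \<in> V \<Longrightarrow> inv_into V (R_q q m N n) v = comp_list R_inv (rev [1..<Suc N]) v"
proof -
  have r: "R_lab q m N n i v \<in> V" "R_inv i v \<in> V" "R_lab q m N n i (R_inv i v) = v"
    "R_inv i (R_lab q m N n i v) = v" if "i \<in> set [1..<Suc N]" "v \<in> V" for i v
    using that endo_in[OF endo_R(1)] endo_in[OF endo_R(2)] R_lab_inverse unfolding labels by auto
  have R: "comp_list (R_lab q m N n) [1..<Suc N] v \<in> V" if "v \<in> V" for v
    by (rule comp_list_in[where S = V]) (use that r in auto)
  have Rq: "R_q q m N n v \<in> V" if "v \<in> V" for v
    unfolding R_q_eq[OF that] by (rule R[OF that])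
  have I: "comp_list R_inv (rev [1..<Suc N]) v \<in> V" if "v \<in> V" for v
    by (rule comp_list_in[where S = V]) (use that r in auto)
  have 1: "comp_list (R_lab q m N n) [1..<Suc N] (comp_list R_inv (rev [1..<Suc N]) v) = v"
    if "v \<in> V" for v
    by (rule comp_list_inverse[where S = V]) (use that r in auto)
  have 2: "comp_list R_inv (rev [1..<Suc N]) (comp_list (R_lab q m N n) [1..<Suc N] v) = v"
    if "v \<in> V" for v
    using comp_list_inverse[where S = V and f = R_inv and g = "R_lab q m N n"
        and xs = "rev [1..<Suc N]" and v = v] that r
    by (simp only: set_rev rev_rev_ident)
  note c = bij_betw_inverse[of V "R_q q m N n" "comp_list R_inv (rev [1..<Suc N])", OF Rq I]
  show "bij_betw (R_q q m N n) V V" by (rule c(1)) (simp_all only: R_q_eq 1 2 I)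
  show "v \<in> V \<Longrightarrow> inv_into V (R_q q m N n) v = comp_list R_inv (rev [1..<Suc N]) v"
    by (rule c(2)) (simp_all only: R_q_eq 1 2 I)
qed

interpretation conjugations V "{1..N}" "R_lab q m N n" R_inv "K_lab q m N n"
proof unfold_locales
  show "K_lab q m N n i X v = R_lab q m N n i (X (R_inv i v)) - X v"
    if "i \<in> {1..N}" "v \<in> V" for i X v
    by (simp only: K_lab_def bij_R_lab(2)[OF that])
qed (use endo_R commute_onD[OF commute_on_R(1)] commute_onD[OF commute_on_R(2)] in auto)

text \<open>Conjugation by \<open>R_q\<close> is the product of the \<open>1 + K_lab\<close>. In the
  expansion over subsets the empty set returns \<open>A_minus\<close> itself, which is
  subtracted.\<close>

lemma Omega_expansions:
  assumes j: "j \<in> {1..N}" and v: "v \<in> V"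
  shows "Omega q m N n j v =
      comp_list (\<lambda>i X w. X w + K_lab q m N n i X w) [1..<Suc N] (A_minus q m n j) v - A_minus q m n j v"
    and "Omega q m N n j v = (\<Sum>I\<in>Pow {1..N} - {{}}. K_set q m N n I (A_minus q m n j) v)"
    and "Omega q m N n j v = (\<Sum>i=1..N. K_lab q m N n i (A_minus q m n j) v) +
      (\<Sum>I | I \<subseteq> {1..N} \<and> 2 \<le> card I. K_set q m N n I (A_minus q m n j) v)"
proof -
  let ?A = "A_minus q m n j" and ?K = "\<lambda>I. K_set q m N n I (A_minus q m n j) v"
  have A: "preserves ?A" unfolding preserves_def using A_minus_Mspace[OF j] by blast
  have sub: "set [1..<Suc N] \<subseteq> {1..N}" by auto
  have "comp_list R_inv (rev [1..<Suc N]) v \<in> V"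
    by (rule comp_list_in[where S = V]) (use v in \<open>auto intro!: endo_in[OF endo_R(2)]\<close>)
  then have AV: "?A (comp_list R_inv (rev [1..<Suc N]) v) \<in> V"
    by (rule A_minus_Mspace[OF j])
  show 1: "Omega q m N n j v =
      comp_list (\<lambda>i X w. X w + K_lab q m N n i X w) [1..<Suc N] ?A v - ?A v"
    unfolding Omega_def bij_R_q(2)[OF v] R_q_eq[OF AV] comp_list_conj[OF sub A v] ..
  have "comp_list (\<lambda>i X w. X w + K_lab q m N n i X w) [1..<Suc N] ?A v = (\<Sum>I\<in>Pow {1..N}. ?K I)"
    unfolding K_set_def by (subst comp_list_expand[OF _ _ sub A v]) (simp_all only: labels sorted_upt distinct_upt)
  also have "\<dots> = ?K {} + (\<Sum>I\<in>Pow {1..N} - {{}}. ?K I)"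
    by (rule sum.remove) auto
  also have "?K {} = ?A v" by (simp add: K_set_def)
  finally show 2: "Omega q m N n j v = (\<Sum>I\<in>Pow {1..N} - {{}}. ?K I)"
    unfolding 1 by simp
  \<comment> \<open>Singletons give the labelwise defects; the other nonempty subsets are the terms
    of filtration at least 2.\<close>
  have split: "Pow {1..N} - {{}} = (\<lambda>i. {i}) ` {1..N} \<union> {I. I \<subseteq> {1..N} \<and> 2 \<le> card I}"
  proof (rule set_eqI)
    fix I :: "nat set"
    have "I \<in> (\<lambda>i. {i}) ` {1..N} \<longleftrightarrow> I \<subseteq> {1..N} \<and> card I = 1"
      by (auto elim!: card_1_singletonE)
    moreover have "card I \<noteq> 0 \<longleftrightarrow> I \<noteq> {}" if "I \<subseteq> {1..N}"
      using finite_subset[OF that] by simp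
    ultimately show "I \<in> Pow {1..N} - {{}} \<longleftrightarrow>
        I \<in> (\<lambda>i. {i}) ` {1..N} \<union> {I. I \<subseteq> {1..N} \<and> 2 \<le> card I}"
      by (cases "I \<subseteq> {1..N}") auto
  qed
  have "(\<Sum>I\<in>Pow {1..N} - {{}}. ?K I) =
      (\<Sum>I\<in>(\<lambda>i. {i}) ` {1..N}. ?K I) + (\<Sum>I | I \<subseteq> {1..N} \<and> 2 \<le> card I. ?K I)"
    unfolding split
  proof (rule sum.union_disjoint)
    show "finite {I. I \<subseteq> {1..N} \<and> 2 \<le> card I}"
      by (rule finite_subset[of _ "Pow {1..N}"]) blast+
  qed auto
  also have "(\<Sum>I\<in>(\<lambda>i. {i}) ` {1..N}. ?K I) = (\<Sum>i=1..N. K_lab q m N n i ?A v)"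
    by (subst sum.reindex) (auto simp: K_set_def)
  finally show "Omega q m N n j v = (\<Sum>i=1..N. K_lab q m N n i ?A v) +
      (\<Sum>I | I \<subseteq> {1..N} \<and> 2 \<le> card I. ?K I)"
    unfolding 2 .
qed

text \<open>\<open>K_set\<close> fixes the increasing order of labels; this shows that the choice is
  immaterial for every operator on the space.\<close>

lemma K_set_perm:
  assumes "distinct is" "set is \<subseteq> {1..N}" "is_operator q m N n X" "v \<in> V"
  shows "comp_list (K_lab q m N n) is X v = K_set q m N n (set is) X v"
  unfolding K_set_def
  by (rule comp_list_K_perm) (use assms in \<open>auto simp: preserves_def is_operator_def\<close>)

end

text \<open>The bijectivity clauses make the \<open>inv_into\<close> within \<open>R_q\<close>,
  \<open>K_lab\<close> and \<open>Omega\<close> two-sided inverses on \<open>Mspace\<close>, so the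
  equations speak of genuine conjugations there.\<close>

theorem theorem6p8:
  fixes q :: real and m N n :: nat
  assumes "0 < q" and "q < 1" and "N \<ge> 1" and "n \<ge> 1" and "m \<ge> 2 * N"
  shows
    "bij_betw (U_minus q m N n) (Mspace q m N n) (Mspace q m N n) \<and>
     bij_betw (R_q q m N n) (Mspace q m N n) (Mspace q m N n) \<and>
     (\<forall>i\<in>{1..N}. bij_betw (R_lab q m N n i) (Mspace q m N n) (Mspace q m N n)) \<and>
     (\<forall>j\<in>{1..N}. \<forall>v\<in>Mspace q m N n.
        Omega q m N n j v =
          comp_list (\<lambda>i X w. X w + K_lab q m N n i X w) [1..<Suc N] (A_minus q m n j) v
            - A_minus q m n j v \<and>
        Omega q m N n j v =
          (\<Sum>I\<in>Pow {1..N} - {{}}. K_set q m N n I (A_minus q m n j) v) \<and>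
        Omega q m N n j v =
          (\<Sum>i=1..N. K_lab q m N n i (A_minus q m n j) v) +
          (\<Sum>I | I \<subseteq> {1..N} \<and> 2 \<le> card I. K_set q m N n I (A_minus q m n j) v)) \<and>
     (\<forall>I is. I \<subseteq> {1..N} \<and> distinct is \<and> set is = I \<longrightarrow>
        (\<forall>X. is_operator q m N n X \<longrightarrow>
          (\<forall>v\<in>Mspace q m N n.
             comp_list (K_lab q m N n) is X v = K_set q m N n I X v)))"
proof -
  have mN: "N \<le> m" using assms(5) by simp
  show ?thesis
  proof (intro conjI ballI allI impI)
    fix I "is" X v
    assume "I \<subseteq> {1..N} \<and> distinct is \<and> set is = I" "is_operator q m N n X" "v \<in> Mspace q m N n"
    then show "comp_list (K_lab q m N n) is X v = K_set q m N n I X v"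
      using K_set_perm[OF mN] by blast
  qed (rule bij_U_minus(1)[OF mN] bij_R_q(1)[OF mN] bij_R_lab(1)[OF mN] Omega_expansions[OF mN];
      assumption)+
qed

end
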